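(* Let $n>1$ and let $\pi:P\to M$ be the almost CR quaternionic structure on the quaternionic Heisenberg group $M$ associated with $L\in U^\perp\otimes\Lambda^2 U^*$. Then the essential $(G,\widetilde G)$-curvature $\mathcal{R}^1:P\to H^{0,2}(\widetilde{\mathfrak g},W)$ is nonzero if and only if $L$ has a non-trivial component in $\Lambda^2 \mathbf{E}^*\otimes S^2\mathbf{H}\oplus\Lambda^2\mathbf{E}^*\otimes S^4\mathbf{H}$ and, in this case, $P$ is not induced by a local immersion in a quaternionic manifold and it is not quaternionic contact. Moreover there exists a $1$-parameter family of almost CR quaternionic structures $\pi:P_t\to M$, $t\geq 0$, such that $P_t$ is isomorphic to the standard quaternionic contact structure only at $t=0$.
   Context: Algebra. Let $V=\mathbb{H}^n$ with the quaternionic structure $Q=\mathrm{span}\{-R_i,-R_j,-R_k\}$ ($R_h$ = right multiplication). $\widetilde G=\mathrm{GL}_n(\mathbb{H})\cdot\mathrm{Sp}_1$ is the group of real linear automorphisms of $V$ preserving $Q$, $(A,h)$ acting by $v\mapsto Avh^{-1}$, and $\widetilde{\mathfrak g}=\mathfrak{gl}_n(\mathbb{H})\oplus\mathfrak{sp}_1\subset\mathfrak{gl}(V)$. Put $U=\mathbb{H}^{n-1}$, $U^\perp=\mathrm{Im}\,\mathbb{H}$, $W=U\oplus U^\perp\subset V$. $G$ is the subgroup of $\widetilde G$ preserving $W$; it acts faithfully on $W$ and is regarded as a subgroup of $\mathrm{GL}(W)$. The Levi factor $\mathfrak{sl}_{n-1}(\mathbb{H})\oplus\mathfrak{sp}_1$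 of $\mathrm{Lie}(G)$ is embedded in $\widetilde{\mathfrak g}$ by $(X,\xi)\mapsto(\mathrm{diag}(X,\xi),\xi)$; its complexification is $\mathfrak s=\mathfrak{sl}_{2n-2}(\mathbb{C})\oplus\mathfrak{sl}_2(\mathbb{C})$, with defining representations $\mathbf{E}=\mathbb{C}^{2n-2}$ and $\mathbf{H}=\mathbb{C}^2$. As $\mathfrak s$-modules (up to complexification) $$U^\perp\otimes\Lambda^2U^*\simeq\Lambda^2\mathbf{E}^*\oplus(\Lambda^2\mathbf{E}^*\oplus S^2\mathbf{E}^* )\otimes S^2\mathbf{H}\oplus\Lambda^2\mathbf{E}^*\otimes S^4\mathbf{H},$$ and "components" refer to this decomposition. $H^{0,2}(\widetilde{\mathfrak g},W)=V\otimes\Lambda^2W^*/\partial(\widetilde{\mathfrak g}\otimes W^* )$, where $\partial c(w_1,w_2)=-[c(w_2),w_1]+[c(w_1),w_2]$ and $[A,w]=A(w)$ for $A\in\widetilde{\mathfrak g}$. Geometry. A linear quaternionic structure on a real vector bundle $E$ of rank $4n$ is a subbundle of $\mathrm{End}(E)$ locally spanned by fields $(I_1,I_2,I_3)$ of anticommuting complex structures with $I_3=I_1I_2$. An almost quaternionic manifold is a $4n$-manifold $\widetilde M$ with a linear quaternionic structure on $T\widetilde M$; it is quaternionic if there is a torsion-free linear connection preserving it. An almost CR quaternionic structure on a manifold $M$ of dimension $4n-1$ is a codimension one embedding $\iota:TM\to E$ into a vector bundle $E$ with a linear quaternionic structure; equivalently it is a $G$-structure $\pi:P\to M$, where $P$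 consists of all frames $u:W\to T_xM$ such that $\iota\circ u$ extends to an isomorphism of quaternionic vector spaces $V\to E_x$. A hypersurface immersion $f:M\to\widetilde M$ induces the structure $df:TM\to f^*T\widetilde M$. Isomorphism of almost CR quaternionic structures means isomorphism of the corresponding $G$-structures. The essential $(G,\widetilde G)$-curvature $\mathcal R^1:P\to H^{0,2}(\widetilde{\mathfrak g},W)$ is the $G$-equivariant map given by $\mathcal R^1(s(x))=[d\omega^{-1}|_x]$ for every local section $s$ of $P$, where $\omega^{-1}$ is the $W$-valued coframe dual to $s$, i.e. $\omega^{-1}_x=s(x)^{-1}:T_xM\to W$, and $T_xM$ is identified with $W$ through $s(x)$, so that $d\omega^{-1}|_x\in W\otimes\Lambda^2W^*\subset V\otimes\Lambda^2W^*$. Structure associated with $L$. A real tensor $L\in U^\perp\otimes\Lambda^2U^*$ defines on $W=\mathfrak m=\mathfrak m_{-1}+\mathfrak m_{-2}$, $\mathfrak m_{-1}=U$, $\mathfrak m_{-2}=U^\perp$, a $2$-step nilpotent graded Lie algebra structure, whose only possibly nonzero brackets are $[x,y]=L(x,y)$ for $x,y\in U$. The associated connected simply connected Lie group is, as a smooth manifold, the $(4n-1)$-dimensional quaternionic Heisenberg group $M$. The left-invariant vector fields for this group structure give a global frame $s:M\to\mathrm{Fr}(M)$ (identifying $W=\mathfrak m$ with each $T_xM$), with image $P'=s(M)$, and the associated almost CR quaternionic structure is $P=P'\cdot G$. The standard quaternionic contact structure on $M$ is the one associated with the quaternionic Heisenberg bracket $L_o(x,y)=\mathrm{Im}(\bar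 x^{t}y)$, which lies in the component $\Lambda^2\mathbf{E}^*$. Quaternionic contact: for an almost CR quaternionic structure $P$ on $M$ let $\mathcal D\subset TM$ be the rank $4n-4$ distribution $\mathcal D_x=u(U)$, $u\in P|_x$ (the maximal quaternionic subspace of $E_x$ contained in $T_xM$), and let $\mathfrak m(x)=T_xM/\mathcal D_x+\mathcal D_x$ be its symbol algebra, with bracket $\mathcal D_x\times\mathcal D_x\to T_xM/\mathcal D_x$ induced by the Lie bracket of vector fields. $P$ is quaternionic contact if at every $x$ the symbol algebra is isomorphic to the quaternionic Heisenberg algebra $\mathrm{Im}\,\mathbb{H}+\mathbb{H}^{n-1}$ (with bracket $L_o$), compatibly with the quaternionic structure, i.e. through the graded map $U+U^\perp\to\mathcal D_x+T_xM/\mathcal D_x$ induced by some frame $u\in P|_x$. *)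

theory Defs
  imports "HOL-Analysis.Analysis" "HOL-Library.Multiset"
begin

section \<open>Quaternions and the model spaces\<close>

text \<open>A quaternion is a pair (real part, imaginary part), with Im H = \<open>real^3\<close>. The product norm
  is the quaternion norm, and the Euclidean structure on \<open>H^m\<close>, V, W comes for free.
  For \<open>CARD('m) = n - 1\<close>: \<open>U = H^(n-1)\<close>, \<open>V = H^n\<close> and \<open>W = U + Im H\<close>,
  which is included in V by \<open>incl\<close>.\<close>

type_synonym quat = "real \<times> (real^3)"
type_synonym 'm Usp = "quat^'m"
type_synonym 'm Vsp = "(quat^'m) \<times> quat"
type_synonym 'm Wsp = "(quat^'m) \<times> (real^3)"

definition qmul :: "quat \<Rightarrow> quat \<Rightarrow> quat"  (infixl "\<odot>" 70)
  where "p \<odot> q = (fst p * fst q - snd p \<bullet> snd q,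
                   fst p *\<^sub>R snd q + fst q *\<^sub>R snd p + cross3 (snd p) (snd q))"

definition qcnj :: "quat \<Rightarrow> quat"
  where "qcnj q = (fst q, - snd q)"

definition im :: "real^3 \<Rightarrow> quat"
  where "im v = (0, v)"

definition rmulU :: "'m::finite Usp \<Rightarrow> quat \<Rightarrow> 'm Usp"
  where "rmulU x q = (\<chi> i. x$i \<odot> q)"

definition rmulV :: "'m::finite Vsp \<Rightarrow> quat \<Rightarrow> 'm Vsp"
  where "rmulV v q = (rmulU (fst v) q, snd v \<odot> q)"

definition qmatvec :: "quat^'m^'m \<Rightarrow> 'm::finite Usp \<Rightarrow> 'm Usp"
  where "qmatvec X x = (\<chi> i. \<Sum>j\<in>UNIV. X$i$j \<odot> x$j)"

definition incl :: "'m::finite Wsp \<Rightarrow> 'm Vsp"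
  where "incl w = (fst w, im (snd w))"


section \<open>The groups and the cohomology space\<close>

definition Q_std :: "('m::finite Vsp \<Rightarrow> 'm Vsp) set"
  where "Q_std = {\<lambda>v. - rmulV v (im q) | q. True}"

text \<open>Endomorphisms given by left multiplication with quaternionic matrices, i.e. \<open>gl_n(H)\<close>.\<close>

definition hlinear :: "('m::finite Vsp \<Rightarrow> 'm Vsp) \<Rightarrow> bool"
  where "hlinear A \<longleftrightarrow> linear A \<and> (\<forall>v q. A (rmulV v q) = rmulV (A v) q)"

text \<open>\<open>GL_n(H) \<cdot> Sp_1\<close>; for a unit quaternion the inverse is the conjugate.\<close>

definition Gtilde :: "('m::finite Vsp \<Rightarrow> 'm Vsp) set"
  where "Gtilde = {\<lambda>v. rmulV (A v) (qcnj h) | A h. hlinear A \<and> bij A \<and> norm h = 1}"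

definition gtilde :: "('m::finite Vsp \<Rightarrow> 'm Vsp) set"
  where "gtilde = {\<lambda>v. A v - rmulV v (im \<xi>) | A \<xi>. hlinear A}"

text \<open>The stabiliser of W in \<open>Gtilde\<close>, as a group of transformations of W.\<close>

definition Ggrp :: "('m::finite Wsp \<Rightarrow> 'm Wsp) set"
  where "Ggrp = {g. \<exists>F\<in>Gtilde. F ` range incl = range incl \<and> (\<forall>w. F (incl w) = incl (g w))}"

text \<open>Elements of \<open>gtilde \<otimes> W*\<close>, i.e. linear maps from W to \<open>gtilde\<close>.\<close>

definition cochains1 :: "('m::finite Wsp \<Rightarrow> 'm Vsp \<Rightarrow> 'm Vsp) set"
  where "cochains1 = {c. (\<forall>w. c w \<in> gtilde) \<and> (\<forall>v. linear (\<lambda>w. c w v))}"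

definition spencer ::
    "('m::finite Wsp \<Rightarrow> 'm Vsp \<Rightarrow> 'm Vsp) \<Rightarrow> 'm Wsp \<Rightarrow> 'm Wsp \<Rightarrow> 'm Vsp"
  where "spencer c w1 w2 = - c w2 (incl w1) + c w1 (incl w2)"

text \<open>The class in \<open>H^{0,2}\<close> of a V-valued alternating form on W, as a coset.\<close>

definition H02_class ::
    "('m::finite Wsp \<Rightarrow> 'm Wsp \<Rightarrow> 'm Vsp) \<Rightarrow> ('m Wsp \<Rightarrow> 'm Wsp \<Rightarrow> 'm Vsp) set"
  where "H02_class \<tau> = {\<lambda>w1 w2. \<tau> w1 w2 + spencer c w1 w2 | c. c \<in> cochains1}"


section \<open>Smooth maps on open sets\<close>

primrec Ck_on :: "nat \<Rightarrow> 'a::euclidean_space set \<Rightarrow> ('a \<Rightarrow> 'b::euclidean_space) \<Rightarrow> bool" where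
  "Ck_on 0 S f \<longleftrightarrow> continuous_on S f"
| "Ck_on (Suc k) S f \<longleftrightarrow>
     (\<exists>f'. (\<forall>x\<in>S. (f has_derivative f' x) (at x)) \<and> (\<forall>v. Ck_on k S (\<lambda>x. f' x v)))"

definition smooth_on :: "'a::euclidean_space set \<Rightarrow> ('a \<Rightarrow> 'b::euclidean_space) \<Rightarrow> bool"
  where "smooth_on S f \<longleftrightarrow> open S \<and> (\<forall>k. Ck_on k S f)"

definition smooth_op_on ::
    "'a::euclidean_space set \<Rightarrow> ('a \<Rightarrow> 'b::euclidean_space \<Rightarrow> 'c::euclidean_space) \<Rightarrow> bool"
  where "smooth_op_on S F \<longleftrightarrow> (\<forall>x\<in>S. linear (F x)) \<and> (\<forall>v. smooth_on S (\<lambda>x. F x v))"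


section \<open>Almost CR quaternionic structures on the Heisenberg group\<close>

text \<open>As a manifold M is W (exponential coordinates), so every tangent space of M is
  identified with W, and a frame at a point is a linear automorphism of W.
  A structure assigns to each point its set of adapted frames.\<close>

type_synonym 'm gstruct = "'m Wsp \<Rightarrow> ('m Wsp \<Rightarrow> 'm Wsp) set"

definition frame_field :: "'m::finite Wsp set \<Rightarrow> ('m Wsp \<Rightarrow> 'm Wsp \<Rightarrow> 'm Wsp) \<Rightarrow> bool"
  where "frame_field N s \<longleftrightarrow> open N \<and> smooth_op_on N s \<and> (\<forall>x\<in>N. bij (s x))"

definition local_section ::
    "'m::finite gstruct \<Rightarrow> 'm Wsp set \<Rightarrow> ('m Wsp \<Rightarrow> 'm Wsp \<Rightarrow> 'm Wsp) \<Rightarrow> bool"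
  where "local_section P N s \<longleftrightarrow> frame_field N s \<and> (\<forall>x\<in>N. s x \<in> P x)"

definition almost_CR_quaternionic :: "'m::finite gstruct \<Rightarrow> bool"
  where "almost_CR_quaternionic P \<longleftrightarrow>
    (\<forall>x. \<exists>N s. x \<in> N \<and> frame_field N s \<and> (\<forall>y\<in>N. P y = {s y \<circ> g | g. g \<in> Ggrp}))"

definition isomorphic :: "'m::finite gstruct \<Rightarrow> 'm gstruct \<Rightarrow> bool"
  where "isomorphic P P' \<longleftrightarrow>
    (\<exists>\<phi>. bij \<phi> \<and> smooth_on UNIV \<phi> \<and> smooth_on UNIV (inv \<phi>) \<and>
      (\<forall>x. P' (\<phi> x) = {frechet_derivative \<phi> (at x) \<circ> u | u. u \<in> P x}))"

text \<open>Smooth dependence on t in \<open>[0,\<infinity>)\<close>: locally there are adapted frames smooth in (t,x)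
  (at t = 0, extendable smoothly to negative t).\<close>

definition smooth_family :: "(real \<Rightarrow> 'm::finite gstruct) \<Rightarrow> bool"
  where "smooth_family P \<longleftrightarrow>
    (\<forall>t0\<ge>0. \<forall>x0. \<exists>N s. (t0, x0) \<in> N \<and> smooth_op_on N s \<and> (\<forall>z\<in>N. bij (s z)) \<and>
      (\<forall>t x. (t, x) \<in> N \<and> t \<ge> 0 \<longrightarrow> P t x = {s (t, x) \<circ> g | g. g \<in> Ggrp}))"


subsection \<open>The essential curvature\<close>

text \<open>The exterior derivative at x of the coframe dual to s, evaluated on \<open>s x w1\<close>, \<open>s x w2\<close>.\<close>

definition d_coframe ::
    "('m::finite Wsp \<Rightarrow> 'm Wsp \<Rightarrow> 'm Wsp) \<Rightarrow> 'm Wsp \<Rightarrow> 'm Wsp \<Rightarrow> 'm Wsp \<Rightarrow> 'm Wsp"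
  where "d_coframe s x w1 w2 =
    frechet_derivative (\<lambda>y. inv (s y) (s x w2)) (at x) (s x w1)
    - frechet_derivative (\<lambda>y. inv (s y) (s x w1)) (at x) (s x w2)"

definition ess_curvature ::
    "'m::finite gstruct \<Rightarrow> 'm Wsp \<Rightarrow> ('m Wsp \<Rightarrow> 'm Wsp) \<Rightarrow> ('m Wsp \<Rightarrow> 'm Wsp \<Rightarrow> 'm Vsp) set"
  where "ess_curvature P x u =
    (THE K. \<forall>N s. x \<in> N \<and> local_section P N s \<and> s x = u \<longrightarrow>
        K = H02_class (\<lambda>w1 w2. incl (d_coframe s x w1 w2)))"

definition ess_curvature_nonzero :: "'m::finite gstruct \<Rightarrow> bool"
  where "ess_curvature_nonzero P \<longleftrightarrow>
    (\<exists>x. \<exists>u\<in>P x. ess_curvature P x u \<noteq> H02_class (\<lambda>w1 w2. 0))"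


subsection \<open>The structure associated with a bracket\<close>

definition bracket_tensors :: "('m::finite Usp \<Rightarrow> 'm Usp \<Rightarrow> real^3) set"
  where "bracket_tensors = {L. bilinear L \<and> (\<forall>x. L x x = 0)}"

text \<open>Baker-Campbell-Hausdorff product of the 2-step nilpotent Lie algebra W with bracket L.\<close>

definition heis_mult ::
    "('m::finite Usp \<Rightarrow> 'm Usp \<Rightarrow> real^3) \<Rightarrow> 'm Wsp \<Rightarrow> 'm Wsp \<Rightarrow> 'm Wsp"
  where "heis_mult L x y = x + y + (1/2) *\<^sub>R (0, L (fst x) (fst y))"

definition heis_frame ::
    "('m::finite Usp \<Rightarrow> 'm Usp \<Rightarrow> real^3) \<Rightarrow> 'm Wsp \<Rightarrow> 'm Wsp \<Rightarrow> 'm Wsp"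
  where "heis_frame L x = frechet_derivative (heis_mult L x) (at 0)"

definition heis_structure :: "('m::finite Usp \<Rightarrow> 'm Usp \<Rightarrow> real^3) \<Rightarrow> 'm gstruct"
  where "heis_structure L x = {heis_frame L x \<circ> g | g. g \<in> Ggrp}"

definition L_std :: "'m::finite Usp \<Rightarrow> 'm Usp \<Rightarrow> real^3"
  where "L_std x y = snd (\<Sum>i\<in>UNIV. qcnj (x$i) \<odot> y$i)"


subsection \<open>Quaternionic contact structures\<close>

definition distr :: "'m::finite gstruct \<Rightarrow> 'm Wsp \<Rightarrow> 'm Wsp set"
  where "distr P x = {u (a, 0) | u a. u \<in> P x}"

definition lie_bracket ::
    "('a::euclidean_space \<Rightarrow> 'a) \<Rightarrow> ('a \<Rightarrow> 'a) \<Rightarrow> 'a \<Rightarrow> 'a"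
  where "lie_bracket X Y x =
    frechet_derivative Y (at x) (X x) - frechet_derivative X (at x) (Y x)"

definition quaternionic_contact :: "'m::finite gstruct \<Rightarrow> bool"
  where "quaternionic_contact P \<longleftrightarrow>
    (\<forall>x. \<exists>u\<in>P x. \<forall>N X Y a b.
      x \<in> N \<and> smooth_on N X \<and> smooth_on N Y \<and>
      (\<forall>y\<in>N. X y \<in> distr P y \<and> Y y \<in> distr P y) \<and>
      X x = u (a, 0) \<and> Y x = u (b, 0) \<longrightarrow>
      lie_bracket X Y x - u (0, L_std a b) \<in> distr P x)"


section \<open>Quaternionic manifolds and hypersurfaces\<close>

text \<open>A manifold of dimension 4n is a Hausdorff second countable type \<open>'p\<close> with an atlas of charts
  (domain, coordinate map) with values in V. Geometric objects on it are given by their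
  coordinate expressions: one for each chart, at the points of its image.\<close>

type_synonym ('p, 'm) chart = "'p set \<times> ('p \<Rightarrow> 'm Vsp)"

definition chart_image :: "('p, 'm) chart \<Rightarrow> 'm Vsp set"
  where "chart_image c = snd c ` fst c"

definition overlap :: "('p, 'm) chart \<Rightarrow> ('p, 'm) chart \<Rightarrow> 'm Vsp set"
  where "overlap c c' = snd c ` (fst c \<inter> fst c')"

definition transition :: "('p, 'm) chart \<Rightarrow> ('p, 'm) chart \<Rightarrow> 'm Vsp \<Rightarrow> 'm Vsp"
  where "transition c c' y = snd c' (inv_into (fst c) (snd c) y)"

definition jacobian ::
    "('p, 'm::finite) chart \<Rightarrow> ('p, 'm) chart \<Rightarrow> 'm Vsp \<Rightarrow> 'm Vsp \<Rightarrow> 'm Vsp"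
  where "jacobian c c' y = frechet_derivative (transition c c') (at y)"

definition smooth_atlas ::
    "('p::{t2_space, second_countable_topology}, 'm::finite) chart set \<Rightarrow> bool"
  where "smooth_atlas \<A> \<longleftrightarrow>
    (\<Union>c\<in>\<A>. fst c) = UNIV \<and>
    (\<forall>c\<in>\<A>. open (fst c) \<and> open (chart_image c) \<and>
       (\<exists>g. homeomorphism (fst c) (chart_image c) (snd c) g)) \<and>
    (\<forall>c\<in>\<A>. \<forall>c'\<in>\<A>. smooth_on (overlap c c') (transition c c'))"

definition conjugate :: "('a \<Rightarrow> 'b) \<Rightarrow> ('a \<Rightarrow> 'a) set \<Rightarrow> ('b \<Rightarrow> 'b) set"
  where "conjugate F S = {F \<circ> B \<circ> inv F | B. B \<in> S}"

definition hypercomplex ::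
    "('a::real_vector \<Rightarrow> 'a) \<Rightarrow> ('a \<Rightarrow> 'a) \<Rightarrow> ('a \<Rightarrow> 'a) \<Rightarrow> bool"
  where "hypercomplex I1 I2 I3 \<longleftrightarrow>
    linear I1 \<and> linear I2 \<and> linear I3 \<and>
    (\<forall>v. I1 (I1 v) = - v) \<and> (\<forall>v. I2 (I2 v) = - v) \<and> (\<forall>v. I3 (I3 v) = - v) \<and>
    (\<forall>v. I1 (I2 v) = - I2 (I1 v)) \<and> (\<forall>v. I1 (I3 v) = - I3 (I1 v)) \<and>
    (\<forall>v. I2 (I3 v) = - I3 (I2 v)) \<and> (\<forall>v. I3 v = I1 (I2 v))"

definition almost_quaternionic_manifold ::
    "('p::{t2_space, second_countable_topology}, 'm::finite) chart set \<Rightarrow>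
     (('p, 'm) chart \<Rightarrow> 'm Vsp \<Rightarrow> ('m Vsp \<Rightarrow> 'm Vsp) set) \<Rightarrow> bool"
  where "almost_quaternionic_manifold \<A> Q \<longleftrightarrow>
    smooth_atlas \<A> \<and>
    (\<forall>c\<in>\<A>. \<forall>y\<in>chart_image c. \<exists>N I1 I2 I3.
       y \<in> N \<and> N \<subseteq> chart_image c \<and>
       smooth_op_on N I1 \<and> smooth_op_on N I2 \<and> smooth_op_on N I3 \<and>
       (\<forall>z\<in>N. hypercomplex (I1 z) (I2 z) (I3 z) \<and>
          Q c z = {\<lambda>v. a1 *\<^sub>R I1 z v + a2 *\<^sub>R I2 z v + a3 *\<^sub>R I3 z v | a1 a2 a3. True})) \<and>
    (\<forall>c\<in>\<A>. \<forall>c'\<in>\<A>. \<forall>y\<in>overlap c c'.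
       Q c' (transition c c' y) = conjugate (jacobian c c' y) (Q c y))"

text \<open>A linear connection is given by Christoffel symbols: \<open>\<nabla>_a X = D_a X + \<Gamma>(a, X)\<close> in each chart.
  The last condition is the transformation law, whose last term is the second derivative
  of the transition map applied to (a, b).\<close>

definition linear_connection ::
    "('p, 'm::finite) chart set \<Rightarrow>
     (('p, 'm) chart \<Rightarrow> 'm Vsp \<Rightarrow> 'm Vsp \<Rightarrow> 'm Vsp \<Rightarrow> 'm Vsp) \<Rightarrow> bool"
  where "linear_connection \<A> \<Gamma> \<longleftrightarrow>
    (\<forall>c\<in>\<A>. (\<forall>y\<in>chart_image c. bilinear (\<Gamma> c y)) \<and>
       (\<forall>a b. smooth_on (chart_image c) (\<lambda>y. \<Gamma> c y a b))) \<and>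
    (\<forall>c\<in>\<A>. \<forall>c'\<in>\<A>. \<forall>y\<in>overlap c c'. \<forall>a b.
       \<Gamma> c' (transition c c' y) (jacobian c c' y a) (jacobian c c' y b) =
       jacobian c c' y (\<Gamma> c y a b) - frechet_derivative (\<lambda>z. jacobian c c' z b) (at y) a)"

definition torsion_free ::
    "('p, 'm::finite) chart set \<Rightarrow>
     (('p, 'm) chart \<Rightarrow> 'm Vsp \<Rightarrow> 'm Vsp \<Rightarrow> 'm Vsp \<Rightarrow> 'm Vsp) \<Rightarrow> bool"
  where "torsion_free \<A> \<Gamma> \<longleftrightarrow>
    (\<forall>c\<in>\<A>. \<forall>y\<in>chart_image c. \<forall>a b. \<Gamma> c y a b = \<Gamma> c y b a)"

text \<open>Covariant derivatives of local sections of Q are again in Q.\<close>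

definition preserves ::
    "('p, 'm::finite) chart set \<Rightarrow>
     (('p, 'm) chart \<Rightarrow> 'm Vsp \<Rightarrow> 'm Vsp \<Rightarrow> 'm Vsp \<Rightarrow> 'm Vsp) \<Rightarrow>
     (('p, 'm) chart \<Rightarrow> 'm Vsp \<Rightarrow> ('m Vsp \<Rightarrow> 'm Vsp) set) \<Rightarrow> bool"
  where "preserves \<A> \<Gamma> Q \<longleftrightarrow>
    (\<forall>c\<in>\<A>. \<forall>N I. N \<subseteq> chart_image c \<and> smooth_op_on N I \<and> (\<forall>z\<in>N. I z \<in> Q c z) \<longrightarrow>
       (\<forall>y\<in>N. \<forall>a.
          (\<lambda>v. frechet_derivative (\<lambda>z. I z v) (at y) a + \<Gamma> c y a (I y v) - I y (\<Gamma> c y a v))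
          \<in> Q c y))"

definition quaternionic_manifold ::
    "('p::{t2_space, second_countable_topology}, 'm::finite) chart set \<Rightarrow>
     (('p, 'm) chart \<Rightarrow> 'm Vsp \<Rightarrow> ('m Vsp \<Rightarrow> 'm Vsp) set) \<Rightarrow> bool"
  where "quaternionic_manifold \<A> Q \<longleftrightarrow>
    almost_quaternionic_manifold \<A> Q \<and>
    (\<exists>\<Gamma>. linear_connection \<A> \<Gamma> \<and> torsion_free \<A> \<Gamma> \<and> preserves \<A> \<Gamma> Q)"

definition immersion_on ::
    "('p::topological_space, 'm::finite) chart set \<Rightarrow> 'm Wsp set \<Rightarrow> ('m Wsp \<Rightarrow> 'p) \<Rightarrow> bool"
  where "immersion_on \<A> N f \<longleftrightarrow>
    open N \<and> continuous_on N f \<and>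
    (\<forall>c\<in>\<A>. smooth_on (N \<inter> f -` fst c) (snd c \<circ> f) \<and>
       (\<forall>x \<in> N \<inter> f -` fst c. inj (frechet_derivative (snd c \<circ> f) (at x))))"

text \<open>On N, P consists of the frames u such that \<open>df \<circ> u\<close> extends to an isomorphism of
  quaternionic vector spaces from V to the tangent space at f x.\<close>

definition induced_on ::
    "('p, 'm::finite) chart set \<Rightarrow> (('p, 'm) chart \<Rightarrow> 'm Vsp \<Rightarrow> ('m Vsp \<Rightarrow> 'm Vsp) set) \<Rightarrow>
     'm Wsp set \<Rightarrow> ('m Wsp \<Rightarrow> 'p) \<Rightarrow> 'm gstruct \<Rightarrow> bool"
  where "induced_on \<A> Q N f P \<longleftrightarrow>
    (\<forall>c\<in>\<A>. \<forall>x \<in> N \<inter> f -` fst c. P x =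
       {u. linear u \<and> bij u \<and>
          (\<exists>F. linear F \<and> bij F \<and> conjugate F Q_std = Q c (snd c (f x)) \<and>
             (\<forall>w. F (incl w) = frechet_derivative (snd c \<circ> f) (at x) (u w)))})"


section \<open>The decomposition of the space of brackets\<close>

text \<open>Infinitesimal action on V of the element (X, \<open>\<xi>\<close>) of the Levi factor; it preserves U and
  Im H. Modules over \<open>sl_{2n-2}(C) + sl_2(C)\<close> and their homomorphisms are the same as
  complex modules and complex linear homomorphisms over its real form, the Levi factor.\<close>

definition slH :: "(quat^'m^'m::finite) set"
  where "slH = {X. fst (\<Sum>i\<in>UNIV. X$i$i) = 0}"

definition levi :: "quat^'m^'m \<Rightarrow> real^3 \<Rightarrow> 'm::finite Vsp \<Rightarrow> 'm Vsp"
  where "levi X \<xi> v = (qmatvec X (fst v), im \<xi> \<odot> snd v) - rmulV v (im \<xi>)"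

definition levi_U :: "quat^'m^'m \<Rightarrow> real^3 \<Rightarrow> 'm::finite Usp \<Rightarrow> 'm Usp"
  where "levi_U X \<xi> x = fst (levi X \<xi> (x, 0))"

definition levi_ImH :: "quat^'m^'m::finite \<Rightarrow> real^3 \<Rightarrow> real^3 \<Rightarrow> real^3"
  where "levi_ImH X \<xi> v = snd (snd (levi X \<xi> (0, im v)))"

definition complexify_map :: "(real^3 \<Rightarrow> real^3) \<Rightarrow> complex^3 \<Rightarrow> complex^3"
  where "complexify_map A z = (\<chi> k. Complex (A (\<chi> j. Re (z$j)) $ k) (A (\<chi> j. Im (z$j)) $ k))"

text \<open>The complexification of \<open>bracket_tensors\<close>, with its module structure.\<close>

type_synonym 'm ctensor = "'m Usp \<Rightarrow> 'm Usp \<Rightarrow> complex^3"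

definition ctensors :: "'m::finite ctensor set"
  where "ctensors = {f. bilinear f \<and> (\<forall>x. f x x = 0)}"

definition complexify :: "('m::finite Usp \<Rightarrow> 'm Usp \<Rightarrow> real^3) \<Rightarrow> 'm ctensor"
  where "complexify L x y = (\<chi> k. complex_of_real (L x y $ k))"

definition act_ctensor :: "quat^'m^'m \<Rightarrow> real^3 \<Rightarrow> 'm::finite ctensor \<Rightarrow> 'm ctensor"
  where "act_ctensor X \<xi> f = (\<lambda>x y. complexify_map (levi_ImH X \<xi>) (f x y)
           - f (levi_U X \<xi> x) y - f x (levi_U X \<xi> y))"

text \<open>The embedding of H into the complex 2 by 2 matrices, identifying \<open>sp_1\<close> and \<open>sl_{n-1}(H)\<close> with
  real forms of \<open>sl_2(C)\<close> and \<open>sl_{2n-2}(C)\<close>; the coordinates of \<open>E = C^{2n-2}\<close>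
  are indexed by \<open>'m \<times> 2\<close> and those of \<open>H = C^2\<close> by 2.\<close>

definition cmat :: "quat \<Rightarrow> complex^2^2"
  where "cmat q = vector [
    vector [Complex (fst q) (snd q $ 1), Complex (snd q $ 2) (snd q $ 3)],
    vector [Complex (- (snd q $ 2)) (snd q $ 3), Complex (fst q) (- (snd q $ 1))]]"

definition cmatE :: "quat^'m^'m::finite \<Rightarrow> 'm \<times> 2 \<Rightarrow> 'm \<times> 2 \<Rightarrow> complex"
  where "cmatE X e f = cmat (X $ fst e $ fst f) $ snd e $ snd f"

text \<open>Coordinates of tensors in \<open>E* \<otimes> E* \<otimes> H^{\<otimes>k}\<close>: a list of length k is the multi-index
  for the H factors. \<open>EH_module (-1) k\<close> is \<open>\<Lambda>^2 E* \<otimes> S^k H\<close> and \<open>EH_module 1 k\<close> is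
  \<open>S^2 E* \<otimes> S^k H\<close>.\<close>

type_synonym 'm EHtensor = "'m \<times> 2 \<Rightarrow> 'm \<times> 2 \<Rightarrow> 2 list \<Rightarrow> complex"

definition EH_module :: "complex \<Rightarrow> nat \<Rightarrow> 'm::finite EHtensor set"
  where "EH_module \<epsilon> k = {t. \<forall>e f l.
    t f e l = \<epsilon> * t e f l \<and>
    (\<forall>l'. mset l' = mset l \<longrightarrow> t e f l' = t e f l) \<and>
    (length l \<noteq> k \<longrightarrow> t e f l = 0)}"

definition act_EH :: "quat^'m^'m \<Rightarrow> real^3 \<Rightarrow> 'm::finite EHtensor \<Rightarrow> 'm EHtensor"
  where "act_EH X \<xi> t = (\<lambda>e f l.
    - (\<Sum>g\<in>UNIV. cmatE X g e * t g f l) - (\<Sum>g\<in>UNIV. cmatE X g f * t e g l)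
    + (\<Sum>p<length l. \<Sum>b\<in>UNIV. cmat (im \<xi>) $ (l ! p) $ b * t e f (l[p := b])))"

definition submodule :: "'m::finite ctensor set \<Rightarrow> bool"
  where "submodule S \<longleftrightarrow>
    S \<subseteq> ctensors \<and> (\<lambda>x y. 0) \<in> S \<and>
    (\<forall>f\<in>S. \<forall>g\<in>S. (\<lambda>x y. f x y + g x y) \<in> S) \<and>
    (\<forall>z. \<forall>f\<in>S. (\<lambda>x y. z *s f x y) \<in> S) \<and>
    (\<forall>X\<in>slH. \<forall>\<xi>. \<forall>f\<in>S. act_ctensor X \<xi> f \<in> S)"

definition module_iso ::
    "('m::finite EHtensor \<Rightarrow> 'm ctensor) \<Rightarrow> 'm EHtensor set \<Rightarrow> 'm ctensor set \<Rightarrow> bool"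
  where "module_iso \<phi> M S \<longleftrightarrow>
    bij_betw \<phi> M S \<and>
    (\<forall>t\<in>M. \<forall>t'\<in>M. \<phi> (\<lambda>e f l. t e f l + t' e f l) = (\<lambda>x y. \<phi> t x y + \<phi> t' x y)) \<and>
    (\<forall>z. \<forall>t\<in>M. \<phi> (\<lambda>e f l. z * t e f l) = (\<lambda>x y. z *s \<phi> t x y)) \<and>
    (\<forall>X\<in>slH. \<forall>\<xi>. \<forall>t\<in>M. \<phi> (act_EH X \<xi> t) = act_ctensor X \<xi> (\<phi> t))"

text \<open>The decomposition of \<open>ctensors\<close> is multiplicity free, so there is exactly one submodule of
  each of the four types, and the component is that submodule.\<close>

definition component :: "complex \<Rightarrow> nat \<Rightarrow> 'm::finite ctensor set"
  where "component \<epsilon> k =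
    \<Union>{S. submodule S \<and> (\<exists>\<phi>. module_iso \<phi> (EH_module \<epsilon> k) S)}"

definition nontrivial_component_S2H_S4H :: "('m::finite Usp \<Rightarrow> 'm Usp \<Rightarrow> real^3) \<Rightarrow> bool"
  where "nontrivial_component_S2H_S4H L \<longleftrightarrow>
    (\<exists>a \<in> component (-1) 0. \<exists>b \<in> component (-1) 2. \<exists>c \<in> component 1 2. \<exists>d \<in> component (-1) 4.
       complexify L = (\<lambda>x y. a x y + b x y + c x y + d x y) \<and>
       (b \<noteq> (\<lambda>x y. 0) \<or> d \<noteq> (\<lambda>x y. 0)))"

end

theory Submission
  imports Defs
begin

text \<open>Everything reduces to one algebraic condition on the bracket. Call L a hypersurface bracket if there is a symmetric
real bilinear form \<open>\<beta>\<close> on U with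
\<open>L\<^sub>k(x, y) = \<beta>(x i\<^sub>k, y) - \<beta>(x, y i\<^sub>k)\<close> for the three imaginary units. This is the shape that the Levi bracket
of a hypersurface in a quaternionic manifold must have: \<open>\<beta>\<close> is then a second fundamental form. Each claim is
equivalent to this condition, implies it, or exhibits brackets that violate it.

\<^item> Curvature. The differential of the left-invariant coframe is \<open>- L\<close>. A cochain whose Spencer boundary is L has,
  in its \<open>Hom(U, Hom(U, H))\<close> block, a bilinear form \<open>B\<close> on U with values in H that is H-linear in the second argument and satisfies
  \<open>B(x, y) - B(y, x) = L(x, y)\<close>. Such a \<open>B\<close> is determined by its real part, which has to be symmetric because L is imaginary;
  the imaginary parts give exactly the formula above. So the essential curvature vanishes if and only if L is a
  hypersurface bracket (\<open>ess_curvature_nonzero_iff\<close>). That the curvature does not depend on the section is the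
  statement that a curve in G through the identity has its velocity in \<open>gtilde\<close> (\<open>Ggrp_derivative\<close>); it is proved by
  differentiating polynomial identities that hold on G.

\<^item> Hypersurfaces. Let \<open>\<nabla>\<close> be torsion free and preserve Q, let \<open>\<nu>\<close> be a conormal covector at a point and \<open>b(X, Z) = \<nu>(\<nabla>\<^sub>X Z)\<close>
  the second fundamental form. For sections X, Y of the distribution, \<open>I Y\<close> is again tangent, so
  \<open>\<nu>(I [X, Y]) = b(X, I Y) - b(Y, I X)\<close>: the bracket is a hypersurface bracket (\<open>induced_imp_hypersurface_bracket\<close>).

\<^item> Contact structures and isomorphisms. The bracket of the distribution, read through adapted frames, changes by the
  action of G (\<open>hypersurface_bracket_transfer\<close>), and the standard bracket is a hypersurface bracket with \<open>\<beta>\<close> half the Euclidean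
  product. Stretching one of the three components of the standard bracket by a factor \<open>1 + t\<close> destroys the
  condition for \<open>t \<noteq> 0\<close>, because \<open>L\<^sub>k(x, x i\<^sub>k) + L\<^sub>k(x i\<^sub>a, x i\<^sub>a i\<^sub>k)\<close>, with a different from k, is the trace of \<open>\<beta>\<close> on the
  quaternionic line of x, the same for all k. This gives the one-parameter family.

\<^item> Representation theory. Symmetric forms are \<open>S\<^sup>2(E\<^sup>* \<otimes> H) = \<Lambda>\<^sup>2E\<^sup>* \<oplus> S\<^sup>2E\<^sup>* \<otimes> S\<^sup>2H\<close>, so the hypersurface brackets ought to be the sum of
  the two other components. This is made explicit (\<open>nontrivial_component_iff\<close>). Coordinates on U with an E-index
  and an H-index identify brackets with tensors in \<open>E\<^sup>* \<otimes> E\<^sup>* \<otimes> H\<^sup>4\<close>; the Clebsch-Gordan formulas realise each of the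
  four modules in it (\<open>ctensor_decomposition\<close>). Conversely, any submodule of a given type is located by operators
  that every module isomorphism respects: the Casimir operator of \<open>gl\<^sub>n\<^sub>-\<^sub>1(H)\<close>, which is a constant plus a multiple of the
  exchange of the two E-indices, separates \<open>\<Lambda>\<^sup>2E\<^sup>*\<close> from \<open>S\<^sup>2E\<^sup>*\<close>, and the Casimir operator of \<open>sp\<^sub>1\<close> separates the powers of H.\<close>

type_synonym 'm bracket = "'m Usp \<Rightarrow> 'm Usp \<Rightarrow> real^3"

section \<open>Quaternions\<close>

lemma quat_eq_iff:
  fixes p q :: quat
  shows "p = q \<longleftrightarrow> fst p = fst q \<and> snd p $ 1 = snd q $ 1 \<and> snd p $ 2 = snd q $ 2 \<and> snd p $ 3 = snd q $ 3"
  by (auto simp: prod_eq_iff vec_eq_iff forall_3)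

lemma qmul_components [simp]:
  "fst (p \<odot> q) = fst p * fst q - snd p $ 1 * snd q $ 1 - snd p $ 2 * snd q $ 2 - snd p $ 3 * snd q $ 3"
  "snd (p \<odot> q) $ 1 = fst p * snd q $ 1 + fst q * snd p $ 1 + snd p $ 2 * snd q $ 3 - snd p $ 3 * snd q $ 2"
  "snd (p \<odot> q) $ 2 = fst p * snd q $ 2 + fst q * snd p $ 2 + snd p $ 3 * snd q $ 1 - snd p $ 1 * snd q $ 3"
  "snd (p \<odot> q) $ 3 = fst p * snd q $ 3 + fst q * snd p $ 3 + snd p $ 1 * snd q $ 2 - snd p $ 2 * snd q $ 1"
  by (simp_all add: qmul_def cross3_def inner_vec_def sum_3)

lemma im_components [simp]: "fst (im v) = 0" "snd (im v) = v"
  by (simp_all add: im_def)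

lemma qcnj_components [simp]: "fst (qcnj q) = fst q" "snd (qcnj q) = - snd q"
  by (simp_all add: qcnj_def)

abbreviation q1 :: quat where "q1 \<equiv> (1, 0)"

lemma qmul_assoc: "p \<odot> q \<odot> r = p \<odot> (q \<odot> r)"
  by (simp add: quat_eq_iff algebra_simps)

lemma qmul_simps [simp]:
  "p \<odot> (a, 0) = a *\<^sub>R p" "(a, 0) \<odot> p = a *\<^sub>R p" "p \<odot> 0 = 0" "0 \<odot> p = 0"
  "p \<odot> (- q) = - (p \<odot> q)" "(- p) \<odot> q = - (p \<odot> q)"
  "(c *\<^sub>R p) \<odot> q = c *\<^sub>R (p \<odot> q)" "p \<odot> (c *\<^sub>R q) = c *\<^sub>R (p \<odot> q)"
  by (simp_all add: quat_eq_iff algebra_simps)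

lemma qmul_add: "(p + p') \<odot> q = p \<odot> q + p' \<odot> q" "p \<odot> (q + q') = p \<odot> q + p \<odot> q'"
  and qmul_diff: "(p - p') \<odot> q = p \<odot> q - p' \<odot> q" "p \<odot> (q - q') = p \<odot> q - p \<odot> q'"
  by (simp_all add: quat_eq_iff algebra_simps)

lemma norm_quat: "(norm (q::quat))\<^sup>2 = (fst q)\<^sup>2 + (snd q $ 1)\<^sup>2 + (snd q $ 2)\<^sup>2 + (snd q $ 3)\<^sup>2"
  by (cases q) (simp add: norm_Pair norm_vec_def L2_set_def sum_3)

lemma qmul_cnj: "q \<odot> qcnj q = (norm q)\<^sup>2 *\<^sub>R q1" "qcnj q \<odot> q = (norm q)\<^sup>2 *\<^sub>R q1"
  by (simp_all add: quat_eq_iff norm_quat) (simp_all add: power2_eq_square)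

lemma qmul_cnj_unit: 
  assumes "norm q = 1" shows "q \<odot> qcnj q = q1" "qcnj q \<odot> q = q1"
  using qmul_cnj[of q] assms by simp_all

lemma rmulU_nth [simp]: "rmulU x q $ i = x $ i \<odot> q"
  by (simp add: rmulU_def)

lemma rmulU_rmulU [simp]: "rmulU (rmulU x p) q = rmulU x (p \<odot> q)"
  by (simp add: vec_eq_iff qmul_assoc)

lemma rmulU_simps [simp]:
  "rmulU x q1 = x" "rmulU 0 q = 0" "rmulU x 0 = 0" "rmulU (- x) q = - rmulU x q" "rmulU x (- q) = - rmulU x q"
  "rmulU (c *\<^sub>R x) q = c *\<^sub>R rmulU x q" "rmulU x (c *\<^sub>R q) = c *\<^sub>R rmulU x q"
  by (simp_all add: vec_eq_iff)

lemma rmulU_add: "rmulU (x + y) q = rmulU x q + rmulU y q" "rmulU x (p + q) = rmulU x p + rmulU x q"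
  and rmulU_diff: "rmulU (x - y) q = rmulU x q - rmulU y q" "rmulU x (p - q) = rmulU x p - rmulU x q"
  by (simp_all add: vec_eq_iff qmul_add qmul_diff)

lemma bilinear_rmulU: "bilinear rmulU"
  by (simp add: bilinear_def linear_iff rmulU_add)

lemma fst_rmulV [simp]: "fst (rmulV v q) = rmulU (fst v) q" and snd_rmulV [simp]: "snd (rmulV v q) = snd v \<odot> q"
  by (simp_all add: rmulV_def)

lemma rmulV_rmulV [simp]: "rmulV (rmulV v p) q = rmulV v (p \<odot> q)"
  by (simp add: prod_eq_iff[of "rmulV _ _"] qmul_assoc)

lemma rmulV_simps [simp]:
  "rmulV x q1 = x" "rmulV 0 q = 0" "rmulV x 0 = 0" "rmulV (- x) q = - rmulV x q" "rmulV x (- q) = - rmulV x q"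
  "rmulV (c *\<^sub>R x) q = c *\<^sub>R rmulV x q" "rmulV x (c *\<^sub>R q) = c *\<^sub>R rmulV x q"
  by (simp_all add: rmulV_def prod_eq_iff)

lemma rmulV_add: "rmulV (x + y) q = rmulV x q + rmulV y q" "rmulV x (p + q) = rmulV x p + rmulV x q"
  and rmulV_diff: "rmulV (x - y) q = rmulV x q - rmulV y q" "rmulV x (p - q) = rmulV x p - rmulV x q"
  by (simp_all add: rmulV_def rmulU_add rmulU_diff qmul_add qmul_diff)

lemma linear_rmulV: "linear (\<lambda>v. rmulV v q)"
  by (simp add: linear_iff rmulV_add)

lemma incl_simps [simp]: "fst (incl w) = fst w" "snd (incl w) = im (snd w)"
  by (simp_all add: incl_def)

lemma im_linear: "im (u + v) = im u + im v" "im (c *\<^sub>R v) = c *\<^sub>R im v" "im (- v) = - im v" "im (u - v) = im u - im v" "im 0 = 0"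
  by (simp_all add: im_def prod_eq_iff)

lemma incl_linear: "incl (u + v) = incl u + incl v" "incl (c *\<^sub>R v) = c *\<^sub>R incl v" "incl (- v) = - incl v" "incl (u - v) = incl u - incl v" "incl 0 = 0"
  by (simp_all add: incl_def im_linear zero_prod_def)

lemma linear_im: "linear im"
  by (simp add: linear_iff im_linear)

lemma inj_incl: "inj incl"
  by (rule injI) (auto simp: incl_def im_def prod_eq_iff)

abbreviation ax :: "3 \<Rightarrow> real^3" where "ax k \<equiv> axis k 1"

section \<open>The structure group and its Lie algebra\<close>

lemma im_ax_mult:
  "im (ax 1) \<odot> im (ax 2) = im (ax 3)" "im (ax 2) \<odot> im (ax 3) = im (ax 1)" "im (ax 3) \<odot> im (ax 1) = im (ax 2)"
  "im (ax 2) \<odot> im (ax 1) = - im (ax 3)" "im (ax 3) \<odot> im (ax 2) = - im (ax 1)" "im (ax 1) \<odot> im (ax 3) = - im (ax 2)"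
  "im (ax k) \<odot> im (ax k) = - q1"
  using exhaust_3[of k] by (auto simp: quat_eq_iff axis_def)

lemma inner_im: "u \<bullet> v = - fst (im u \<odot> im v)"
  by (simp add: inner_vec_def sum_3)

lemma fst_qmul_commute: "fst (p \<odot> q) = fst (q \<odot> p)"
  by (simp add: algebra_simps)

text \<open>Euler's four square identity, as an identity between squared norms.\<close>

lemma norm_qmul: "norm (p \<odot> q) = norm p * norm q"
proof (rule power2_eq_imp_eq)
  show "(norm (p \<odot> q))\<^sup>2 = (norm p * norm q)\<^sup>2"
    unfolding power_mult_distrib norm_quat qmul_components by algebra
qed simp_all

lemma hlinear_linear: "hlinear A \<Longrightarrow> linear A" and hlinear_rmulV: "hlinear A \<Longrightarrow> A (rmulV v q) = rmulV (A v) q"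
  unfolding hlinear_def by blast+

lemma GgrpE:
  fixes g :: "'m::finite Wsp \<Rightarrow> 'm Wsp"
  assumes "g \<in> Ggrp"
  obtains F A h where "hlinear A" "bij A" "norm h = 1" "F = (\<lambda>v. rmulV (A v) (qcnj h))"
    "F \<in> Gtilde" "F ` range incl = range incl" "\<And>w. F (incl w) = incl (g w)"
proof -
  obtain F where F: "F \<in> Gtilde" "F ` range incl = range incl" "\<And>w. F (incl w) = incl (g w)"
    using assms unfolding Ggrp_def by blast
  moreover obtain A h where "F = (\<lambda>v. rmulV (A v) (qcnj h))" "hlinear A" "bij A" "norm h = 1"
    using F(1) unfolding Gtilde_def by blast
  ultimately show thesis using that by blast
qed

lemma Gtilde_linear_bij:
  assumes "F \<in> Gtilde" shows "linear F" "bij F"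
proof -
  obtain A h where A: "hlinear A" "bij A" "norm h = 1" and F: "F = (\<lambda>v. rmulV (A v) (qcnj h))"
    using assms unfolding Gtilde_def by auto
  show "linear F" unfolding F using linear_compose[OF hlinear_linear[OF A(1)] linear_rmulV] by (simp add: o_def)
  have "bij (\<lambda>v. rmulV v (qcnj h))"
    by (rule bij_betw_byWitness[where f' = "\<lambda>v. rmulV v h"]) (auto simp: qmul_cnj_unit[OF A(3)])
  from bij_comp[OF A(2) this] show "bij F" unfolding F by (simp add: o_def)
qed

lemma Ggrp_linear_bij:
  fixes g :: "'m::finite Wsp \<Rightarrow> 'm Wsp"
  assumes "g \<in> Ggrp" shows "linear g" "bij g"
proof -
  obtain F where F: "F \<in> Gtilde" "F ` range incl = range incl" "\<And>w. F (incl w) = incl (g w)"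
    using assms unfolding Ggrp_def by auto
  note FF = Gtilde_linear_bij[OF F(1)]
  have "incl (g (u + v)) = incl (g u + g v)" "incl (g (c *\<^sub>R u)) = incl (c *\<^sub>R g u)" for u v c
    using F(3)[symmetric] by (simp_all add: incl_linear linear_add[OF FF(1)] linear_cmul[OF FF(1)])
  then show "linear g" unfolding linear_iff inj_eq[OF inj_incl] by blast
  have "inj g"
    by (rule injI) (metis F(3) FF(2) bij_is_inj inj_eq inj_incl)
  moreover have "surj g"
    unfolding surj_def
  proof
    fix w' have "incl w' \<in> F ` range incl" using F(2) by blast
    then obtain w where "incl w' = F (incl w)" by blast
    then have "w' = g w" unfolding F(3) inj_eq[OF inj_incl] .
    then show "\<exists>w. w' = g w" ..
  qed
  ultimately show "bij g" by (simp add: bij_def)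
qed

lemma GtildeI: "hlinear A \<Longrightarrow> bij A \<Longrightarrow> norm h = 1 \<Longrightarrow> F = (\<lambda>v. rmulV (A v) (qcnj h)) \<Longrightarrow> F \<in> Gtilde"
  unfolding Gtilde_def by blast

lemma GgrpI: "F \<in> Gtilde \<Longrightarrow> F ` range incl = range incl \<Longrightarrow> (\<And>w. F (incl w) = incl (g w)) \<Longrightarrow> g \<in> Ggrp"
  unfolding Ggrp_def by blast

lemma id_Ggrp: "(id :: 'm::finite Wsp \<Rightarrow> 'm Wsp) \<in> Ggrp"
proof (rule GgrpI[of id])
  have q: "qcnj q1 = q1" by (simp add: quat_eq_iff)
  show "(id :: 'm Vsp \<Rightarrow> 'm Vsp) \<in> Gtilde"
  proof (rule GtildeI)
    show "hlinear (id :: 'm Vsp \<Rightarrow> 'm Vsp)" unfolding hlinear_def id_def by (blast intro: linear_ident)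
    show "norm q1 = 1" by (simp add: norm_Pair)
    show "(id :: 'm Vsp \<Rightarrow> 'm Vsp) = (\<lambda>v. rmulV (id v) (qcnj q1))" by (rule ext) (simp only: q rmulV_simps(1) id_apply)
  qed (rule bij_id)
qed simp_all

lemma comp_Ggrp:
  assumes "g1 \<in> Ggrp" "g2 \<in> Ggrp" shows "g1 \<circ> g2 \<in> Ggrp"
proof -
  obtain F1 A1 h1 where 1: "hlinear A1" "bij A1" "norm h1 = 1" "F1 = (\<lambda>v. rmulV (A1 v) (qcnj h1))"
    "F1 ` range incl = range incl" "\<And>w. F1 (incl w) = incl (g1 w)" by (rule GgrpE[OF assms(1)]) blast
  obtain F2 A2 h2 where 2: "hlinear A2" "bij A2" "norm h2 = 1" "F2 = (\<lambda>v. rmulV (A2 v) (qcnj h2))"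
    "F2 ` range incl = range incl" "\<And>w. F2 (incl w) = incl (g2 w)" by (rule GgrpE[OF assms(2)]) blast
  have c: "qcnj h2 \<odot> qcnj h1 = qcnj (h1 \<odot> h2)"
    by (simp add: quat_eq_iff algebra_simps)
  have n: "norm (h1 \<odot> h2) = 1" by (simp only: norm_qmul 1(3) 2(3) mult_1)
  show ?thesis
  proof (rule GgrpI)
    show "F1 \<circ> F2 \<in> Gtilde"
    proof (rule GtildeI[of "A1 \<circ> A2" "h1 \<odot> h2"])
      show "hlinear (A1 \<circ> A2)"
        unfolding hlinear_def o_apply hlinear_rmulV[OF 2(1)] hlinear_rmulV[OF 1(1)]
        using linear_compose[OF hlinear_linear[OF 2(1)] hlinear_linear[OF 1(1)]] by (simp add: o_def)
      show "F1 \<circ> F2 = (\<lambda>v. rmulV ((A1 \<circ> A2) v) (qcnj (h1 \<odot> h2)))"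
        unfolding 1(4) 2(4) o_def hlinear_rmulV[OF 1(1)] rmulV_rmulV c ..
      show "bij (A1 \<circ> A2)" by (rule bij_comp[OF 2(2) 1(2)])
    qed (rule n)
    show "(F1 \<circ> F2) ` range incl = range incl" by (simp only: image_comp[symmetric] 1(5) 2(5))
    show "(F1 \<circ> F2) (incl w) = incl ((g1 \<circ> g2) w)" for w by (simp only: o_apply 1(6) 2(6))
  qed
qed

lemma inv_Ggrp:
  assumes "g \<in> Ggrp" shows "inv g \<in> Ggrp"
proof -
  obtain F A h where 1: "hlinear A" "bij A" "norm h = 1" "F = (\<lambda>v. rmulV (A v) (qcnj h))" "F \<in> Gtilde"
    "F ` range incl = range incl" "\<And>w. F (incl w) = incl (g w)" by (rule GgrpE[OF assms(1)]) blast
  note g = Ggrp_linear_bij[OF assms] and F = Gtilde_linear_bij[OF 1(5)]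
  have A': "A (inv A v) = v" "inv A (A v) = v" for v using 1(2) by (simp_all add: bij_is_surj surj_f_inv_f bij_is_inj)
  have hl: "hlinear (inv A)" unfolding hlinear_def
  proof (intro conjI allI)
    show "linear (inv A)"
      by (rule inj_linear_imp_inv_linear[OF hlinear_linear[OF 1(1)] bij_is_inj[OF 1(2)]])
    fix v q have "A (inv A (rmulV v q)) = A (rmulV (inv A v) q)" by (simp add: A' hlinear_rmulV[OF 1(1)])
    from arg_cong[OF this, of "inv A"] show "inv A (rmulV v q) = rmulV (inv A v) q" by (simp only: A')
  qed
  have Fi: "inv F = (\<lambda>v. rmulV (inv A v) (qcnj (qcnj h)))"
  proof (rule inv_equality)
    have q: "qcnj (qcnj h) = h" by (simp add: quat_eq_iff)
    show "rmulV (inv A (F x)) (qcnj (qcnj h)) = x" for x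
      by (simp only: 1(4) q hlinear_rmulV[OF hl] A' qmul_cnj_unit[OF 1(3)] rmulV_rmulV rmulV_simps)
    show "F (rmulV (inv A x) (qcnj (qcnj h))) = x" for x
      by (simp only: 1(4) q hlinear_rmulV[OF 1(1)] A' qmul_cnj_unit[OF 1(3)] rmulV_rmulV rmulV_simps)
  qed
  have "norm (qcnj h) = 1" using 1(3) by (simp add: qcnj_def norm_prod_def)
  from GtildeI[OF hl bij_imp_bij_inv[OF 1(2)] this Fi] show ?thesis
  proof (rule GgrpI)
    show "inv F ` range incl = range incl"
      using arg_cong[OF 1(6), of "(`) (inv F)"] by (simp only: image_inv_f_f[OF bij_is_inj[OF F(2)]])
    fix w have "g (inv g w) = w" by (rule surj_f_inv_f[OF bij_is_surj[OF g(2)]])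
    then have "F (incl (inv g w)) = incl w" by (simp only: 1(7))
    from arg_cong[OF this, of "inv F"] show "inv F (incl w) = incl (inv g w)"
      by (simp only: inv_f_f[OF bij_is_inj[OF F(2)]])
  qed
qed

text \<open>Write an extension of g to V as \<open>v \<mapsto> A v h\<^sup>-\<^sup>1\<close>. The last component r of \<open>A (x, 0)\<close> must give imaginary numbers \<open>r q h\<^sup>-\<^sup>1\<close> for all q,
and \<open>q = r\<^sup>* h\<close> forces \<open>r = 0\<close>. The lower diagonal entry d must map \<open>p\<close> to imaginary \<open>d p h\<^sup>-\<^sup>1\<close>, which forces d to be a
real multiple of h. So G acts on Im H by a rotation times a nonzero scalar \<open>\<mu>\<close>, and semilinearly on U with
the same rotation.\<close>

lemma Ggrp_form:
  fixes g :: "'m::finite Wsp \<Rightarrow> 'm Wsp"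
  assumes "g \<in> Ggrp"
  obtains \<mu> h b where "\<mu> \<noteq> 0" "norm h = 1"
    "\<And>x. snd (g (x, 0)) = 0"
    "\<And>p. im (snd (g (0, p))) = \<mu> *\<^sub>R (h \<odot> im p \<odot> qcnj h)"
    "\<And>x q. fst (g (rmulU x q, 0)) = rmulU (fst (g (x, 0))) (h \<odot> q \<odot> qcnj h)"
    "\<And>p. fst (g (0, p)) = rmulU b (im p \<odot> qcnj h)"
proof -
  obtain F A h where A: "hlinear A" "bij A" "norm h = 1" and F1: "F = (\<lambda>v. rmulV (A v) (qcnj h))"
    and "F \<in> Gtilde" "F ` range incl = range incl" and F2: "\<And>w. F (incl w) = incl (g w)"
    by (rule GgrpE[OF assms]) blast
  have F: "F v = rmulV (A v) (qcnj h)" "F (incl w) = incl (g w)" for v w by (simp only: F1, rule F2)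
  note hh = qmul_cnj_unit[OF A(3)]
  \<comment> \<open>The lower diagonal entry of the quaternionic matrix A.\<close>
  define d where "d = snd (A (0, q1))"
  have Aq: "A (rmulV v q) = rmulV (A v) q" for v q using A(1) by (rule hlinear_rmulV)
  have Aq0: "A (rmulU x q, 0) = rmulV (A (x, 0)) q" for x q using Aq[of "(x,0)" q] by (simp add: rmulV_def)
  have A0q: "A (0, q) = rmulV (A (0, q1)) q" for q using Aq[of "(0,q1)" q] by (simp add: rmulV_def)
  have Fx: "rmulV (A (x,0)) (qcnj h) = incl (g (x,0))" for x using F(2)[of "(x,0)"] by (simp add: F(1) incl_def im_linear zero_prod_def)
  have Fp: "rmulV (A (0,q1)) (im p \<odot> qcnj h) = incl (g (0,p))" for p 
    using F(2)[of "(0,p)"] A0q[of "im p"] by (simp add: F(1) incl_def)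
  have Ax0: "snd (A (x,0)) = 0" for x
  proof -
    define r where "r = snd (A (x,0))"
    \<comment> \<open>The argument is chosen so that the last component becomes the real number \<open>|r|\<^sup>2\<close>, which has to be imaginary.\<close>
    have "incl (g (rmulU x (qcnj r \<odot> h), 0)) = rmulV (A (x,0)) (qcnj r)"
      by (simp add: Fx[symmetric] Aq0 qmul_assoc hh)
    then have "im (snd (g (rmulU x (qcnj r \<odot> h), 0))) = r \<odot> qcnj r"
      unfolding r_def by (metis incl_simps(2) snd_rmulV)
    then have "fst (r \<odot> qcnj r) = 0" by (metis im_components(1))
    then show ?thesis unfolding qmul_cnj by (simp add: r_def)
  qed
  have dp: "d \<odot> (im p \<odot> qcnj h) = im (snd (g (0,p)))" for p
    using arg_cong[OF Fp[of p], of snd] by (simp add: d_def)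
  define e where "e = qcnj h \<odot> d"
  have "fst (e \<odot> im p) = 0" for p
  proof -
    have "fst (e \<odot> im p) = fst (qcnj h \<odot> (d \<odot> (im p \<odot> qcnj h) \<odot> h))"
      by (simp only: e_def qmul_assoc hh scaleR_one qmul_simps)
    also have "\<dots> = fst (d \<odot> (im p \<odot> qcnj h))" by (subst fst_qmul_commute) (simp only: qmul_assoc hh scaleR_one qmul_simps)
    finally show ?thesis by (simp add: dp)
  qed
  from this[of "ax 1"] this[of "ax 2"] this[of "ax 3"] 
  have e: "e = fst e *\<^sub>R q1" by (simp add: quat_eq_iff axis_def)
  have "d = h \<odot> e" by (simp only: e_def qmul_assoc[symmetric] hh scaleR_one qmul_simps)
  then have d: "d = fst e *\<^sub>R h" by (subst (asm) e) simp
  have "fst e \<noteq> 0"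
  proof
    assume "fst e = 0"
    then have "snd (A (0, q)) = 0" for q using A0q[of q] d d_def by simp
    then have "snd (A v) = 0" for v using linear_add[OF hlinear_linear[OF A(1)], of "(fst v,0)" "(0, snd v)"] Ax0 by simp
    then show False using A(2) by (metis bij_is_surj snd_conv surj_f_inv_f zero_neq_one prod.inject zero_prod_def)
  qed
  moreover have "snd (g (x,0)) = 0" for x
    using arg_cong[OF Fx[of x], of snd] Ax0[of x] by (simp add: quat_eq_iff vec_eq_iff forall_3)
  moreover have "im (snd (g (0, p))) = fst e *\<^sub>R (h \<odot> im p \<odot> qcnj h)" for p
    by (simp only: dp[symmetric] d qmul_simps qmul_assoc)
  moreover have "fst (g (rmulU x q, 0)) = rmulU (fst (g (x, 0))) (h \<odot> q \<odot> qcnj h)" for x q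
  proof -
    have a: "fst (g (y,0)) = rmulU (fst (A (y,0))) (qcnj h)" for y using arg_cong[OF Fx[of y], of fst] by simp
    show ?thesis by (simp only: a Aq0 fst_rmulV rmulU_rmulU qmul_assoc[symmetric] hh scaleR_one qmul_simps)
  qed
  moreover have "fst (g (0,p)) = rmulU (fst (A (0, q1))) (im p \<odot> qcnj h)" for p
    using arg_cong[OF Fp[of p], of fst] by simp
  ultimately show thesis using that A(3) by blast
qed

text \<open>Polynomial equations satisfied by G in which \<open>\<mu>\<close>, h and b no longer occur. They can be differentiated along a family in G
without first choosing h and b differentiably.\<close>

lemma Ggrp_identities:
  fixes g :: "'m::finite Wsp \<Rightarrow> 'm Wsp"
  assumes "g \<in> Ggrp"
  shows "snd (g (x, 0)) = 0"
    and "k \<noteq> l \<Longrightarrow> snd (g (0, ax k)) \<bullet> snd (g (0, ax l)) = 0"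
    and "snd (g (0, ax k)) \<bullet> snd (g (0, ax k)) = snd (g (0, ax l)) \<bullet> snd (g (0, ax l))"
    and "im (ax k) \<odot> im (ax l) = im (ax j) \<Longrightarrow>
      rmulU (fst (g (rmulU x (im (ax k)), 0))) (im (snd (g (0, ax l)))) = rmulU (fst (g (x, 0))) (im (snd (g (0, ax j))))"
    and "rmulU (fst (g (0, ax k))) (im (snd (g (0, ax k)))) = rmulU (fst (g (0, ax l))) (im (snd (g (0, ax l))))"
proof -
  obtain \<mu> h b where h: "norm h = 1" and g: "\<And>x. snd (g (x, 0)) = 0"
    "\<And>p. im (snd (g (0, p))) = \<mu> *\<^sub>R (h \<odot> im p \<odot> qcnj h)"
    "\<And>x q. fst (g (rmulU x q, 0)) = rmulU (fst (g (x, 0))) (h \<odot> q \<odot> qcnj h)"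
    "\<And>p. fst (g (0, p)) = rmulU b (im p \<odot> qcnj h)" by (rule Ggrp_form[OF assms]) blast
  note hh = qmul_cnj_unit[OF h]
  show "snd (g (x, 0)) = 0" by (rule g)
  have c: "h \<odot> p \<odot> qcnj h \<odot> (h \<odot> q \<odot> qcnj h) = h \<odot> (p \<odot> q) \<odot> qcnj h" for p q
  proof -
    have "h \<odot> p \<odot> qcnj h \<odot> (h \<odot> q \<odot> qcnj h) = h \<odot> p \<odot> (qcnj h \<odot> h) \<odot> q \<odot> qcnj h"
      by (simp only: qmul_assoc)
    also have "\<dots> = h \<odot> (p \<odot> q) \<odot> qcnj h" by (simp only: hh scaleR_one qmul_simps qmul_assoc)
    finally show ?thesis .
  qed
  have in1: "snd (g (0, u)) \<bullet> snd (g (0, v)) = \<mu>\<^sup>2 * (u \<bullet> v)" for u v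
  proof -
    have "snd (g (0, u)) \<bullet> snd (g (0, v)) = - fst ((\<mu> * \<mu>) *\<^sub>R (h \<odot> (im u \<odot> im v) \<odot> qcnj h))"
      by (simp only: inner_im g c qmul_simps scaleR_scaleR)
    also have "\<dots> = - \<mu> * \<mu> * fst (qcnj h \<odot> (h \<odot> (im u \<odot> im v)))"
      by (subst fst_qmul_commute[of "qcnj h"]) simp
    also have "\<dots> = \<mu>\<^sup>2 * (u \<bullet> v)" by (simp only: qmul_assoc[symmetric] hh scaleR_one qmul_simps inner_im power2_eq_square)
    finally show ?thesis .
  qed
  show "k \<noteq> l \<Longrightarrow> snd (g (0, ax k)) \<bullet> snd (g (0, ax l)) = 0"
    by (simp add: in1 inner_axis_axis)
  show "snd (g (0, ax k)) \<bullet> snd (g (0, ax k)) = snd (g (0, ax l)) \<bullet> snd (g (0, ax l))"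
    by (simp add: in1 inner_axis_axis)
  show "im (ax k) \<odot> im (ax l) = im (ax j) \<Longrightarrow>
      rmulU (fst (g (rmulU x (im (ax k)), 0))) (im (snd (g (0, ax l)))) = rmulU (fst (g (x, 0))) (im (snd (g (0, ax j))))"
    by (simp only: g rmulU_rmulU qmul_simps c)
  have "rmulU (fst (g (0, ax k))) (im (snd (g (0, ax k)))) = - rmulU b (\<mu> *\<^sub>R qcnj h)" for k
  proof -
    have "im (ax k) \<odot> qcnj h \<odot> (h \<odot> im (ax k) \<odot> qcnj h) = im (ax k) \<odot> (qcnj h \<odot> h) \<odot> im (ax k) \<odot> qcnj h"
      by (simp only: qmul_assoc)
    also have "\<dots> = - qcnj h" by (simp only: hh scaleR_one qmul_simps im_ax_mult)
    finally show ?thesis by (simp only: g rmulU_rmulU qmul_simps rmulU_simps scaleR_minus_right)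
  qed
  then show "rmulU (fst (g (0, ax k))) (im (snd (g (0, ax k)))) = rmulU (fst (g (0, ax l))) (im (snd (g (0, ax l))))" by metis
qed

text \<open>The linearisation at the identity of the equations in \<open>Ggrp_identities\<close>.\<close>

definition infinitesimal_symmetry :: "('m::finite Wsp \<Rightarrow> 'm Wsp) \<Rightarrow> bool"
  where "infinitesimal_symmetry \<kappa> \<longleftrightarrow> linear \<kappa> \<and>
    (\<forall>x. snd (\<kappa> (x, 0)) = 0) \<and>
    (\<forall>k l. k \<noteq> l \<longrightarrow> snd (\<kappa> (0, ax k)) $ l + snd (\<kappa> (0, ax l)) $ k = 0) \<and>
    (\<forall>k l. snd (\<kappa> (0, ax k)) $ k = snd (\<kappa> (0, ax l)) $ l) \<and>
    (\<forall>k l j x. im (ax k) \<odot> im (ax l) = im (ax j) \<longrightarrow>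
      rmulU (fst (\<kappa> (rmulU x (im (ax k)), 0))) (im (ax l)) + rmulU x (im (ax k) \<odot> im (snd (\<kappa> (0, ax l))))
      = rmulU (fst (\<kappa> (x, 0))) (im (ax j)) + rmulU x (im (snd (\<kappa> (0, ax j))))) \<and>
    (\<forall>k l. rmulU (fst (\<kappa> (0, ax k))) (im (ax k)) = rmulU (fst (\<kappa> (0, ax l))) (im (ax l)))"

text \<open>On Im H an infinitesimal symmetry is \<open>p \<mapsto> m p + \<xi> p - p \<xi>\<close>, and \<open>\<xi> p - p \<xi> = 2 \<xi> \<times> p\<close>; this formula recovers \<open>\<xi>\<close>.\<close>

definition rotation_part :: "('m::finite Wsp \<Rightarrow> 'm Wsp) \<Rightarrow> real^3"
  where "rotation_part \<kappa> = (1/2) *\<^sub>R vector [snd (\<kappa> (0, ax 2)) $ 3, snd (\<kappa> (0, ax 3)) $ 1, snd (\<kappa> (0, ax 1)) $ 2]"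

text \<open>The extension from W to V is forced by H-semilinearity. It is written so that it depends linearly on \<open>\<kappa>\<close>, as the
cochain built from it has to be linear.\<close>

definition extend_symmetry :: "('m::finite Wsp \<Rightarrow> 'm Wsp) \<Rightarrow> 'm Vsp \<Rightarrow> 'm Vsp"
  where "extend_symmetry \<kappa> v =
    (fst (\<kappa> (fst v, 0)) - rmulU (fst (\<kappa> (0, ax 1))) (im (ax 1) \<odot> snd v),
     (snd (\<kappa> (0, ax 1)) $ 1) *\<^sub>R snd v + im (rotation_part \<kappa>) \<odot> snd v - snd v \<odot> im (rotation_part \<kappa>))"

lemma vec3_basis: "v = v $ 1 *\<^sub>R ax 1 + v $ 2 *\<^sub>R ax 2 + v $ 3 *\<^sub>R ax 3"
  by (simp add: vec_eq_iff forall_3 axis_def)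

lemma quat_basis: "q = fst q *\<^sub>R q1 + snd q $ 1 *\<^sub>R im (ax 1) + snd q $ 2 *\<^sub>R im (ax 2) + snd q $ 3 *\<^sub>R im (ax 3)"
  by (simp add: quat_eq_iff axis_def)

lemma ax_nth [simp]: "ax k $ l = (if l = k then 1 else 0)"
  by (simp add: axis_def)

lemma rmulU_real [simp]: "rmulU x (a, 0) = a *\<^sub>R x" and rmulV_real [simp]: "rmulV v (a, 0) = a *\<^sub>R v"
  by (simp_all add: vec_eq_iff prod_eq_iff[of "rmulV _ _"])

lemma linear_parts:
  fixes \<kappa> :: "'a::real_vector \<times> 'b::real_vector \<Rightarrow> 'c::real_vector \<times> 'd::real_vector"
  assumes "linear \<kappa>"
  shows "linear (\<lambda>x. fst (\<kappa> (x, 0)))" "linear (\<lambda>p. fst (\<kappa> (0, p)))" "linear (\<lambda>p. snd (\<kappa> (0, p)))"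
proof -
  have 1: "linear (\<lambda>x. (x, 0) :: 'a \<times> 'b)" "linear (\<lambda>p. (0, p) :: 'a \<times> 'b)"
    and 2: "linear (fst :: 'c \<times> 'd \<Rightarrow> 'c)" "linear (snd :: 'c \<times> 'd \<Rightarrow> 'd)"
    by (simp_all add: linear_iff)
  show "linear (\<lambda>x. fst (\<kappa> (x, 0)))" "linear (\<lambda>p. fst (\<kappa> (0, p)))" "linear (\<lambda>p. snd (\<kappa> (0, p)))"
    using linear_compose[OF linear_compose[OF 1(1) assms] 2(1)] linear_compose[OF linear_compose[OF 1(2) assms] 2(1)]
      linear_compose[OF linear_compose[OF 1(2) assms] 2(2)] by (simp_all add: o_def)
qed

text \<open>The Lie algebra of the conformal group of Euclidean 3-space consists of the maps with antisymmetric off-diagonal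
part and equal diagonal entries.\<close>

lemma extend_symmetry_rotation:
  fixes \<kappa> :: "'m::finite Wsp \<Rightarrow> 'm Wsp"
  assumes "infinitesimal_symmetry \<kappa>"
  shows "im (snd (\<kappa> (0, p))) = (snd (\<kappa> (0, ax 1)) $ 1) *\<^sub>R im p + im (rotation_part \<kappa>) \<odot> im p - im p \<odot> im (rotation_part \<kappa>)"
proof -
  have lin: "linear (\<lambda>p. snd (\<kappa> (0, p)))"
    by (rule linear_parts) (use assms in \<open>simp add: infinitesimal_symmetry_def\<close>)
  have sk: "snd (\<kappa> (0, ax k)) $ l = - snd (\<kappa> (0, ax l)) $ k" if "k \<noteq> l" for k l
    using assms that unfolding infinitesimal_symmetry_def by (metis add_eq_0_iff2)
  have dg: "snd (\<kappa> (0, ax k)) $ k = snd (\<kappa> (0, ax 1)) $ 1" for k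
    using assms unfolding infinitesimal_symmetry_def by metis
  have "snd (\<kappa> (0, p)) = p $ 1 *\<^sub>R snd (\<kappa> (0, ax 1)) + p $ 2 *\<^sub>R snd (\<kappa> (0, ax 2)) + p $ 3 *\<^sub>R snd (\<kappa> (0, ax 3))"
    by (subst vec3_basis[of p]) (simp only: linear_add[OF lin] linear_cmul[OF lin])
  then show ?thesis
    using sk[of 1 2] sk[of 1 3] sk[of 2 3] dg[of 2] dg[of 3]
    by (simp add: quat_eq_iff rotation_part_def vector_def algebra_simps)
qed

lemma extend_symmetry_incl:
  fixes \<kappa> :: "'m::finite Wsp \<Rightarrow> 'm Wsp"
  assumes k: "infinitesimal_symmetry \<kappa>"
  shows "extend_symmetry \<kappa> (incl w) = incl (\<kappa> w)"
proof -
  have lin: "linear \<kappa>" using k by (simp add: infinitesimal_symmetry_def)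
  have w: "\<kappa> w = \<kappa> (fst w, 0) + \<kappa> (0, snd w)" using linear_add[OF lin, of "(fst w, 0)" "(0, snd w)"] by simp
  have linf: "linear (\<lambda>p. fst (\<kappa> (0, p)))"
    by (rule linear_parts[OF lin])
  have b: "rmulU (fst (\<kappa> (0, ax l))) (im (ax l)) = rmulU (fst (\<kappa> (0, ax 1))) (im (ax 1))" for l
    using k unfolding infinitesimal_symmetry_def by metis
  have c: "fst (\<kappa> (0, ax l)) = - rmulU (fst (\<kappa> (0, ax 1))) (im (ax 1) \<odot> im (ax l))" for l
    using arg_cong[OF b[of l], of "\<lambda>z. - rmulU z (im (ax l))"] by (simp add: im_ax_mult(7) del: ax_nth)
  have "fst (\<kappa> (0, a *\<^sub>R ax 1 + b *\<^sub>R ax 2 + c *\<^sub>R ax 3))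
      = - rmulU (fst (\<kappa> (0, ax 1))) (im (ax 1) \<odot> im (a *\<^sub>R ax 1 + b *\<^sub>R ax 2 + c *\<^sub>R ax 3))" for a b c
    by (simp add: linear_add[OF linf] linear_cmul[OF linf] im_linear qmul_add rmulU_add rmulU_diff c[of 2] c[of 3] im_ax_mult)
  from this[of "p $ 1" "p $ 2" "p $ 3" for p :: "real^3", unfolded vec3_basis[symmetric]]
  have f: "fst (\<kappa> (0, p)) = - rmulU (fst (\<kappa> (0, ax 1))) (im (ax 1) \<odot> im p)" for p .
  have "snd (\<kappa> (fst w, 0)) = 0" using k by (simp add: infinitesimal_symmetry_def)
  then show ?thesis
    using extend_symmetry_rotation[OF k, of "snd w"] f[of "snd w"]
    by (simp add: extend_symmetry_def incl_def w)
qed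

text \<open>Put \<open>A x = \<kappa> x + x \<xi>\<close>. The linearised semilinearity equations for two units \<open>i\<^sub>k i\<^sub>l = i\<^sub>j\<close> become \<open>A (x i\<^sub>k) i\<^sub>l = A x i\<^sub>j\<close>, because the
terms with \<open>\<xi>\<close> cancel. Multiplication by \<open>i\<^sub>l\<close> gives H-linearity of A.\<close>

lemma extend_symmetry_gtilde:
  fixes \<kappa> :: "'m::finite Wsp \<Rightarrow> 'm Wsp"
  assumes k: "infinitesimal_symmetry \<kappa>"
  shows "extend_symmetry \<kappa> \<in> gtilde"
proof -
  define \<xi> where "\<xi> = rotation_part \<kappa>"
  define m where "m = snd (\<kappa> (0, ax 1)) $ 1"
  have lin: "linear \<kappa>" using k by (simp add: infinitesimal_symmetry_def)
  define A where "A x = fst (\<kappa> (x, 0)) + rmulU x (im \<xi>)" for x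
  have "linear (\<lambda>x. rmulU x (im \<xi>))" by (simp add: linear_iff rmulU_add)
  from linear_compose_add[OF linear_parts(1)[OF lin] this] have linA: "linear A" unfolding A_def .
  have rot: "im (snd (\<kappa> (0, p))) = m *\<^sub>R im p + im \<xi> \<odot> im p - im p \<odot> im \<xi>" for p
    unfolding m_def \<xi>_def by (rule extend_symmetry_rotation[OF k])
  have cyc: "A (rmulU x (im (ax k))) = rmulU (A x) (im (ax k))" if klj: "im (ax k) \<odot> im (ax l) = im (ax j)" for x k l j
  proof -
    have "rmulU (fst (\<kappa> (rmulU x (im (ax k)), 0))) (im (ax l)) + rmulU x (im (ax k) \<odot> im (snd (\<kappa> (0, ax l))))
      = rmulU (fst (\<kappa> (x, 0))) (im (ax j)) + rmulU x (im (snd (\<kappa> (0, ax j))))"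
      using k klj unfolding infinitesimal_symmetry_def by blast
    then have "rmulU (A (rmulU x (im (ax k)))) (im (ax l)) = rmulU (A x) (im (ax j))"
      by (simp add: A_def rot rmulU_add rmulU_diff qmul_add qmul_diff qmul_assoc[symmetric] klj algebra_simps)
    then have "rmulU (A (rmulU x (im (ax k)))) (im (ax l) \<odot> im (ax l)) = rmulU (A x) (im (ax k) \<odot> (im (ax l) \<odot> im (ax l)))"
      by (simp only: rmulU_rmulU[symmetric] qmul_assoc[symmetric] klj)
    then show ?thesis by (simp only: im_ax_mult rmulU_simps qmul_simps neg_equal_iff_equal scaleR_one)
  qed
  have A3: "A (rmulU x (im (ax k))) = rmulU (A x) (im (ax k))" for x k
    using exhaust_3[of k] cyc[OF im_ax_mult(1)] cyc[OF im_ax_mult(2)] cyc[OF im_ax_mult(3)] by blast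
  have "A (rmulU x (a *\<^sub>R q1 + b *\<^sub>R im (ax 1) + c *\<^sub>R im (ax 2) + d *\<^sub>R im (ax 3)))
     = rmulU (A x) (a *\<^sub>R q1 + b *\<^sub>R im (ax 1) + c *\<^sub>R im (ax 2) + d *\<^sub>R im (ax 3))" for x a b c d
    by (simp only: rmulU_add rmulU_simps linear_add[OF linA] linear_cmul[OF linA] A3)
  from this[of _ "fst q" "snd q $ 1" "snd q $ 2" "snd q $ 3" for q :: quat, unfolded quat_basis[symmetric]]
  have AA: "A (rmulU x q) = rmulU (A x) q" for x q .
  define B where "B v = (A (fst v) - rmulU (fst (\<kappa> (0, ax 1))) (im (ax 1) \<odot> snd v), m *\<^sub>R snd v + im \<xi> \<odot> snd v)" for v :: "'m Vsp"
  have "hlinear B" unfolding hlinear_def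
  proof (intro conjI allI)
    show "linear B" unfolding B_def
      by (simp add: linear_iff rmulU_add qmul_add linear_add[OF linA] linear_cmul[OF linA] algebra_simps del: qmul_components)
    show "B (rmulV v q) = rmulV (B v) q" for v q
      unfolding B_def rmulV_def by (simp add: AA rmulU_diff qmul_assoc qmul_add del: qmul_components)
  qed
  moreover have "extend_symmetry \<kappa> = (\<lambda>v. B v - rmulV v (im \<xi>))"
    by (rule ext) (simp add: extend_symmetry_def B_def A_def m_def \<xi>_def rmulV_def)
  ultimately show ?thesis unfolding gtilde_def by blast
qed

lemma gtilde_linear: "B \<in> gtilde \<Longrightarrow> linear B"
  unfolding gtilde_def using linear_compose_sub[OF hlinear_linear linear_rmulV] by blast

lemma gtildeI: "hlinear A \<Longrightarrow> B = (\<lambda>v. A v - rmulV v (im \<xi>)) \<Longrightarrow> B \<in> gtilde"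
  unfolding gtilde_def by blast

lemma gtilde_add:
  assumes "B \<in> gtilde" "B' \<in> gtilde"
  shows "(\<lambda>v. B v + B' v) \<in> gtilde"
proof -
  obtain A \<xi> where 1: "B = (\<lambda>v. A v - rmulV v (im \<xi>))" "hlinear A" using assms unfolding gtilde_def by blast
  obtain A' \<xi>' where 2: "B' = (\<lambda>v. A' v - rmulV v (im \<xi>'))" "hlinear A'" using assms unfolding gtilde_def by blast
  show ?thesis
  proof (rule gtildeI)
    show "hlinear (\<lambda>v. A v + A' v)"
      using 1(2) 2(2) linear_compose_add unfolding hlinear_def by (simp add: rmulV_add linear_compose_add del: split_paired_All)
    show "(\<lambda>v. B v + B' v) = (\<lambda>v. (A v + A' v) - rmulV v (im (\<xi> + \<xi>')))"
      unfolding 1 2 im_linear rmulV_add by (rule ext) simp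
  qed
qed

lemma gtilde_scaleR:
  assumes "B \<in> gtilde"
  shows "(\<lambda>v. r *\<^sub>R B v) \<in> gtilde"
proof -
  obtain A \<xi> where 1: "B = (\<lambda>v. A v - rmulV v (im \<xi>))" "hlinear A" using assms unfolding gtilde_def by blast
  show ?thesis
  proof (rule gtildeI)
    show "hlinear (\<lambda>v. r *\<^sub>R A v)"
      using 1(2) unfolding hlinear_def by (simp add: linear_compose_scale_right del: split_paired_All)
    show "(\<lambda>v. r *\<^sub>R B v) = (\<lambda>v. r *\<^sub>R A v - rmulV v (im (r *\<^sub>R \<xi>)))"
      unfolding 1 im_linear rmulV_simps by (rule ext) (simp add: scaleR_diff_right)
  qed
qed

lemma gtilde_conj:
  assumes "F \<in> Gtilde" "B \<in> gtilde"
  shows "inv F \<circ> B \<circ> F \<in> gtilde"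
proof -
  obtain A \<xi> where 1: "B = (\<lambda>v. A v - rmulV v (im \<xi>))" "hlinear A" using assms unfolding gtilde_def by blast
  obtain C h where 2: "hlinear C" "bij C" "norm h = 1" "F = (\<lambda>v. rmulV (C v) (qcnj h))"
    using assms(1) unfolding Gtilde_def by blast
  note hh = qmul_cnj_unit[OF 2(3)]
  have C': "C (inv C v) = v" "inv C (C v) = v" for v using 2(2) by (simp_all add: bij_is_surj surj_f_inv_f bij_is_inj)
  have linC': "linear (inv C)"
      by (rule inj_linear_imp_inv_linear[OF hlinear_linear[OF 2(1)] bij_is_inj[OF 2(2)]])
  have C'q: "inv C (rmulV v q) = rmulV (inv C v) q" for v q
  proof -
    have "C (inv C (rmulV v q)) = C (rmulV (inv C v) q)" by (simp only: C' hlinear_rmulV[OF 2(1)])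
    from arg_cong[OF this, of "inv C"] show ?thesis by (simp only: C')
  qed
  have Fi: "inv F = (\<lambda>v. rmulV (inv C v) h)"
  proof (rule inv_equality)
    show "rmulV (inv C (F x)) h = x" for x
      by (simp only: 2(4) C'q C' hh rmulV_rmulV rmulV_simps scaleR_one)
    show "F (rmulV (inv C x) h) = x" for x
      by (simp only: 2(4) hlinear_rmulV[OF 2(1)] C' hh rmulV_rmulV rmulV_simps)
  qed
  have im: "qcnj h \<odot> (im \<xi> \<odot> h) = im (snd (qcnj h \<odot> (im \<xi> \<odot> h)))"
  proof -
    have "fst (qcnj h \<odot> (im \<xi> \<odot> h)) = 0" by (simp add: algebra_simps)
    then show ?thesis by (simp only: prod_eq_iff im_components)
  qed
  show ?thesis
  proof (rule gtildeI)
    show "hlinear (\<lambda>v. inv C (A (C v)))"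
      unfolding hlinear_def hlinear_rmulV[OF 2(1)] hlinear_rmulV[OF 1(2)] C'q
      using linear_compose[OF linear_compose[OF hlinear_linear[OF 2(1)] hlinear_linear[OF 1(2)]] linC']
      by (simp add: o_def)
    show "inv F \<circ> B \<circ> F = (\<lambda>v. inv C (A (C v)) - rmulV v (im (snd (qcnj h \<odot> (im \<xi> \<odot> h)))))"
      unfolding Fi unfolding 1(1) 2(4) im[symmetric]
      by (rule ext) (simp only: o_apply linear_diff[OF linC'] rmulV_diff C'q C' hlinear_rmulV[OF 1(2)] rmulV_rmulV qmul_assoc hh qmul_simps rmulV_simps scaleR_one)
  qed
qed

section \<open>Differentiating families of linear maps\<close>

lemma has_derivative_const_on_open:
  assumes "open N" "x \<in> N" "(f has_derivative f') (at x)" "\<And>y. y \<in> N \<Longrightarrow> f y = c"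
  shows "f' h = 0"
proof -
  have "((\<lambda>y. c) has_derivative f') (at x)"
    using has_derivative_transform_within_open[OF assms(3,1,2)] assms(4) by metis
  then show ?thesis using has_derivative_unique[OF has_derivative_const] by metis
qed

lemma derivative_of_linear_family:
  fixes A :: "'a::real_normed_vector \<Rightarrow> 'b::real_normed_vector \<Rightarrow> 'c::real_normed_vector"
  assumes "open N" "x \<in> N" "\<And>y. y \<in> N \<Longrightarrow> linear (A y)"
    and D: "\<And>v. ((\<lambda>y. A y v) has_derivative (\<lambda>h. D h v)) (at x)"
  shows "linear (D h)" and "linear (\<lambda>h. D h v)"
proof -
  have "D h (u + v) - (D h u + D h v) = 0" for u v
    by (rule has_derivative_const_on_open[OF assms(1,2), where f = "\<lambda>y. A y (u + v) - (A y u + A y v)"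
          and f' = "\<lambda>h. D h (u + v) - (D h u + D h v)" and c = 0])
       (auto intro!: derivative_intros D simp: linear_add[OF assms(3)])
  moreover have "D h (r *\<^sub>R v) - r *\<^sub>R D h v = 0" for r v
    by (rule has_derivative_const_on_open[OF assms(1,2), where f = "\<lambda>y. A y (r *\<^sub>R v) - r *\<^sub>R A y v"
          and f' = "\<lambda>h. D h (r *\<^sub>R v) - r *\<^sub>R D h v" and c = 0])
       (auto intro!: derivative_intros D simp: linear_cmul[OF assms(3)])
  ultimately show "linear (D h)" by (auto intro!: linearI)
  show "linear (\<lambda>h. D h v)" using D[of v] has_derivative_linear by blast
qed

lemma linear_basis_expansion:
  fixes f :: "'a::euclidean_space \<Rightarrow> 'b::real_vector"
  assumes "linear f" shows "f v = (\<Sum>b\<in>Basis. (v \<bullet> b) *\<^sub>R f b)"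
  by (subst euclidean_representation[of v, symmetric]) (simp only: linear_sum[OF assms] linear_cmul[OF assms])

lemma has_derivative_family_apply:
  fixes A :: "'a::real_normed_vector \<Rightarrow> 'b::euclidean_space \<Rightarrow> 'c::real_normed_vector"
  assumes N: "open N" "x \<in> N" "\<And>y. y \<in> N \<Longrightarrow> linear (A y)"
    and D: "\<And>v. ((\<lambda>y. A y v) has_derivative (\<lambda>h. D h v)) (at x)"
    and u: "(u has_derivative u') (at x)"
  shows "((\<lambda>y. A y (u y)) has_derivative (\<lambda>h. D h (u x) + A x (u' h))) (at x)"
proof -
  have "((\<lambda>y. \<Sum>b\<in>Basis. (u y \<bullet> b) *\<^sub>R A y b) has_derivative
      (\<lambda>h. \<Sum>b\<in>Basis. (u x \<bullet> b) *\<^sub>R D h b + (u' h \<bullet> b) *\<^sub>R A x b)) (at x)"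
    by (auto intro!: derivative_eq_intros D u)
  also have "(\<lambda>h. \<Sum>b\<in>Basis. (u x \<bullet> b) *\<^sub>R D h b + (u' h \<bullet> b) *\<^sub>R A x b) = (\<lambda>h. D h (u x) + A x (u' h))"
    by (rule ext) (simp only: sum.distrib linear_basis_expansion[OF N(3)[OF N(2)], of "u' _", symmetric]
        linear_basis_expansion[OF derivative_of_linear_family(1)[OF N D], of _ "u x", symmetric])
  finally show ?thesis
    by (rule has_derivative_transform_within_open[OF _ N(1,2)]) (simp only: linear_basis_expansion[OF N(3), symmetric])
qed

text \<open>The inverse of a family of operators is differentiable because \<open>(y, v) \<mapsto> (y, A y v)\<close> is a map whose inverse is
\<open>(y, v) \<mapsto> (y, (A y)\<^sup>-\<^sup>1 v)\<close>, so the inverse function theorem applies to it.\<close>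

lemma has_derivative_inverse_family:
  fixes A :: "'a::euclidean_space \<Rightarrow> 'b::euclidean_space \<Rightarrow> 'b"
  assumes N: "open N" "x \<in> N" "\<And>y. y \<in> N \<Longrightarrow> linear (A y)" and bij: "\<And>y. y \<in> N \<Longrightarrow> bij (A y)"
    and cont: "\<And>v. continuous_on N (\<lambda>y. A y v)"
    and D: "\<And>v. ((\<lambda>y. A y v) has_derivative (\<lambda>h. D h v)) (at x)"
  shows "((\<lambda>y. inv (A y) v) has_derivative (\<lambda>h. - inv (A x) (D h (inv (A x) v)))) (at x)"
proof -
  define v0 where "v0 = inv (A x) v"
  \<comment> \<open>The map to which the inverse function theorem is applied.\<close>
  define f where "f z = (fst z, A (fst z) (snd z))" for z
  define g where "g z = (fst z, inv (A (fst z)) (snd z))" for z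
  have S: "open (N \<times> (UNIV :: 'b set))" "(x, v0) \<in> N \<times> UNIV" using N by (auto intro: open_Times)
  have fst: "(fst has_derivative fst) (at z)" and snd: "(snd has_derivative snd) (at z)" for z :: "'a \<times> 'b"
    by (simp_all add: has_derivative_fst has_derivative_snd bounded_linear_imp_has_derivative bounded_linear_fst bounded_linear_snd)
  have AF: "((\<lambda>z. A (fst z) v) has_derivative (\<lambda>h. D (fst h) v)) (at (x, v0))" for v
    using has_derivative_compose[OF fst[of "(x, v0)"], of "\<lambda>y. A y v"] D[of v] by simp
  have "((\<lambda>z. A (fst z) (snd z)) has_derivative (\<lambda>h. D (fst h) (snd (x,v0)) + A (fst (x, v0)) (snd h))) (at (x, v0))"
    by (rule has_derivative_family_apply[OF S _ AF snd]) (auto intro: N(3))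
  then have df: "(f has_derivative (\<lambda>h. (fst h, D (fst h) v0 + A x (snd h)))) (at (x, v0))"
    unfolding f_def by (auto intro!: derivative_eq_intros)
  have "continuous_on (N \<times> UNIV) (\<lambda>z. \<Sum>b\<in>Basis. (snd z \<bullet> b) *\<^sub>R A (fst z) b)"
    by (intro continuous_intros continuous_on_compose2[OF cont]) auto
  then have "continuous_on (N \<times> UNIV) (\<lambda>z. A (fst z) (snd z))"
    by (rule continuous_on_eq) (auto simp only: mem_Times_iff linear_basis_expansion[OF N(3), symmetric])
  then have cf: "continuous_on (N \<times> UNIV) f" unfolding f_def by (intro continuous_intros)
  have inv: "inv (A y) (A y w) = w" "A y (inv (A y) w) = w" if "y \<in> N" for y w
    using bij[OF that] by (simp_all add: bij_is_inj bij_is_surj surj_f_inv_f)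
  have "(g has_derivative (\<lambda>h. (fst h, inv (A x) (snd h - D (fst h) v0)))) (at (f (x, v0)))"
  proof (rule has_derivative_inverse_strong[OF S cf _ df])
    show "g (f z) = z" if "z \<in> N \<times> UNIV" for z using that inv by (auto simp: f_def g_def)
    show "(\<lambda>h. (fst h, D (fst h) v0 + A x (snd h))) \<circ> (\<lambda>h. (fst h, inv (A x) (snd h - D (fst h) v0))) = id"
      by (rule ext) (simp add: inv[OF N(2)])
  qed
  moreover have "f (x, v0) = (x, v)" by (simp add: f_def v0_def inv[OF N(2)])
  ultimately have "(g has_derivative (\<lambda>h. (fst h, inv (A x) (snd h - D (fst h) v0)))) (at (x, v))" by simp
  moreover have "((\<lambda>y. (y, v)) has_derivative (\<lambda>h. (h, 0))) (at x)" by (auto intro!: derivative_eq_intros)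
  ultimately have "((\<lambda>y. g (y, v)) has_derivative (\<lambda>h. (h, inv (A x) (- D h v0)))) (at x)"
    using has_derivative_compose[of "\<lambda>y. (y, v)" "\<lambda>h. (h, 0)" x UNIV g] by fastforce
  then have "((\<lambda>y. snd (g (y, v))) has_derivative (\<lambda>h. inv (A x) (- D h v0))) (at x)"
    using has_derivative_snd by fastforce
  moreover have "linear (inv (A x))"
    by (rule inj_linear_imp_inv_linear[OF N(3)[OF N(2)] bij_is_inj[OF bij[OF N(2)]]])
  ultimately show ?thesis by (simp add: g_def linear_neg v0_def)
qed

text \<open>A tangent vector of G at the identity satisfies the linearised equations: each identity of \<open>Ggrp_identities\<close> is constant
along the family.\<close>

lemma Ggrp_derivative:
  fixes \<kappa> :: "'a::real_normed_vector \<Rightarrow> 'm::finite Wsp \<Rightarrow> 'm Wsp"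
  assumes N: "open N" "x \<in> N" and G: "\<And>y. y \<in> N \<Longrightarrow> \<kappa> y \<in> Ggrp" and id: "\<kappa> x = id"
    and D: "\<And>w. ((\<lambda>y. \<kappa> y w) has_derivative (\<lambda>h. D h w)) (at x)"
  shows "infinitesimal_symmetry (D h)"
proof -
  note const = has_derivative_const_on_open[OF N]
  have bb: "bounded_bilinear (rmulU :: 'm Usp \<Rightarrow> quat \<Rightarrow> 'm Usp)"
    using bilinear_rmulU bilinear_conv_bounded_bilinear by blast
  have bi: "bounded_linear im" using linear_im linear_conv_bounded_linear by blast
  note d1 = has_derivative_fst[OF D] and d2 = has_derivative_snd[OF D]
  note d3 = bounded_linear.has_derivative[OF bi d2]
  note dm = bounded_bilinear.FDERIV[OF bb d1 d3]
  have "linear (D h)"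
    by (rule derivative_of_linear_family(1)[OF N _ D]) (rule Ggrp_linear_bij(1)[OF G])
  moreover have "snd (D h (z, 0)) = 0" for z
    by (rule const[OF d2]) (rule Ggrp_identities(1)[OF G])
  moreover have "snd (D h (0, ax k)) $ l + snd (D h (0, ax l)) $ k = 0" if "k \<noteq> l" for k l
  proof -
    have "snd (\<kappa> x (0, ax k)) \<bullet> snd (D h (0, ax l)) + snd (D h (0, ax k)) \<bullet> snd (\<kappa> x (0, ax l)) = 0"
      by (rule const[OF has_derivative_inner[OF d2 d2]]) (rule Ggrp_identities(2)[OF G that])
    then show ?thesis by (simp add: id inner_axis inner_axis' add.commute)
  qed
  moreover have "snd (D h (0, ax k)) $ k = snd (D h (0, ax l)) $ l" for k l
  proof -
    have "(snd (\<kappa> x (0, ax k)) \<bullet> snd (D h (0, ax k)) + snd (D h (0, ax k)) \<bullet> snd (\<kappa> x (0, ax k)))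
       - (snd (\<kappa> x (0, ax l)) \<bullet> snd (D h (0, ax l)) + snd (D h (0, ax l)) \<bullet> snd (\<kappa> x (0, ax l))) = 0"
      by (rule const[where c = 0, OF has_derivative_diff[OF has_derivative_inner[OF d2 d2] has_derivative_inner[OF d2 d2]]])
         (simp only: right_minus_eq, rule Ggrp_identities(3)[OF G])
    then show ?thesis by (simp add: id inner_axis inner_axis')
  qed
  moreover have "rmulU (fst (D h (rmulU z (im (ax k)), 0))) (im (ax l)) + rmulU z (im (ax k) \<odot> im (snd (D h (0, ax l))))
      = rmulU (fst (D h (z, 0))) (im (ax j)) + rmulU z (im (snd (D h (0, ax j))))"
    if "im (ax k) \<odot> im (ax l) = im (ax j)" for k l j z
  proof -
    have "(rmulU (fst (\<kappa> x (rmulU z (im (ax k)), 0))) (im (snd (D h (0, ax l)))) +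
        rmulU (fst (D h (rmulU z (im (ax k)), 0))) (im (snd (\<kappa> x (0, ax l))))) -
        (rmulU (fst (\<kappa> x (z, 0))) (im (snd (D h (0, ax j)))) + rmulU (fst (D h (z, 0))) (im (snd (\<kappa> x (0, ax j))))) = 0"
      by (rule const[where c = 0, OF has_derivative_diff[OF dm dm]])
         (simp only: right_minus_eq, rule Ggrp_identities(4)[OF G that])
    then show ?thesis by (simp add: id add.commute)
  qed
  moreover have "rmulU (fst (D h (0, ax k))) (im (ax k)) = rmulU (fst (D h (0, ax l))) (im (ax l))" for k l
  proof -
    have "(rmulU (fst (\<kappa> x (0, ax k))) (im (snd (D h (0, ax k)))) + rmulU (fst (D h (0, ax k))) (im (snd (\<kappa> x (0, ax k))))) -
     (rmulU (fst (\<kappa> x (0, ax l))) (im (snd (D h (0, ax l)))) + rmulU (fst (D h (0, ax l))) (im (snd (\<kappa> x (0, ax l))))) = 0"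
      by (rule const[where c = 0, OF has_derivative_diff[OF dm dm]])
         (simp only: right_minus_eq, rule Ggrp_identities(5)[OF G])
    then show ?thesis by (simp add: id)
  qed
  ultimately show ?thesis unfolding infinitesimal_symmetry_def by blast
qed

section \<open>Smoothness of quadratic maps\<close>

text \<open>A directional derivative of a quadratic map is affine, hence again quadratic, and the induction on the order closes.\<close>

lemma Ck_on_quadratic:
  fixes l :: "'a::euclidean_space \<Rightarrow> 'b::euclidean_space"
  assumes "linear l" "bilinear B"
  shows "Ck_on k S (\<lambda>x. c + l x + B x x)"
  using assms
proof (induction k arbitrary: c l B)
  case 0
  then interpret l: bounded_linear l by (simp add: linear_conv_bounded_linear)
  from 0 interpret B: bounded_bilinear B by (simp add: bilinear_conv_bounded_bilinear)
  show ?case by (auto intro!: continuous_intros l.continuous_on B.continuous_on)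
next
  case (Suc k)
  then interpret l: bounded_linear l by (simp add: linear_conv_bounded_linear)
  from Suc interpret B: bounded_bilinear B by (simp add: bilinear_conv_bounded_bilinear)
  have "((\<lambda>x. c + l x + B x x) has_derivative (\<lambda>v. l v + (B x v + B v x))) (at x)" for x
    by (auto intro!: derivative_eq_intros l.has_derivative B.FDERIV)
  moreover have "Ck_on k S (\<lambda>x. l v + (B x v + B v x))" for v
  proof -
    have "Ck_on k S (\<lambda>x. l v + (B x v + B v x) + (\<lambda>_ _. 0) x x)"
      by (rule Suc.IH) (auto simp: linear_iff bilinear_def B.add_left B.add_right B.scaleR_left B.scaleR_right algebra_simps)
    then show ?thesis by simp
  qed
  ultimately show ?case unfolding Ck_on.simps
    by (intro exI[of _ "\<lambda>x v. l v + (B x v + B v x)"]) simp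
qed

lemma smooth_on_quadratic:
  fixes l :: "'a::euclidean_space \<Rightarrow> 'b::euclidean_space"
  assumes "open S" "linear l" "bilinear B" "\<And>x. x \<in> S \<Longrightarrow> f x = c + l x + B x x"
  shows "smooth_on S f"
proof -
  have *: "Ck_on k S g \<Longrightarrow> (\<And>x. x \<in> S \<Longrightarrow> f x = g x) \<Longrightarrow> Ck_on k S f" for k and f g :: "'a \<Rightarrow> 'b"
  proof (induction k arbitrary: f g)
    case 0
    then show ?case using continuous_on_cong by force
  next
    case (Suc k)
    then obtain g' where g': "\<And>x. x \<in> S \<Longrightarrow> (g has_derivative g' x) (at x)" "\<And>v. Ck_on k S (\<lambda>x. g' x v)"
      unfolding Ck_on.simps by blast
    then have "(f has_derivative g' x) (at x)" if "x \<in> S" for x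
      using has_derivative_transform_within_open[OF g'(1)[OF that] assms(1) that] Suc.prems(2) by metis
    then show ?case unfolding Ck_on.simps using g'(2) by blast
  qed
  show ?thesis unfolding smooth_on_def using *[OF Ck_on_quadratic[OF assms(2,3)] assms(4)] assms(1) by blast
qed

lemma smooth_on_has_derivative: "smooth_on S f \<Longrightarrow> x \<in> S \<Longrightarrow> (f has_derivative frechet_derivative f (at x)) (at x)"
  unfolding smooth_on_def using Ck_on.simps(2) frechet_derivative_works differentiable_def by metis

lemma smooth_on_continuous: "smooth_on S f \<Longrightarrow> continuous_on S f"
  unfolding smooth_on_def using Ck_on.simps(1) by metis

section \<open>The left-invariant frame\<close>

lemma bracket_tensors_bilinear: "L \<in> bracket_tensors \<Longrightarrow> bilinear L"
  by (simp add: bracket_tensors_def)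

lemma bracket_tensors_skew:
  assumes "L \<in> bracket_tensors" shows "L x y = - L y x"
proof -
  have "L (x + y) (x + y) = 0" "L x x = 0" "L y y = 0" using assms by (simp_all add: bracket_tensors_def)
  then have "L x y + L y x = 0"
    by (simp add: bilinear_ladd[OF bracket_tensors_bilinear[OF assms]] bilinear_radd[OF bracket_tensors_bilinear[OF assms]] add.commute)
  then show ?thesis by (simp add: eq_neg_iff_add_eq_0)
qed

lemma bilinear_linear: "bilinear L \<Longrightarrow> linear (L x)" "bilinear L \<Longrightarrow> linear (\<lambda>x. L x y)"
  by (simp_all add: bilinear_def)

lemma heis_frame_eq:
  assumes "bilinear L"
  shows "heis_frame L x w = (fst w, snd w + (1/2) *\<^sub>R L (fst x) (fst w))"
proof -
  have "bounded_linear (\<lambda>w. L (fst x) (fst w))"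
    using bounded_linear_compose[OF _ bounded_linear_fst] bilinear_linear(1)[OF assms] linear_conv_bounded_linear by blast
  from bounded_linear_imp_has_derivative[OF this, of "at 0"]
  have "((\<lambda>w. L (fst x) (fst w)) has_derivative (\<lambda>w. L (fst x) (fst w))) (at 0)" .
  then have "(heis_mult L x has_derivative (\<lambda>w. w + (1/2) *\<^sub>R (0, L (fst x) (fst w)))) (at 0)"
    unfolding heis_mult_def by (auto intro!: derivative_eq_intros)
  from frechet_derivative_at[OF this] have "heis_frame L x = (\<lambda>w. w + (1/2) *\<^sub>R (0, L (fst x) (fst w)))"
    unfolding heis_frame_def by simp
  then show ?thesis by (simp add: prod_eq_iff)
qed

lemma heis_frame_inv:
  assumes "bilinear L"
  shows "bij (heis_frame L x)" "inv (heis_frame L x) w = (fst w, snd w - (1/2) *\<^sub>R L (fst x) (fst w))"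
proof -
  let ?g = "\<lambda>w. (fst w, snd w - (1/2) *\<^sub>R L (fst x) (fst w))"
  have 1: "?g (heis_frame L x w) = w" "heis_frame L x (?g w) = w" for w
    by (simp_all add: heis_frame_eq[OF assms])
  show "bij (heis_frame L x)" by (rule bij_betw_byWitness[where f' = ?g]) (use 1 in simp_all)
  show "inv (heis_frame L x) w = ?g w" by (rule fun_cong[OF inv_equality]) (use 1 in simp_all)
qed

lemma heis_frame_linear: "bilinear L \<Longrightarrow> linear (heis_frame L x)"
  by (simp add: linear_iff heis_frame_eq bilinear_radd bilinear_rmul algebra_simps)

lemma heis_frame_has_derivative:
  assumes "bilinear L"
  shows "((\<lambda>y. heis_frame L y w) has_derivative (\<lambda>h. (0, (1/2) *\<^sub>R L (fst h) (fst w)))) (at x)"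
proof -
  have "bounded_linear (\<lambda>y. L (fst y) (fst w))"
    using bounded_linear_compose[OF _ bounded_linear_fst] bilinear_linear(2)[OF assms] linear_conv_bounded_linear by blast
  from bounded_linear_imp_has_derivative[OF this, of "at x"]
  show ?thesis unfolding heis_frame_eq[OF assms] by (auto intro!: derivative_eq_intros)
qed

lemma heis_frame_smooth:
  assumes "bilinear L" shows "frame_field UNIV (heis_frame L)"
proof -
  have "smooth_on UNIV (\<lambda>x. heis_frame L x v)" for v
    by (rule smooth_on_quadratic[where c = v and l = "\<lambda>x. (0, (1/2) *\<^sub>R L (fst x) (fst v))" and B = "\<lambda>_ _. 0"])
       (auto simp: linear_iff bilinear_def heis_frame_eq[OF assms] prod_eq_iff bilinear_ladd[OF assms] bilinear_lmul[OF assms] algebra_simps)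
  then show ?thesis unfolding frame_field_def smooth_op_on_def
    using heis_frame_linear[OF assms] heis_frame_inv(1)[OF assms] by auto
qed

lemma frame_field_comp:
  assumes "frame_field N s" "linear g" "bij g"
  shows "frame_field N (\<lambda>x. s x \<circ> g)"
  using assms linear_compose[OF assms(2)] bij_comp[OF assms(3)]
  unfolding frame_field_def smooth_op_on_def o_apply by blast

lemma heis_structure_iff: "u \<in> heis_structure L x \<longleftrightarrow> (\<exists>g\<in>Ggrp. u = heis_frame L x \<circ> g)"
  by (auto simp: heis_structure_def)

lemma heis_frame_section:
  assumes "bilinear L" "g \<in> Ggrp"
  shows "local_section (heis_structure L) UNIV (\<lambda>x. heis_frame L x \<circ> g)"
  unfolding local_section_def using frame_field_comp[OF heis_frame_smooth[OF assms(1)] Ggrp_linear_bij[OF assms(2)]] assms(2)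
  by (auto simp: heis_structure_iff)

lemma heis_almost_CR: "bilinear L \<Longrightarrow> almost_CR_quaternionic (heis_structure L)"
  unfolding almost_CR_quaternionic_def using heis_frame_smooth by (auto simp: heis_structure_def)

section \<open>The essential curvature of the structure associated with a bracket\<close>

text \<open>Needed to turn a linear family of infinitesimal symmetries into a cochain in \<open>cochains1\<close>.\<close>

lemma linear_extend_symmetry:
  assumes "\<And>u. linear (\<lambda>w. K w u)"
  shows "linear (\<lambda>w. extend_symmetry (K w) v)"
proof -
  note a = linear_add[OF assms] and c = linear_cmul[OF assms]
  have "rotation_part (K (x + y)) = rotation_part (K x) + rotation_part (K y)" for x y
    by (simp add: rotation_part_def a vector_def vec_eq_iff forall_3)
  moreover have "rotation_part (K (r *\<^sub>R x)) = r *\<^sub>R rotation_part (K x)" for x r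
    by (simp add: rotation_part_def c vector_def vec_eq_iff forall_3)
  ultimately show ?thesis
    by (simp add: linear_iff extend_symmetry_def a c im_linear qmul_add rmulU_add algebra_simps del: qmul_components)
qed

lemma cochains1_add: "c \<in> cochains1 \<Longrightarrow> c' \<in> cochains1 \<Longrightarrow> (\<lambda>w v. c w v + c' w v) \<in> cochains1"
  unfolding cochains1_def mem_Collect_eq by (intro conjI allI; rule gtilde_add linear_compose_add; blast)

lemma cochains1_uminus: "c \<in> cochains1 \<Longrightarrow> (\<lambda>w v. - c w v) \<in> cochains1"
  unfolding cochains1_def mem_Collect_eq
  by (intro conjI allI; (rule gtilde_scaleR[of _ "-1", simplified] linear_compose_neg); blast)

lemma cochains1_zero: "(\<lambda>w v. 0) \<in> cochains1"
proof -
  have "(\<lambda>v. 0) \<in> gtilde" 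
    by (rule gtildeI[of "\<lambda>v. 0" _ 0]) (simp_all add: hlinear_def linear_iff im_linear)
  then show ?thesis by (simp add: cochains1_def linear_iff)
qed

lemma H02_class_eqI:
  assumes "c \<in> cochains1" "\<And>w1 w2. \<tau> w1 w2 = \<tau>' w1 w2 + spencer c w1 w2"
  shows "H02_class \<tau> = H02_class \<tau>'"
proof -
  have sub: "H02_class \<tau> \<subseteq> H02_class \<tau>'" if "c \<in> cochains1" "\<And>w1 w2. \<tau> w1 w2 = \<tau>' w1 w2 + spencer c w1 w2" for \<tau> \<tau>' c
  proof
    fix \<sigma> assume "\<sigma> \<in> H02_class \<tau>"
    then obtain d where d: "d \<in> cochains1" "\<sigma> = (\<lambda>w1 w2. \<tau> w1 w2 + spencer d w1 w2)" unfolding H02_class_def by blast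
    have "\<sigma> = (\<lambda>w1 w2. \<tau>' w1 w2 + spencer (\<lambda>w v. c w v + d w v) w1 w2)"
      unfolding d(2) that(2) spencer_def by (intro ext) simp
    then show "\<sigma> \<in> H02_class \<tau>'" unfolding H02_class_def using cochains1_add[OF that(1) d(1)] by blast
  qed
  moreover have "H02_class \<tau>' \<subseteq> H02_class \<tau>"
    by (rule sub[OF cochains1_uminus[OF assms(1)]]) (simp add: assms(2) spencer_def)
  ultimately show ?thesis using assms by blast
qed

lemma H02_class_eqD:
  assumes "H02_class \<tau> = H02_class \<tau>'"
  obtains c where "c \<in> cochains1" "\<And>w1 w2. \<tau> w1 w2 = \<tau>' w1 w2 + spencer c w1 w2"
proof -
  have "\<tau> \<in> H02_class \<tau>" unfolding H02_class_def
    by (rule CollectI, rule exI[of _ "\<lambda>w v. 0"]) (use cochains1_zero in \<open>simp add: spencer_def\<close>)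
  then have "\<tau> \<in> H02_class \<tau>'" unfolding assms .
  then obtain c where c: "\<tau> = (\<lambda>w1 w2. \<tau>' w1 w2 + spencer c w1 w2)" "c \<in> cochains1"
    unfolding H02_class_def by blast
  show thesis by (rule that[OF c(2) fun_cong[OF fun_cong[OF c(1)]]])
qed

text \<open>A section s differs from the left-invariant frame by a family in G. With \<open>\<kappa> y = (s y)\<^sup>-\<^sup>1 \<circ> heis_frame L y \<circ> g\<close>, a family in G that is the
identity at x, the product rule splits the differential of the coframe into the value for the left-invariant frame
moved by g, and a term made of the derivative of \<open>\<kappa>\<close>. The latter takes values in the Lie algebra, so it is a Spencer
boundary.\<close>

lemma d_coframe_heis_section:
  fixes L :: "'m::finite bracket"
  assumes L: "L \<in> bracket_tensors" and s: "local_section (heis_structure L) N s"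
    and x: "x \<in> N" and sx: "s x = heis_frame L x \<circ> g" and g: "g \<in> Ggrp"
  obtains c where "c \<in> cochains1"
    "\<And>w1 w2. incl (d_coframe s x w1 w2) = incl (inv g (0, - L (fst (g w1)) (fst (g w2)))) + spencer c w1 w2"
proof -
  note bl = bracket_tensors_bilinear[OF L]
  let ?H = "heis_frame L"
  have N: "open N" and lin: "\<And>y. y \<in> N \<Longrightarrow> linear (s y)" and bij: "\<And>y. y \<in> N \<Longrightarrow> bij (s y)"
    and sm: "\<And>v. smooth_on N (\<lambda>y. s y v)" and sP: "\<And>y. y \<in> N \<Longrightarrow> s y \<in> heis_structure L y"
    using s unfolding local_section_def frame_field_def smooth_op_on_def by blast+
  define E where "E h v = - inv (s x) (frechet_derivative (\<lambda>y. s y (inv (s x) v)) (at x) h)" for h v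
  have E: "((\<lambda>y. inv (s y) v) has_derivative (\<lambda>h. E h v)) (at x)" for v
    unfolding E_def
    by (rule has_derivative_inverse_family[OF N x lin bij smooth_on_continuous[OF sm] smooth_on_has_derivative[OF sm x]])
  have linv: "linear (inv (s y))" if "y \<in> N" for y
    by (rule inj_linear_imp_inv_linear[OF lin[OF that] bij_is_inj[OF bij[OF that]]])
  \<comment> \<open>K is the derivative of \<open>\<kappa>\<close> at x.\<close>
  define K where "K h w = E h (?H x (g w)) + inv (s x) (0, (1/2) *\<^sub>R L (fst h) (fst (g w)))" for h w
  define \<kappa> where "\<kappa> y w = inv (s y) (?H y (g w))" for y w
  have K: "((\<lambda>y. \<kappa> y w) has_derivative (\<lambda>h. K h w)) (at x)" for w
    unfolding \<kappa>_def K_def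
    by (rule has_derivative_family_apply[OF N x linv E heis_frame_has_derivative[OF bl]])
  have kG: "\<kappa> y \<in> Ggrp" if yN: "y \<in> N" for y
  proof -
    obtain k where k: "k \<in> Ggrp" "s y = ?H y \<circ> k" using sP[OF yN] heis_structure_iff by blast
    have "inv (s y) = inv k \<circ> inv (?H y)"
      unfolding k(2) using o_inv_distrib[OF heis_frame_inv(1)[OF bl] Ggrp_linear_bij(2)[OF k(1)]] .
    then have "\<kappa> y = inv k \<circ> g"
      by (intro ext) (simp only: \<kappa>_def o_apply inv_f_f[OF bij_is_inj[OF heis_frame_inv(1)[OF bl]]])
    then show ?thesis using comp_Ggrp[OF inv_Ggrp[OF k(1)] g] by simp
  qed
  have "?H x (g w) = s x w" for w by (simp only: sx o_apply)
  then have "\<kappa> x = id"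
    by (intro ext) (simp only: \<kappa>_def inv_f_f[OF bij_is_inj[OF bij[OF x]]] id_apply)
  then have sym: "infinitesimal_symmetry (K h)" for h
    using Ggrp_derivative[of N x \<kappa> K h, OF N x kG _ K] by blast
  have linK: "linear (\<lambda>h. K h w)" for w using K[of w] has_derivative_linear by blast
  define c where "c w = extend_symmetry (K (s x w))" for w
  have "linear (\<lambda>w. c w v)" for v
    unfolding c_def using linear_compose[OF lin[OF x] linear_extend_symmetry[OF linK]] by (simp add: o_def)
  then have c: "c \<in> cochains1" unfolding cochains1_def c_def using extend_symmetry_gtilde[OF sym] by blast
  have sinv: "inv (s x) (0, p) = inv g (0, p)" for p
    unfolding sx using o_inv_distrib[OF heis_frame_inv(1)[OF bl] Ggrp_linear_bij(2)[OF g]]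
    by (simp add: heis_frame_inv(2)[OF bl] bilinear_rzero[OF bl])
  have ling: "linear (inv g)" using Ggrp_linear_bij(1)[OF inv_Ggrp[OF g]] .
  have fr: "frechet_derivative (\<lambda>y. inv (s y) (s x w)) (at x) (s x v) 
      = K (s x v) w - (1/2) *\<^sub>R inv g (0, L (fst (g v)) (fst (g w)))" for v w
  proof -
    have "frechet_derivative (\<lambda>y. inv (s y) (s x w)) (at x) (s x v) = E (s x v) (s x w)"
      using frechet_derivative_at[OF E] by metis
    also have "\<dots> = K (s x v) w - inv g (0, (1/2) *\<^sub>R L (fst (g v)) (fst (g w)))"
      by (simp add: K_def sinv) (simp add: sx heis_frame_eq[OF bl])
    finally show ?thesis using linear_cmul[OF ling, of "1/2" "(0, L (fst (g v)) (fst (g w)))"] by simp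
  qed
  have "d_coframe s x w1 w2 = K (s x w1) w2 - K (s x w2) w1 + inv g (0, - L (fst (g w1)) (fst (g w2)))" for w1 w2
  proof -
    have "inv g (0, L (fst (g w2)) (fst (g w1))) = - inv g (0, L (fst (g w1)) (fst (g w2)))"
      "inv g (0, - L (fst (g w1)) (fst (g w2))) = - inv g (0, L (fst (g w1)) (fst (g w2)))"
      using linear_neg[OF ling, of "(0, L (fst (g w1)) (fst (g w2)))"] bracket_tensors_skew[OF L, of "fst (g w2)"] by simp_all
    then show ?thesis unfolding d_coframe_def fr by (simp add: algebra_simps scaleR_2[symmetric] flip: scaleR_add_left)
  qed
  then have "incl (d_coframe s x w1 w2) = incl (inv g (0, - L (fst (g w1)) (fst (g w2)))) + spencer c w1 w2" for w1 w2
    unfolding spencer_def c_def extend_symmetry_incl[OF sym] by (simp add: incl_linear)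
  then show thesis using that c by blast
qed

lemma ess_curvature_heis:
  fixes L :: "'m::finite bracket"
  assumes L: "L \<in> bracket_tensors" and g: "g \<in> Ggrp"
  shows "ess_curvature (heis_structure L) x (heis_frame L x \<circ> g)
    = H02_class (\<lambda>w1 w2. incl (inv g (0, - L (fst (g w1)) (fst (g w2)))))"
proof -
  let ?C = "H02_class (\<lambda>w1 w2. incl (inv g (0, - L (fst (g w1)) (fst (g w2)))))"
  have *: "H02_class (\<lambda>w1 w2. incl (d_coframe s x w1 w2)) = ?C"
    if "x \<in> N" "local_section (heis_structure L) N s" "s x = heis_frame L x \<circ> g" for N s
    by (rule d_coframe_heis_section[OF L that(2,1,3) g]) (rule H02_class_eqI)
  have ex: "x \<in> UNIV \<and> local_section (heis_structure L) UNIV (\<lambda>y. heis_frame L y \<circ> g) \<and> heis_frame L x \<circ> g = heis_frame L x \<circ> g"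
    using heis_frame_section[OF bracket_tensors_bilinear[OF L] g] by (intro conjI UNIV_I refl)
  show ?thesis unfolding ess_curvature_def
  proof (rule the_equality)
    show "\<forall>N s. x \<in> N \<and> local_section (heis_structure L) N s \<and> s x = heis_frame L x \<circ> g \<longrightarrow>
        ?C = H02_class (\<lambda>w1 w2. incl (d_coframe s x w1 w2))"
      by (intro allI impI, elim conjE) (rule *[symmetric])
    fix K assume K: "\<forall>N s. x \<in> N \<and> local_section (heis_structure L) N s \<and> s x = heis_frame L x \<circ> g \<longrightarrow>
        K = H02_class (\<lambda>w1 w2. incl (d_coframe s x w1 w2))"
    from K[rule_format, OF ex] show "K = ?C"
      using *[of UNIV "\<lambda>y. heis_frame L y \<circ> g"] ex by (elim conjE) (simp only:)
  qed
qed

text \<open>The form \<open>\<beta>\<close> plays the role of the second fundamental form of a hypersurface, restricted to its maximal quaternionic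
distribution.\<close>

definition hypersurface_bracket :: "'m::finite bracket \<Rightarrow> bool"
  where "hypersurface_bracket L \<longleftrightarrow> (\<exists>\<beta>. bilinear \<beta> \<and> (\<forall>x y. \<beta> x y = \<beta> y x) \<and>
    (\<forall>x y k. L x y $ k = \<beta> (rmulU x (im (ax k))) y - \<beta> x (rmulU y (im (ax k)))))"

text \<open>The last component of \<open>c x y\<close> for x, y in U does not see the \<open>sp\<^sub>1\<close> part of \<open>gtilde\<close>, since y has last component zero; it is
therefore H-linear in y. Its real part is the form \<open>\<beta>\<close>, and H-linearity expresses the imaginary parts through it.\<close>

lemma spencer_exact_imp_hypersurface_bracket:
  fixes L :: "'m::finite bracket"
  assumes c: "c \<in> cochains1" and eq: "\<And>w1 w2. incl (0, L (fst w1) (fst w2)) = spencer c w1 w2"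
  shows "hypersurface_bracket L"
proof -
  define B where "B x y = snd (c (x, 0) (y, 0))" for x y
  have g: "c w \<in> gtilde" and lw: "linear (\<lambda>w. c w v)" for w v using c unfolding cochains1_def by blast+
  have lv: "linear (c w)" for w by (rule gtilde_linear[OF g])
  have Bq: "B x (rmulU y q) = B x y \<odot> q" for x y q
  proof -
    obtain A \<xi> where A: "hlinear A" "c (x, 0) = (\<lambda>v. A v - rmulV v (im \<xi>))" using g[of "(x,0)"] unfolding gtilde_def by blast
    have "A (rmulU y q, 0) = rmulV (A (y, 0)) q" using hlinear_rmulV[OF A(1), of "(y,0)" q] by (simp add: rmulV_def)
    then show ?thesis by (simp add: B_def A(2))
  qed
  have bil: "bilinear (\<lambda>x y. fst (B x y))"
  proof -
    have "linear (\<lambda>y. c (x, 0) (y, 0))" for x using linear_compose[OF _ lv[of "(x,0)"], of "\<lambda>y. (y, 0)"] by (simp add: o_def linear_iff)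
    moreover have "linear (\<lambda>x. c (x, 0) (y, 0))" for y using linear_compose[OF _ lw[of "(y,0)"], of "\<lambda>x. (x, 0)"] by (simp add: o_def linear_iff)
    ultimately show ?thesis unfolding bilinear_def B_def by (simp add: linear_iff)
  qed
  have LB: "im (L x y) = B x y - B y x" for x y
    using eq[of "(x,0)" "(y,0)"] by (simp add: spencer_def incl_def B_def prod_eq_iff im_linear zero_prod_def)
  have "fst (B x y) = fst (B y x)" for x y using arg_cong[OF LB[of x y], of fst] by simp
  moreover have "L x y $ k = fst (B (rmulU x (im (ax k))) y) - fst (B x (rmulU y (im (ax k))))" for x y k
  proof -
    have "fst (B x (rmulU y (im (ax k)))) = - snd (B x y) $ k" for x y
      unfolding Bq using exhaust_3[of k] by auto
    moreover have "fst (B (rmulU x (im (ax k))) y) = fst (B y (rmulU x (im (ax k))))" using calculation by (metis \<open>\<And>x y. fst (B x y) = fst (B y x)\<close>)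
    ultimately show ?thesis using arg_cong[OF LB[of x y], of "\<lambda>q. snd q $ k"] by simp
  qed
  ultimately show ?thesis unfolding hypersurface_bracket_def using bil by blast
qed

text \<open>Conversely \<open>\<beta>\<close> is the real part of a unique form B that is H-linear in the second argument, and the cochain can be chosen to
have B as its only block.\<close>

lemma hypersurface_bracket_imp_spencer_exact:
  fixes L :: "'m::finite bracket"
  assumes "hypersurface_bracket L"
  obtains c where "c \<in> cochains1" "\<And>w1 w2. incl (0, L (fst w1) (fst w2)) = spencer c w1 w2"
proof -
  obtain \<beta> where b: "bilinear \<beta>" "\<And>x y. \<beta> x y = \<beta> y x"
    "\<And>x y k. L x y $ k = \<beta> (rmulU x (im (ax k))) y - \<beta> x (rmulU y (im (ax k)))"
    using assms unfolding hypersurface_bracket_def by blast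
  note bs = bilinear_ladd[OF b(1)] bilinear_radd[OF b(1)] bilinear_lmul[OF b(1)] bilinear_rmul[OF b(1)] bilinear_rneg[OF b(1)]
  \<comment> \<open>The components of a quaternion q are the real parts of q and of \<open>- q i\<^sub>k\<close>.\<close>
  define B :: "'m Usp \<Rightarrow> 'm Usp \<Rightarrow> quat" where "B x y = (\<beta> x y, \<chi> k. - \<beta> x (rmulU y (im (ax k))))" for x y
  have Bbil: "bilinear B" unfolding B_def bilinear_def
    by (simp add: linear_iff bs rmulU_add prod_eq_iff vec_eq_iff)
  have Bk: "B x (rmulU y (im (ax k))) = B x y \<odot> im (ax k)" for x y k
    using exhaust_3[of k] 
    by (auto simp: B_def quat_eq_iff im_ax_mult bs simp del: rmulU_nth)
  have "B x (rmulU y (a *\<^sub>R q1 + b *\<^sub>R im (ax 1) + c *\<^sub>R im (ax 2) + d *\<^sub>R im (ax 3)))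
     = B x y \<odot> (a *\<^sub>R q1 + b *\<^sub>R im (ax 1) + c *\<^sub>R im (ax 2) + d *\<^sub>R im (ax 3))" for x y a b c d
    by (simp only: rmulU_add rmulU_simps bilinear_radd[OF Bbil] bilinear_rmul[OF Bbil] Bk qmul_add qmul_simps scaleR_one)
  from this[of _ _ "fst q" "snd q $ 1" "snd q $ 2" "snd q $ 3" for q :: quat, unfolded quat_basis[symmetric]]
  have Bq: "B x (rmulU y q) = B x y \<odot> q" for x y q .
  define c :: "'m Wsp \<Rightarrow> 'm Vsp \<Rightarrow> 'm Vsp" where "c w v = (0, B (fst w) (fst v))" for w v
  have "c w \<in> gtilde" for w
    by (rule gtildeI[of "\<lambda>v. (0, B (fst w) (fst v))" _ 0])
       (simp_all add: fun_eq_iff hlinear_def c_def linear_iff Bq bilinear_radd[OF Bbil] bilinear_rmul[OF Bbil] im_linear rmulV_def)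
  moreover have "linear (\<lambda>w. c w v)" for v
    by (simp add: c_def linear_iff bilinear_ladd[OF Bbil] bilinear_lmul[OF Bbil])
  ultimately have "c \<in> cochains1" unfolding cochains1_def by blast
  moreover have "incl (0, L (fst w1) (fst w2)) = spencer c w1 w2" for w1 w2
    using b(2)[of "fst w1" "fst w2"] b(2)[of "fst w2" "rmulU (fst w1) _"]
    by (simp add: spencer_def c_def incl_def B_def prod_eq_iff im_def vec_eq_iff b(3))
  ultimately show thesis using that by blast
qed

text \<open>If L is a hypersurface bracket, a cochain that bounds it can be moved by G to every other adapted frame, so the curvature
vanishes at all of them. Otherwise it is nonzero at the left-invariant frame itself.\<close>

theorem ess_curvature_nonzero_iff:
  fixes L :: "'m::finite bracket"
  assumes L: "L \<in> bracket_tensors"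
  shows "ess_curvature_nonzero (heis_structure L) \<longleftrightarrow> \<not> hypersurface_bracket L"
proof
  assume "ess_curvature_nonzero (heis_structure L)"
  then have "\<exists>x. \<exists>u\<in>heis_structure L x. ess_curvature (heis_structure L) x u \<noteq> H02_class (\<lambda>w1 w2. 0)"
    by (simp only: ess_curvature_nonzero_def)
  then obtain x where "\<exists>u\<in>heis_structure L x. ess_curvature (heis_structure L) x u \<noteq> H02_class (\<lambda>w1 w2. 0)" ..
  then obtain u where u: "u \<in> heis_structure L x" and ne: "ess_curvature (heis_structure L) x u \<noteq> H02_class (\<lambda>w1 w2. 0)" ..
  obtain g where g: "g \<in> Ggrp" and ug: "u = heis_frame L x \<circ> g"
    using u unfolding heis_structure_iff by (elim bexE) (rule that)
  show "\<not> hypersurface_bracket L"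
  proof
    assume "hypersurface_bracket L"
    then obtain c where c: "c \<in> cochains1" "\<And>w1 w2. incl (0, L (fst w1) (fst w2)) = spencer c w1 w2"
      by (rule hypersurface_bracket_imp_spencer_exact) blast
    obtain F where F: "F \<in> Gtilde" "\<And>w. F (incl w) = incl (g w)" using g unfolding Ggrp_def by blast
    note Fb = Gtilde_linear_bij[OF F(1)]
    have linFi: "linear (inv F)" by (rule inj_linear_imp_inv_linear[OF Fb(1) bij_is_inj[OF Fb(2)]])
    have Fi: "inv F (incl w) = incl (inv g w)" for w
    proof -
      have "F (incl (inv g w)) = incl w" unfolding F(2) using surj_f_inv_f[OF bij_is_surj[OF Ggrp_linear_bij(2)[OF g]]] by metis
      from arg_cong[OF this, of "inv F"] show ?thesis by (simp only: inv_f_f[OF bij_is_inj[OF Fb(2)]])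
    qed
    define d where "d w v = - inv F (c (g w) (F v))" for w v
    have "(\<lambda>v. inv F (c (g w) (F v))) \<in> gtilde" for w
      using gtilde_conj[OF F(1), of "c (g w)"] c(1) unfolding cochains1_def o_def by blast
    moreover have "linear (\<lambda>w. inv F (c (g w) (F v)))" for v
      using linear_compose[OF linear_compose[OF Ggrp_linear_bij(1)[OF g]] linFi, of "\<lambda>w. c w (F v)"] c(1)
      unfolding cochains1_def o_def by blast
    ultimately have "(\<lambda>w v. inv F (c (g w) (F v))) \<in> cochains1" unfolding cochains1_def by blast
    from cochains1_uminus[OF this] have d: "d \<in> cochains1" unfolding d_def .
    have "incl (inv g (0, - L (fst (g w1)) (fst (g w2)))) = 0 + spencer d w1 w2" for w1 w2
    proof -
      have "incl (0, - L (fst (g w1)) (fst (g w2))) = - spencer c (g w1) (g w2)"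
        unfolding c(2)[symmetric] by (simp add: incl_linear(3)[symmetric])
      then show ?thesis unfolding Fi[symmetric] 
        by (simp add: spencer_def d_def F(2) linear_add[OF linFi] linear_neg[OF linFi] linear_diff[OF linFi])
    qed
    from H02_class_eqI[OF d this] ess_curvature_heis[OF L g, of x] ne show False by (simp only: ug)
  qed
next
  assume n: "\<not> hypersurface_bracket L"
  have u: "heis_frame L 0 \<circ> id \<in> heis_structure L 0"
    unfolding heis_structure_iff by (rule bexI[OF refl id_Ggrp])
  have "ess_curvature (heis_structure L) 0 (heis_frame L 0 \<circ> id) \<noteq> H02_class (\<lambda>w1 w2. 0)"
  proof
    assume "ess_curvature (heis_structure L) 0 (heis_frame L 0 \<circ> id) = H02_class (\<lambda>w1 w2. 0)"
    then have "H02_class (\<lambda>w1 w2. incl (0, - L (fst w1) (fst w2))) = H02_class (\<lambda>w1 w2. 0)"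
      unfolding ess_curvature_heis[OF L id_Ggrp] by (simp add: inv_id)
    then obtain c where c: "c \<in> cochains1" "\<And>w1 w2. incl (0, - L (fst w1) (fst w2)) = 0 + spencer c w1 w2"
      by (rule H02_class_eqD) blast
    have "incl (0, L (fst w1) (fst w2)) = spencer (\<lambda>w v. - c w v) w1 w2" for w1 w2
    proof -
      have "(incl (0, L (fst w1) (fst w2)) :: 'm Vsp) = - incl (0, - L (fst w1) (fst w2))"
        by (simp add: incl_linear(3)[symmetric])
      then show ?thesis unfolding c(2) spencer_def by simp
    qed
    then have "hypersurface_bracket L" by (rule spencer_exact_imp_hypersurface_bracket[OF cochains1_uminus[OF c(1)]])
    with n show False ..
  qed
  with u show "ess_curvature_nonzero (heis_structure L)" unfolding ess_curvature_nonzero_def by (intro exI bexI)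
qed

section \<open>Second derivatives\<close>

text \<open>By the mean value theorem the second difference divided by t is an increment of the partial derivative along a, taken
between two points whose difference is t b, so it tends to the second derivative in the two directions.\<close>

lemma second_difference_limit:
  fixes f :: "'a::real_normed_vector \<Rightarrow> real"
  assumes N: "open N" "x \<in> N" and f: "\<And>y. y \<in> N \<Longrightarrow> (f has_derivative f' y) (at y)"
    and A: "((\<lambda>y. f' y a) has_derivative A) (at x)"
  shows "((\<lambda>t. (f (x + t *\<^sub>R a + t *\<^sub>R b) - f (x + t *\<^sub>R a) - f (x + t *\<^sub>R b) + f x) / t\<^sup>2) \<longlongrightarrow> A b) (at_right 0)"
proof (rule tendstoI)
  fix e :: real assume e: "e > 0"
  define M where "M = norm a + norm b + 1"
  have M: "M > 0" unfolding M_def by (simp add: add_nonneg_pos)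
  have lA: "linear A" using A has_derivative_linear by blast
  obtain d1 where d1: "d1 > 0" "\<And>y. norm (y - x) < d1 \<Longrightarrow> \<bar>f' y a - f' x a - A (y - x)\<bar> \<le> e / (4 * M) * norm (y - x)"
    using A e M unfolding has_derivative_at_alt by (metis divide_pos_pos mult_pos_pos real_norm_def zero_less_numeral)
  obtain d2 where d2: "d2 > 0" "ball x d2 \<subseteq> N" using N openE by blast
  define d where "d = min d1 d2 / M"
  have d: "d > 0" using d1 d2 M by (simp add: d_def)
  show "\<forall>\<^sub>F t in at_right 0. dist ((f (x + t *\<^sub>R a + t *\<^sub>R b) - f (x + t *\<^sub>R a) - f (x + t *\<^sub>R b) + f x) / t\<^sup>2) (A b) < e"
    unfolding eventually_at_right_field
  proof (intro exI[of _ d] conjI allI impI)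
    fix t :: real assume t: "0 < t" "t < d"
    have tM: "t * M < min d1 d2" using t M unfolding d_def by (simp add: pos_less_divide_eq)
    have nrm: "norm (s *\<^sub>R a + r *\<^sub>R b) \<le> t * M" if "0 \<le> s" "s \<le> t" "0 \<le> r" "r \<le> t" for s r
    proof -
      have "norm (s *\<^sub>R a + r *\<^sub>R b) \<le> s * norm a + r * norm b"
        using norm_triangle_ineq[of "s *\<^sub>R a" "r *\<^sub>R b"] that by simp
      also have "\<dots> \<le> t * norm a + t * norm b" using that by (intro add_mono mult_right_mono) auto
      also have "\<dots> \<le> t * M" using t by (simp add: M_def algebra_simps)
      finally show ?thesis .
    qed
    have inN: "x + (s *\<^sub>R a + r *\<^sub>R b) \<in> N" if "0 \<le> s" "s \<le> t" "0 \<le> r" "r \<le> t" for s r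
    proof (rule subsetD[OF d2(2)])
      have "dist x (x + (s *\<^sub>R a + r *\<^sub>R b)) = norm (s *\<^sub>R a + r *\<^sub>R b)"
        unfolding dist_norm by (subst norm_minus_commute) simp
      then show "x + (s *\<^sub>R a + r *\<^sub>R b) \<in> ball x d2" using nrm[OF that] tM by simp
    qed
    define g where "g s = f (x + (s *\<^sub>R a + t *\<^sub>R b)) - f (x + (s *\<^sub>R a + 0 *\<^sub>R b))" for s
    define g' where "g' s = f' (x + (s *\<^sub>R a + t *\<^sub>R b)) a - f' (x + (s *\<^sub>R a + 0 *\<^sub>R b)) a" for s
    have dg1: "((\<lambda>s. f (x + (s *\<^sub>R a + r *\<^sub>R b))) has_field_derivative f' (x + (s *\<^sub>R a + r *\<^sub>R b)) a) (at s)"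
      if "0 \<le> s" "s \<le> t" "0 \<le> r" "r \<le> t" for s r
    proof -
      have "((\<lambda>s. x + (s *\<^sub>R a + r *\<^sub>R b)) has_derivative (\<lambda>h. h *\<^sub>R a)) (at s)"
        by (auto intro!: derivative_eq_intros)
      from has_derivative_compose[OF this f[OF inN[OF that]]]
      show ?thesis unfolding has_field_derivative_def
        using linear_cmul[OF has_derivative_linear[OF f[OF inN[OF that]]]] by (simp add: mult_commute_abs)
    qed
    have dg: "DERIV g s :> g' s" if "0 \<le> s" "s \<le> t" for s
      unfolding g_def g'_def by (intro DERIV_diff dg1) (use that t in auto)
    obtain s where s: "0 < s" "s < t" "g t - g 0 = (t - 0) * g' s" using MVT2[OF t(1) dg] by blast
    have err: "\<bar>f' (x + (s *\<^sub>R a + r *\<^sub>R b)) a - f' x a - A (s *\<^sub>R a + r *\<^sub>R b)\<bar> \<le> e / 4 * t" if "0 \<le> r" "r \<le> t" for r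
    proof -
      have n: "norm (s *\<^sub>R a + r *\<^sub>R b) \<le> t * M" using nrm[of s r] s that by simp
      have "\<bar>f' (x + (s *\<^sub>R a + r *\<^sub>R b)) a - f' x a - A (s *\<^sub>R a + r *\<^sub>R b)\<bar> \<le> e / (4 * M) * norm (s *\<^sub>R a + r *\<^sub>R b)"
        using d1(2)[of "x + (s *\<^sub>R a + r *\<^sub>R b)"] n tM by simp
      also have "\<dots> \<le> e / (4 * M) * (t * M)" using n e M by (intro mult_left_mono) auto
      also have "\<dots> = e / 4 * t" using M by simp
      finally show ?thesis .
    qed
    have "A (s *\<^sub>R a + t *\<^sub>R b) - A (s *\<^sub>R a + 0 *\<^sub>R b) = t * A b"
      using linear_add[OF lA] linear_cmul[OF lA] by simp
    then have "\<bar>g' s - t * A b\<bar> \<le> e / 2 * t"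
      using err[of t] err[of 0] t unfolding g'_def by linarith
    then have "\<bar>(g' s - t * A b) / t\<bar> \<le> e / 2" using t by (simp add: abs_divide pos_divide_le_eq)
    moreover have "(f (x + t *\<^sub>R a + t *\<^sub>R b) - f (x + t *\<^sub>R a) - f (x + t *\<^sub>R b) + f x) / t\<^sup>2 - A b = (g' s - t * A b) / t"
    proof -
      have "f (x + t *\<^sub>R a + t *\<^sub>R b) - f (x + t *\<^sub>R a) - f (x + t *\<^sub>R b) + f x = t * g' s"
        using s(3) by (simp add: g_def add.assoc)
      then show ?thesis using t by (simp add: power2_eq_square field_simps)
    qed
    ultimately have "dist ((f (x + t *\<^sub>R a + t *\<^sub>R b) - f (x + t *\<^sub>R a) - f (x + t *\<^sub>R b) + f x) / t\<^sup>2) (A b) \<le> e / 2"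
      by (simp only: dist_real_def)
    also have "e / 2 < e" using e by simp
    finally show "dist ((f (x + t *\<^sub>R a + t *\<^sub>R b) - f (x + t *\<^sub>R a) - f (x + t *\<^sub>R b) + f x) / t\<^sup>2) (A b) < e" .
  qed (rule d)
qed

text \<open>The second difference is symmetric in a and b, hence so is its limit.\<close>

lemma second_derivative_symmetric:
  fixes f :: "'a::real_normed_vector \<Rightarrow> 'b::euclidean_space"
  assumes N: "open N" "x \<in> N" and f: "\<And>y. y \<in> N \<Longrightarrow> (f has_derivative f' y) (at y)"
    and A: "\<And>v. ((\<lambda>y. f' y v) has_derivative (\<lambda>h. D h v)) (at x)"
  shows "D a b = D b a"
proof (rule euclidean_eqI)
  fix i :: 'b assume "i \<in> Basis"
  have f': "((\<lambda>y. f y \<bullet> i) has_derivative (\<lambda>h. f' y h \<bullet> i)) (at y)" if "y \<in> N" for y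
    by (intro derivative_intros f that)
  have A': "((\<lambda>y. f' y v \<bullet> i) has_derivative (\<lambda>h. D h v \<bullet> i)) (at x)" for v
    by (intro derivative_intros A)
  have eq: "(\<lambda>t. (f (x + t *\<^sub>R a + t *\<^sub>R b) \<bullet> i - f (x + t *\<^sub>R a) \<bullet> i - f (x + t *\<^sub>R b) \<bullet> i + f x \<bullet> i) / t\<^sup>2)
    = (\<lambda>t. (f (x + t *\<^sub>R b + t *\<^sub>R a) \<bullet> i - f (x + t *\<^sub>R b) \<bullet> i - f (x + t *\<^sub>R a) \<bullet> i + f x \<bullet> i) / t\<^sup>2)"
    by (simp add: algebra_simps)
  show "D a b \<bullet> i = D b a \<bullet> i"
    using tendsto_unique[OF _ second_difference_limit[OF N f' A', of b a, folded eq] second_difference_limit[OF N f' A', of a b]]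
    by simp
qed

lemma smooth_on_second_derivative:
  assumes f: "smooth_on S f" and x: "x \<in> S"
  shows "((\<lambda>y. frechet_derivative f (at y) v) has_derivative frechet_derivative (\<lambda>y. frechet_derivative f (at y) v) (at x)) (at x)"
proof -
  have S: "open S" and C: "Ck_on (Suc (Suc 0)) S f" using f unfolding smooth_on_def by blast+
  obtain f' where f': "\<And>y. y \<in> S \<Longrightarrow> (f has_derivative f' y) (at y)" "Ck_on (Suc 0) S (\<lambda>y. f' y v)"
    using C unfolding Ck_on.simps by blast
  obtain g where "((\<lambda>y. f' y v) has_derivative g x) (at x)"
    using f'(2) x unfolding Ck_on.simps by blast
  then have "((\<lambda>y. frechet_derivative f (at y) v) has_derivative g x) (at x)"
    by (rule has_derivative_transform_within_open[OF _ S x]) (simp only: frechet_derivative_at[OF f'(1)])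
  then show ?thesis using frechet_derivative_at by metis
qed

lemma Ck_on_linear_combination:
  "Ck_on k S f \<Longrightarrow> Ck_on k S g \<Longrightarrow> Ck_on k S (\<lambda>x. a *\<^sub>R f x + b *\<^sub>R g x)"
proof (induction k arbitrary: f g)
  case 0
  then show ?case by (auto intro!: continuous_intros)
next
  case (Suc k)
  from Suc.prems(1) obtain f' where f': "\<And>x. x \<in> S \<Longrightarrow> (f has_derivative f' x) (at x)" "\<And>v. Ck_on k S (\<lambda>x. f' x v)"
    unfolding Ck_on.simps by blast
  from Suc.prems(2) obtain g' where g': "\<And>x. x \<in> S \<Longrightarrow> (g has_derivative g' x) (at x)" "\<And>v. Ck_on k S (\<lambda>x. g' x v)"
    unfolding Ck_on.simps by blast
  show ?case unfolding Ck_on.simps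
  proof (intro exI[of _ "\<lambda>x v. a *\<^sub>R f' x v + b *\<^sub>R g' x v"] conjI ballI allI)
    show "((\<lambda>x. a *\<^sub>R f x + b *\<^sub>R g x) has_derivative (\<lambda>v. a *\<^sub>R f' x v + b *\<^sub>R g' x v)) (at x)" if "x \<in> S" for x
      by (intro derivative_intros f' g' that)
    show "Ck_on k S (\<lambda>x. a *\<^sub>R f' x v + b *\<^sub>R g' x v)" for v by (rule Suc.IH[OF f'(2) g'(2)])
  qed
qed

lemma smooth_on_linear_combination:
  "smooth_on S f \<Longrightarrow> smooth_on S g \<Longrightarrow> smooth_on S (\<lambda>x. a *\<^sub>R f x + b *\<^sub>R g x)"
  unfolding smooth_on_def using Ck_on_linear_combination by blast

section \<open>Fields tangent to a moving subspace\<close>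

text \<open>Write \<open>G y = M y (w y)\<close>. If w were differentiable, the product rule would give \<open>G' h = D h z + M x (w' h)\<close>, and \<open>\<nu>\<close> kills the last term.
To avoid differentiating w, consider \<open>K y = G y - M y z = M y u\<close> with u of the order of \<open>y - x\<close>: then
\<open>\<nu> (K y) = \<nu> ((M y - M x) u)\<close> is of smaller order than \<open>y - x\<close>.\<close>

lemma derivative_of_tangent_field:
  fixes M :: "'a::real_normed_vector \<Rightarrow> 'b::euclidean_space \<Rightarrow> 'c::euclidean_space"
  assumes S: "open S" "x \<in> S" and lin: "\<And>y. y \<in> S \<Longrightarrow> linear (M y)" and inj: "inj (M x)"
    and D: "\<And>v. ((\<lambda>y. M y v) has_derivative (\<lambda>h. D h v)) (at x)"
    and G: "(G has_derivative G') (at x)" and tan: "\<And>y. y \<in> S \<Longrightarrow> G y \<in> range (M y)" and Gx: "G x = M x z"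
    and nu: "linear \<nu>" "\<And>v. \<nu> (M x v) = (0::real)"
  shows "\<nu> (G' h) = \<nu> (D h z)"
proof -
  define K where "K y = G y - M y z" for y
  define K' where "K' h = G' h - D h z" for h
  have K: "(K has_derivative K') (at x)" unfolding K_def K'_def by (intro derivative_intros G D)
  have K0: "K x = 0" by (simp add: K_def Gx)
  have Kt: "\<exists>w. K y = M y w" if yS: "y \<in> S" for y
  proof -
    obtain w where "G y = M y w" using tan[OF yS] by blast
    then have "K y = M y (w - z)" by (simp add: K_def linear_diff[OF lin[OF yS]])
    then show ?thesis ..
  qed
  define m where "m y = (\<Sum>b\<in>Basis. norm (M y b - M x b))" for y
  have m: "norm (M y v - M x v) \<le> m y * norm v" if "y \<in> S" for y v
  proof -
    have "M y v - M x v = (\<Sum>b\<in>Basis. (v \<bullet> b) *\<^sub>R (M y b - M x b))"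
      using linear_basis_expansion[OF lin[OF that], of v] linear_basis_expansion[OF lin[OF S(2)], of v]
      by (simp add: sum_subtractf scaleR_diff_right)
    also have "norm \<dots> \<le> (\<Sum>b\<in>Basis. norm ((v \<bullet> b) *\<^sub>R (M y b - M x b)))" by (rule norm_sum)
    also have "\<dots> \<le> (\<Sum>b\<in>Basis. norm v * norm (M y b - M x b))"
      by (intro sum_mono) (simp add: mult_right_mono Basis_le_norm)
    finally show ?thesis by (simp add: m_def sum_distrib_left mult.commute)
  qed
  have "isCont m x" unfolding m_def
    by (intro continuous_intros) (use D in \<open>rule has_derivative_continuous\<close>)
  moreover have "m x = 0" by (simp add: m_def)
  ultimately have m0: "(m \<longlongrightarrow> 0) (at x)" by (simp add: isCont_def)
  obtain c where c: "c > 0" "\<And>v. norm (M x v) \<ge> c * norm v"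
    using linear_inj_bounded_below_pos[OF lin[OF S(2)] inj] by blast
  obtain C where C: "C > 0" "\<And>v. \<bar>\<nu> v\<bar> \<le> C * norm v"
    using linear_bounded_pos[OF nu(1)] by (metis real_norm_def)
  obtain B where B: "B > 0" "\<And>h. norm (K' h) \<le> B * norm h"
    using bounded_linear.pos_bounded[OF has_derivative_bounded_linear[OF K]] by (metis mult.commute)
  obtain d1 where d1: "d1 > 0" "\<And>y. norm (y - x) < d1 \<Longrightarrow> norm (K y - K x - K' (y - x)) \<le> 1 * norm (y - x)"
    using K unfolding has_derivative_at_alt by (meson zero_less_one)
  have key: "\<bar>\<nu> (K y)\<bar> \<le> C * m y * ((2 / c) * ((B + 1) * norm (y - x)))"
    if y: "y \<in> S" "norm (y - x) < d1" "m y \<le> c / 2" for y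
  proof -
    obtain w where w: "K y = M y w" using Kt[OF y(1)] by blast
    have "c * norm w \<le> norm (M x w)" by (rule c)
    also have "\<dots> \<le> norm (M y w) + norm (M y w - M x w)" by (metis norm_minus_commute norm_triangle_sub)
    also have "\<dots> \<le> norm (K y) + c / 2 * norm w"
      using m[OF y(1), of w] mult_right_mono[OF y(3), of "norm w"] w by simp
    finally have nw: "norm w \<le> (2 / c) * norm (K y)" using c(1) by (simp add: field_simps)
    have "norm (K y) \<le> norm (K y - K x - K' (y - x)) + norm (K' (y - x))" 
      using norm_triangle_sub[of "K y" "K' (y - x)"] by (simp add: K0 add.commute)
    then have nK: "norm (K y) \<le> (B + 1) * norm (y - x)"
      using d1(2)[OF y(2)] B(2)[of "y - x"] by (simp add: algebra_simps)
    have "\<nu> (K y) = \<nu> (M y w - M x w)" by (simp add: w linear_diff[OF nu(1)] nu(2))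
    then have "\<bar>\<nu> (K y)\<bar> \<le> C * (m y * norm w)" using C(2)[of "M y w - M x w"] m[OF y(1), of w] C(1)
      by (metis (no_types, opaque_lifting) mult_left_mono order.trans less_imp_le)
    also have "\<dots> \<le> C * (m y * ((2 / c) * ((B + 1) * norm (y - x))))"
    proof -
      have "norm w \<le> (2 / c) * ((B + 1) * norm (y - x))"
        by (rule order_trans[OF nw mult_left_mono[OF nK]]) (use c in simp)
      moreover have "m y \<ge> 0" by (simp add: m_def sum_nonneg)
      ultimately show ?thesis by (intro mult_left_mono) (use C(1) in simp_all)
    qed
    finally show ?thesis by (simp add: mult.assoc)
  qed
  define p where "p t = x + t *\<^sub>R h" for t :: real
  have p: "(p has_derivative (\<lambda>t. t *\<^sub>R h)) (at 0)" unfolding p_def by (auto intro!: derivative_eq_intros)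
  have p0: "p 0 = x" by (simp add: p_def)
  have "((\<lambda>t. \<nu> (K (p t))) has_derivative (\<lambda>t. \<nu> (K' (t *\<^sub>R h)))) (at 0)"
    using bounded_linear.has_derivative[OF _ has_derivative_compose[OF p], of \<nu> K K'] nu(1) K p0
    by (simp add: linear_conv_bounded_linear)
  then have "((\<lambda>t. \<nu> (K (p t))) has_field_derivative \<nu> (K' h)) (at 0)"
    unfolding has_field_derivative_def
    by (simp add: linear_cmul[OF has_derivative_linear[OF K]] linear_cmul[OF nu(1)] mult.commute[of _ "\<nu> (K' h)"])
  then have l1: "((\<lambda>t. \<nu> (K (p t)) / t) \<longlongrightarrow> \<nu> (K' h)) (at 0)"
    unfolding DERIV_def by (simp add: p0 K0 linear_0[OF nu(1)])
  have pl: "(p \<longlongrightarrow> x) (at 0)" using has_derivative_continuous[OF p] by (simp add: isCont_def p0)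
  have ml: "((\<lambda>t. m (p t)) \<longlongrightarrow> 0) (at 0)"
    using continuous_at_compose[OF has_derivative_continuous[OF p], of m] \<open>isCont m x\<close> \<open>m x = 0\<close> 
    by (simp add: isCont_def p0 o_def)
  have "((\<lambda>t. \<nu> (K (p t)) / t) \<longlongrightarrow> 0) (at 0)"
  proof (rule Lim_null_comparison)
    show "((\<lambda>t. C * m (p t) * ((2 / c) * ((B + 1) * norm h))) \<longlongrightarrow> 0) (at 0)"
      by (rule tendsto_eq_intros ml refl | simp)+
    have "\<forall>\<^sub>F t in at 0. p t \<in> S" using pl S by (rule topological_tendstoD)
    moreover have "\<forall>\<^sub>F t in at 0. dist (p t) x < d1" using pl d1(1) by (rule tendstoD)
    moreover have "\<forall>\<^sub>F t in at 0. m (p t) < c / 2" using order_tendstoD(2)[OF ml, of "c/2"] c(1) by simp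
    moreover have "\<forall>\<^sub>F t in at (0::real). t \<noteq> 0" by (simp add: eventually_at_filter)
    ultimately show "\<forall>\<^sub>F t in at 0. norm (\<nu> (K (p t)) / t) \<le> C * m (p t) * ((2 / c) * ((B + 1) * norm h))"
    proof eventually_elim
      case (elim t)
      have "\<bar>\<nu> (K (p t))\<bar> \<le> C * m (p t) * ((2 / c) * ((B + 1) * norm (p t - x)))"
        using key[of "p t"] elim by (simp add: dist_norm)
      also have "norm (p t - x) = \<bar>t\<bar> * norm h" by (simp add: p_def)
      finally show ?case using elim(4) by (simp add: abs_divide pos_divide_le_eq mult_ac)
    qed
  qed
  from tendsto_unique[OF _ l1 this] have "\<nu> (K' h) = 0" by simp
  then show ?thesis by (simp add: K'_def linear_diff[OF nu(1)])
qed

section \<open>Hypersurfaces of quaternionic manifolds\<close>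

lemma conjugate_Q_stdI: "(\<lambda>v. F (rmulV (inv F v) (im q))) \<in> conjugate F Q_std"
proof -
  have "(\<lambda>v. - rmulV v (im (- q))) \<in> Q_std" unfolding Q_std_def by blast
  moreover have "(\<lambda>v. F (rmulV (inv F v) (im q))) = F \<circ> (\<lambda>v. - rmulV v (im (- q))) \<circ> inv F"
    by (simp add: fun_eq_iff im_linear)
  ultimately show ?thesis unfolding conjugate_def by blast
qed

lemma conjugate_Q_stdE:
  assumes "B \<in> conjugate F Q_std" "bij F"
  obtains q where "\<And>v. B (F v) = F (rmulV v (im q))"
proof -
  obtain q where "B = F \<circ> (\<lambda>v. - rmulV v (im q)) \<circ> inv F" using assms(1) unfolding conjugate_def Q_std_def by blast
  then have "B (F v) = F (rmulV v (im (- q)))" for v by (simp add: inv_f_f[OF bij_is_inj[OF assms(2)]] im_linear)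
  then show thesis using that by blast
qed

text \<open>The computation is done at one point \<open>x0\<close> and in one chart. There \<open>\<nu>\<close> is the conormal covector, transported by an adapted
frame F of the tangent space, and \<open>b\<close> is the second fundamental form. For a local section I of Q and the left-invariant field Y with
initial value \<open>(y, 0)\<close>, the field \<open>I Y\<close> is tangent to the hypersurface, so \<open>derivative_of_tangent_field\<close> computes b on it; since the
connection preserves Q, \<open>\<nu>\<close> does not see the covariant derivative of I. Antisymmetrisation leaves \<open>\<nu> (I [X, Y])\<close>,
which is a component of L.\<close>

theorem induced_imp_hypersurface_bracket:
  fixes L :: "'m::finite bracket"
    and \<A> :: "('p::{t2_space, second_countable_topology}, 'm) chart set"
  assumes L: "L \<in> bracket_tensors" and qm: "quaternionic_manifold \<A> Q" and N: "N \<noteq> {}"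
    and im: "immersion_on \<A> N f" and ind: "induced_on \<A> Q N f (heis_structure L)"
  shows "hypersurface_bracket L"
proof -
  note bl = bracket_tensors_bilinear[OF L]
  let ?H = "heis_frame L"
  obtain \<Gamma> where aq: "almost_quaternionic_manifold \<A> Q" and \<Gamma>: "linear_connection \<A> \<Gamma>" "torsion_free \<A> \<Gamma>" "preserves \<A> \<Gamma> Q"
    using qm unfolding quaternionic_manifold_def by blast
  obtain x0 where x0: "x0 \<in> N" using N by blast
  have "f x0 \<in> (\<Union>c\<in>\<A>. fst c)" using aq unfolding almost_quaternionic_manifold_def smooth_atlas_def by simp
  then obtain c where c: "c \<in> \<A>" "f x0 \<in> fst c" by blast
  define S where "S = N \<inter> f -` fst c"
  define \<phi> where "\<phi> = snd c \<circ> f"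
  define d\<phi> where "d\<phi> x = frechet_derivative \<phi> (at x)" for x
  define p where "p = \<phi> x0"
  have x0S: "x0 \<in> S" using x0 c(2) by (simp add: S_def)
  have sm: "smooth_on S \<phi>" and inj: "inj (d\<phi> x0)"
    using im c(1) x0S unfolding immersion_on_def S_def \<phi>_def d\<phi>_def by blast+
  have S: "open S" using sm by (simp add: smooth_on_def)
  have d1: "(\<phi> has_derivative d\<phi> x) (at x)" if "x \<in> S" for x
    unfolding d\<phi>_def by (rule smooth_on_has_derivative[OF sm that])
  have ld: "linear (d\<phi> x)" if "x \<in> S" for x using has_derivative_linear[OF d1[OF that]] .
  define D2 where "D2 h v = frechet_derivative (\<lambda>y. d\<phi> y v) (at x0) h" for h v
  have d2: "((\<lambda>y. d\<phi> y v) has_derivative (\<lambda>h. D2 h v)) (at x0)" for v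
    unfolding D2_def d\<phi>_def by (rule smooth_on_second_derivative[OF sm x0S])
  have D2sym: "D2 a b = D2 b a" for a b by (rule second_derivative_symmetric[OF S x0S d1 d2])
  note D2lin = derivative_of_linear_family[OF S x0S ld d2]
  have px: "\<phi> x \<in> chart_image c" if "x \<in> S" for x using that by (simp add: S_def \<phi>_def chart_image_def)
  note pc = px[OF x0S, folded p_def]
  have gb: "bilinear (\<Gamma> c p)" using \<Gamma>(1) c(1) pc unfolding linear_connection_def by blast
  have gs: "\<Gamma> c p a b = \<Gamma> c p b a" for a b using \<Gamma>(2) c(1) pc unfolding torsion_free_def by blast
  note gl = bilinear_ladd[OF gb] bilinear_radd[OF gb] bilinear_lmul[OF gb] bilinear_rmul[OF gb]
  have ex: "\<exists>F. linear F \<and> bij F \<and> conjugate F Q_std = Q c (\<phi> x) \<and> (\<forall>w. F (incl w) = d\<phi> x (?H x w))" if "x \<in> S" for x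
  proof -
    have "?H x \<circ> id \<in> heis_structure L x" unfolding heis_structure_iff by (rule bexI[OF refl id_Ggrp])
    moreover have "heis_structure L x = {u. linear u \<and> bij u \<and> (\<exists>F. linear F \<and> bij F \<and> conjugate F Q_std = Q c (\<phi> x) \<and>
             (\<forall>w. F (incl w) = d\<phi> x (u w)))}"
      using ind c(1) that unfolding induced_on_def S_def \<phi>_def d\<phi>_def o_apply by blast
    ultimately show ?thesis by simp
  qed
  obtain F where lF: "linear F" and bF: "bij F" and QF: "conjugate F Q_std = Q c p" and F: "\<And>w. F (incl w) = d\<phi> x0 (?H x0 w)"
    using ex[OF x0S] unfolding p_def by blast
  define \<nu> where "\<nu> v = fst (snd (inv F v))" for v
  have lFi: "linear (inv F)" by (rule inj_linear_imp_inv_linear[OF lF bij_is_inj[OF bF]])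
  have iF: "inv F (F v) = v" for v by (rule inv_f_f[OF bij_is_inj[OF bF]])
  have l\<nu>: "linear \<nu>" unfolding \<nu>_def by (simp add: linear_iff linear_add[OF lFi] linear_cmul[OF lFi])
  have \<nu>F: "\<nu> (F v) = fst (snd v)" for v by (simp add: \<nu>_def iF)
  have \<nu>0: "\<nu> (d\<phi> x0 w) = 0" for w
  proof -
    have "d\<phi> x0 w = F (incl (inv (?H x0) w))"
      unfolding F using surj_f_inv_f[OF bij_is_surj[OF heis_frame_inv(1)[OF bl]]] by metis
    then show ?thesis by (simp add: \<nu>F)
  qed
  define b where "b h v = \<nu> (D2 h v + \<Gamma> c p (d\<phi> x0 h) (d\<phi> x0 v))" for h v
  define e where "e x = ?H x0 (x, 0)" for x
  have bsym: "b h v = b v h" for h v unfolding b_def using D2sym[of h v] gs[of "d\<phi> x0 h"] by simp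
  have bbil: "bilinear b" unfolding bilinear_def b_def
    by (simp add: linear_iff linear_add[OF D2lin(1)] linear_add[OF D2lin(2)] linear_cmul[OF D2lin(1)] linear_cmul[OF D2lin(2)]
        linear_add[OF ld[OF x0S]] linear_cmul[OF ld[OF x0S]] gl linear_add[OF l\<nu>] linear_cmul[OF l\<nu>] algebra_simps del: split_paired_All)
  have le: "e (x + y) = e x + e y" "e (r *\<^sub>R x) = r *\<^sub>R e x" for x y r
    using linear_add[OF heis_frame_linear[OF bl, of x0], of "(x,0)" "(y,0)"] linear_cmul[OF heis_frame_linear[OF bl, of x0], of r "(x,0)"]
    by (simp_all add: e_def)
  have fe: "fst (e x) = x" for x by (simp add: e_def heis_frame_eq[OF bl])
  define \<beta> where "\<beta> x y = b (e x) (e y)" for x y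
  have "bilinear \<beta>" unfolding \<beta>_def bilinear_def
    by (simp add: linear_iff le bilinear_ladd[OF bbil] bilinear_radd[OF bbil] bilinear_lmul[OF bbil] bilinear_rmul[OF bbil])
  moreover have "\<beta> x y = \<beta> y x" for x y unfolding \<beta>_def by (rule bsym)
  moreover have "L x y $ k = \<beta> (rmulU x (im (ax k))) y - \<beta> x (rmulU y (im (ax k)))" for x y k
  proof -
    \<comment> \<open>J is right multiplication by the k-th unit, seen in the tangent space; I extends it to a local section of Q with
      constant coefficients in a local basis.\<close>
    define J where "J v = F (rmulV (inv F v) (im (ax k)))" for v
    have JQ: "J \<in> Q c p" unfolding QF[symmetric] J_def by (rule conjugate_Q_stdI)
    have JF: "J (F v) = F (rmulV v (im (ax k)))" for v by (simp add: J_def iF)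
    have lJ: "linear J"
      unfolding J_def using linear_compose[OF linear_compose[OF lFi linear_rmulV] lF] by (simp add: o_def)
    obtain N1 I1 I2 I3 where N1: "p \<in> N1" "N1 \<subseteq> chart_image c" "smooth_op_on N1 I1" "smooth_op_on N1 I2" "smooth_op_on N1 I3"
      and Q1: "\<And>z. z \<in> N1 \<Longrightarrow> Q c z = {\<lambda>v. a1 *\<^sub>R I1 z v + a2 *\<^sub>R I2 z v + a3 *\<^sub>R I3 z v | a1 a2 a3. True}"
      using aq c(1) pc unfolding almost_quaternionic_manifold_def by meson
    obtain a1 a2 a3 where J: "J = (\<lambda>v. a1 *\<^sub>R I1 p v + a2 *\<^sub>R I2 p v + a3 *\<^sub>R I3 p v)"
      using JQ unfolding Q1[OF N1(1)] by blast
    define I where "I z v = a1 *\<^sub>R I1 z v + a2 *\<^sub>R I2 z v + a3 *\<^sub>R I3 z v" for z v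
    have Ip: "I p = J" unfolding J by (rule ext) (simp only: I_def)
    have IQ: "I z \<in> Q c z" if "z \<in> N1" for z unfolding Q1[OF that] I_def by blast
    have N1o: "open N1" using N1(3) unfolding smooth_op_on_def smooth_on_def by blast
    have lI: "linear (I z)" if "z \<in> N1" for z
      using N1(3-5) that unfolding I_def smooth_op_on_def by (intro linear_compose_add linear_compose_scale_right) blast+
    have sI: "smooth_on N1 (\<lambda>z. I z v)" for v
    proof -
      have s: "smooth_on N1 (\<lambda>z. I1 z v)" "smooth_on N1 (\<lambda>z. I2 z v)" "smooth_on N1 (\<lambda>z. I3 z v)"
        using N1(3-5) unfolding smooth_op_on_def by blast+
      show ?thesis unfolding I_def
        using smooth_on_linear_combination[OF smooth_on_linear_combination[OF s(1,2), of a1 a2] s(3), of 1 a3] by simp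
    qed
    have sopI: "smooth_op_on N1 I" unfolding smooth_op_on_def using lI sI by blast
    define DI where "DI a v = frechet_derivative (\<lambda>z. I z v) (at p) a" for a v
    have dI: "((\<lambda>z. I z v) has_derivative (\<lambda>a. DI a v)) (at p)" for v
      unfolding DI_def by (rule smooth_on_has_derivative[OF sI N1(1)])
    have pres: "(\<lambda>v. DI a v + \<Gamma> c p a (J v) - J (\<Gamma> c p a v)) \<in> Q c p" for a
      using \<Gamma>(3) c(1) N1(1,2) sopI IQ unfolding preserves_def DI_def Ip[symmetric] by blast
    \<comment> \<open>The covariant derivative of I takes values in Q, so it maps the maximal quaternionic subspace to itself, where \<open>\<nu>\<close> vanishes.\<close>
    have \<nu>pres: "\<nu> (DI a (F (y, 0)) + \<Gamma> c p a (J (F (y, 0))) - J (\<Gamma> c p a (F (y, 0)))) = 0" for a y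
    proof -
      obtain q where "\<And>v. (\<lambda>v. DI a v + \<Gamma> c p a (J v) - J (\<Gamma> c p a v)) (F v) = F (rmulV v (im q))"
        using conjugate_Q_stdE[OF pres[folded QF] bF] by blast
      from this[of "(y, 0)"] show ?thesis by (simp add: \<nu>F)
    qed
    define S1 where "S1 = S \<inter> \<phi> -` N1"
    have S1: "open S1" "x0 \<in> S1"
      unfolding S1_def using continuous_open_preimage[OF smooth_on_continuous[OF sm] S N1o] x0S N1(1) by (simp_all add: p_def)
    have key: "b h (e (rmulU y (im (ax k)))) = \<nu> (J (D2 h (e y) + \<Gamma> c p (d\<phi> x0 h) (F (y, 0)))) + 1/2 * \<nu> (J (F (0, im (L (fst h) y))))" for h y
    proof -
      define G where "G x = I (\<phi> x) (d\<phi> x (?H x (y, 0)))" for x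
      have dX: "((\<lambda>x. d\<phi> x (?H x (y, 0))) has_derivative (\<lambda>h. D2 h (?H x0 (y, 0)) + d\<phi> x0 (0, (1/2) *\<^sub>R L (fst h) (fst (y, 0 :: real^3))))) (at x0)"
        by (rule has_derivative_family_apply[OF S x0S ld d2 heis_frame_has_derivative[OF bl]])
      have dIp: "((\<lambda>x. I (\<phi> x) v) has_derivative (\<lambda>h. DI (d\<phi> x0 h) v)) (at x0)" for v
        by (rule has_derivative_compose[OF d1[OF x0S], of "\<lambda>z. I z v" "\<lambda>a. DI a v"]) (use dI p_def in simp)
      have dG: "(G has_derivative (\<lambda>h. DI (d\<phi> x0 h) (d\<phi> x0 (?H x0 (y, 0))) + 
          I (\<phi> x0) (D2 h (?H x0 (y, 0)) + d\<phi> x0 (0, (1/2) *\<^sub>R L (fst h) (fst (y, 0 :: real^3)))))) (at x0)"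
        unfolding G_def by (rule has_derivative_family_apply[OF S1 _ dIp dX]) (rule lI, simp add: S1_def)
      have Gt: "G x \<in> range (d\<phi> x)" if x: "x \<in> S1" for x
      proof -
        have xS: "x \<in> S" and xN: "\<phi> x \<in> N1" using x by (simp_all add: S1_def)
        obtain F' where F': "bij F'" "conjugate F' Q_std = Q c (\<phi> x)" "\<And>w. F' (incl w) = d\<phi> x (?H x w)" using ex[OF xS] by blast
        obtain q where q: "\<And>v. I (\<phi> x) (F' v) = F' (rmulV v (im q))"
          using conjugate_Q_stdE[OF IQ[OF xN, folded F'(2)] F'(1)] by blast
        have "G x = F' (incl (rmulU y (im q), 0))"
          unfolding G_def F'(3)[symmetric] q by (simp add: incl_def rmulV_def im_linear)
        then show ?thesis unfolding F'(3) by (rule range_eqI)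
      qed
      have inc: "incl (u, 0) = (u, 0)" for u :: "'m Usp" by (simp add: incl_def im_linear)
      have Y0: "d\<phi> x0 (?H x0 (y, 0)) = F (y, 0)" for y unfolding F[symmetric] inc ..
      have Gx0: "G x0 = d\<phi> x0 (e (rmulU y (im (ax k))))"
        unfolding G_def p_def[symmetric] Ip Y0 JF e_def by (simp add: rmulV_def)
      have S1S: "y \<in> S" if "y \<in> S1" for y using that by (simp add: S1_def)
      have H0: "d\<phi> x0 (0, w) = F (0, im w)" for w
        using F[of "(0, w)"] by (simp add: heis_frame_eq[OF bl] bilinear_rzero[OF bl] incl_def)
      have "\<nu> (DI (d\<phi> x0 h) (d\<phi> x0 (?H x0 (y, 0))) + 
          I (\<phi> x0) (D2 h (?H x0 (y, 0)) + d\<phi> x0 (0, (1/2) *\<^sub>R L (fst h) (fst (y, 0 :: real^3))))) = \<nu> (D2 h (e (rmulU y (im (ax k)))))"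
        by (rule derivative_of_tangent_field[OF S1 ld[OF S1S] inj d2 dG Gt Gx0 l\<nu> \<nu>0])
      then have "\<nu> (DI (d\<phi> x0 h) (F (y, 0)) + J (D2 h (e y) + F (0, (1/2) *\<^sub>R im (L (fst h) y)))) = \<nu> (D2 h (e (rmulU y (im (ax k)))))"
        unfolding p_def[symmetric] Ip Y0 H0 e_def im_linear fst_conv .
      moreover have "F (0, (1/2) *\<^sub>R im (L (fst h) y)) = (1/2) *\<^sub>R F (0, im (L (fst h) y))"
        using linear_cmul[OF lF, of "1/2" "(0, im (L (fst h) y))"] by simp
      moreover have "b h (e (rmulU y (im (ax k)))) = \<nu> (D2 h (e (rmulU y (im (ax k))))) + \<nu> (\<Gamma> c p (d\<phi> x0 h) (J (F (y, 0))))"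
        unfolding b_def linear_add[OF l\<nu>] e_def Y0 JF by (simp add: rmulV_def)
      ultimately show ?thesis using \<nu>pres[of "d\<phi> x0 h" y]
        by (simp add: linear_add[OF l\<nu>] linear_diff[OF l\<nu>] linear_add[OF lJ] linear_cmul[OF lJ] linear_cmul[OF l\<nu>])
    qed
    have FY: "d\<phi> x0 (e y) = F (y, 0)" for y unfolding e_def F[symmetric] by (simp add: incl_def im_linear)
    have "\<beta> x (rmulU y (im (ax k))) - \<beta> y (rmulU x (im (ax k))) =
      1/2 * \<nu> (J (F (0, im (L x y)))) - 1/2 * \<nu> (J (F (0, im (L y x))))"
      unfolding \<beta>_def key fe FY using D2sym[of "e x" "e y"] gs[of "F (x, 0)" "F (y, 0)"] by simp
    also have "\<dots> = \<nu> (J (F (0, im (L x y))))"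
    proof -
      have "F (0, im (L y x)) = - F (0, im (L x y))"
        unfolding bracket_tensors_skew[OF L, of y x] im_linear using linear_neg[OF lF, of "(0, im (L x y))"] by simp
      then show ?thesis by (simp add: linear_neg[OF lJ] linear_neg[OF l\<nu>])
    qed
    also have "\<dots> = - L x y $ k" unfolding JF \<nu>F using exhaust_3[of k] by auto
    finally show ?thesis using bsym[of "e y"] unfolding \<beta>_def by simp
  qed
  ultimately show ?thesis unfolding hypersurface_bracket_def by blast
qed

section \<open>Comparing brackets by a frame\<close>

text \<open>Pull \<open>\<beta>\<close> back by the action of g on U and divide by the scalar \<open>\<mu>\<close> by which g rescales Im H. The rotations of U and of Im H
by g are the same, so the imaginary units match.\<close>

lemma hypersurface_bracket_transfer:
  fixes L L' :: "'m::finite bracket"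
  assumes g: "g \<in> Ggrp" and L': "hypersurface_bracket L'"
    and eq: "\<And>x y. snd (g (0, L x y)) = L' (fst (g (x, 0))) (fst (g (y, 0)))"
  shows "hypersurface_bracket L"
proof -
  obtain \<mu> h b where h: "\<mu> \<noteq> 0" "norm h = 1" and gp: "\<And>p. im (snd (g (0, p))) = \<mu> *\<^sub>R (h \<odot> im p \<odot> qcnj h)"
    and gx: "\<And>x q. fst (g (rmulU x q, 0)) = rmulU (fst (g (x, 0))) (h \<odot> q \<odot> qcnj h)"
    by (rule Ggrp_form[OF g]) blast
  note hh = qmul_cnj_unit[OF h(2)]
  obtain \<beta> where b: "bilinear \<beta>" "\<And>x y. \<beta> x y = \<beta> y x"
    "\<And>x y k. L' x y $ k = \<beta> (rmulU x (im (ax k))) y - \<beta> x (rmulU y (im (ax k)))"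
    using L' unfolding hypersurface_bracket_def by blast
  note bs = bilinear_ladd[OF b(1)] bilinear_radd[OF b(1)] bilinear_lmul[OF b(1)] bilinear_rmul[OF b(1)]
  have inner: "L' x y \<bullet> v = \<beta> (rmulU x (im v)) y - \<beta> x (rmulU y (im v))" for x y v
  proof -
    have "L' x y \<bullet> (r *\<^sub>R ax 1 + s *\<^sub>R ax 2 + t *\<^sub>R ax 3) = \<beta> (rmulU x (im (r *\<^sub>R ax 1 + s *\<^sub>R ax 2 + t *\<^sub>R ax 3))) y 
      - \<beta> x (rmulU y (im (r *\<^sub>R ax 1 + s *\<^sub>R ax 2 + t *\<^sub>R ax 3)))" for r s t
      by (simp add: inner_add_right inner_axis b(3) bs im_linear rmulU_add algebra_simps)
    from this[of "v $ 1" "v $ 2" "v $ 3"] show ?thesis unfolding vec3_basis[symmetric] .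
  qed
  define A where "A x = fst (g (x, 0))" for x
  have lA: "linear A" unfolding A_def by (rule linear_parts(1)[OF Ggrp_linear_bij(1)[OF g]])
  define \<gamma> where "\<gamma> x y = (1 / \<mu>) * \<beta> (A x) (A y)" for x y
  have "bilinear \<gamma>" unfolding \<gamma>_def bilinear_def
    by (simp add: linear_iff linear_add[OF lA] linear_cmul[OF lA] bs add_divide_distrib)
  moreover have "\<gamma> x y = \<gamma> y x" for x y unfolding \<gamma>_def b(2)[of "A x"] ..
  moreover have "L x y $ k = \<gamma> (rmulU x (im (ax k))) y - \<gamma> x (rmulU y (im (ax k)))" for x y k
  proof -
    have im: "h \<odot> im (ax k) \<odot> qcnj h = im (snd (h \<odot> im (ax k) \<odot> qcnj h))"
    proof -
      have "fst (h \<odot> im (ax k) \<odot> qcnj h) = 0" by (simp add: algebra_simps)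
      then show ?thesis by (simp only: prod_eq_iff im_components)
    qed
    have Ak: "A (rmulU x (im (ax k))) = rmulU (A x) (im (snd (h \<odot> im (ax k) \<odot> qcnj h)))" for x
      unfolding A_def gx im[symmetric] ..
    have "L' (A x) (A y) \<bullet> snd (h \<odot> im (ax k) \<odot> qcnj h) = \<mu> * L x y $ k"
    proof -
      have "L' (A x) (A y) \<bullet> snd (h \<odot> im (ax k) \<odot> qcnj h) = - fst (\<mu> *\<^sub>R (h \<odot> im (L x y) \<odot> qcnj h) \<odot> (h \<odot> im (ax k) \<odot> qcnj h))"
        unfolding inner_im im[symmetric] A_def eq[symmetric] gp ..
      also have "\<dots> = - \<mu> * fst (h \<odot> im (L x y) \<odot> (qcnj h \<odot> h) \<odot> im (ax k) \<odot> qcnj h)"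
        by (simp only: qmul_assoc qmul_simps fst_scaleR real_scaleR_def mult_minus_left)
      also have "\<dots> = - \<mu> * fst (qcnj h \<odot> (h \<odot> im (L x y) \<odot> (qcnj h \<odot> h) \<odot> im (ax k)))"
        by (subst fst_qmul_commute) (rule refl)
      also have "\<dots> = - \<mu> * fst (im (L x y) \<odot> im (ax k))"
        by (simp only: qmul_assoc[symmetric] hh qmul_simps scaleR_one)
      also have "\<dots> = \<mu> * (L x y \<bullet> ax k)" by (simp only: inner_im)
      finally show ?thesis by (simp add: inner_axis)
    qed
    then show ?thesis using h(1) unfolding inner \<gamma>_def Ak by (simp add: field_simps)
  qed
  ultimately show ?thesis unfolding hypersurface_bracket_def by blast
qed

lemma L_std_nth: "L_std x y $ k = (\<Sum>i\<in>UNIV. snd (qcnj (x $ i) \<odot> y $ i) $ k)"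
  by (simp add: L_std_def snd_sum sum_component)

lemma L_std_bracket: "(L_std :: 'm::finite Usp \<Rightarrow> 'm Usp \<Rightarrow> real^3) \<in> bracket_tensors"
proof -
  have "bilinear (L_std :: 'm Usp \<Rightarrow> 'm Usp \<Rightarrow> real^3)" unfolding bilinear_def
    by (simp add: linear_iff vec_eq_iff forall_3 L_std_nth sum.distrib sum_subtractf sum_distrib_left algebra_simps)
  moreover have "L_std x x = 0" for x :: "'m Usp"
    by (simp add: L_std_def vec_eq_iff forall_3 snd_sum sum_component algebra_simps)
  ultimately show ?thesis by (simp add: bracket_tensors_def)
qed

lemma L_std_hypersurface: "hypersurface_bracket (L_std :: 'm::finite Usp \<Rightarrow> 'm Usp \<Rightarrow> real^3)"
proof -
  have "L_std x y $ k = (1/2) * (rmulU x (im (ax k)) \<bullet> y) - (1/2) * (x \<bullet> rmulU y (im (ax k)))" for x y :: "'m Usp" and k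
    unfolding L_std_nth inner_vec_def[of "rmulU x _"] inner_vec_def[of x] sum_distrib_left sum_subtractf[symmetric]
    by (rule sum.cong[OF refl]) (use exhaust_3[of k] in \<open>auto simp: inner_prod_def inner_vec_def sum_3 field_simps\<close>)
  then show ?thesis unfolding hypersurface_bracket_def
    by (intro exI[of _ "\<lambda>x y. (1/2) * (x \<bullet> y)"]) (auto simp: inner_commute bilinear_def linear_iff inner_add_left inner_add_right algebra_simps)
qed

section \<open>Brackets of isomorphic and of contact structures\<close>

text \<open>An isomorphism maps the distribution to the distribution, so the left-invariant fields of the first group satisfy
\<open>snd (d\<phi> X) = 1/2 L' (fst \<phi>, fst (d\<phi> X))\<close>. Differentiating this equation along another such field and antisymmetrising removes
the second derivatives of \<open>\<phi>\<close>, and what remains says that an element of G carries one bracket to the other.\<close>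

lemma isomorphic_imp_hypersurface_bracket:
  fixes L L' :: "'m::finite bracket"
  assumes L: "L \<in> bracket_tensors" and L': "L' \<in> bracket_tensors"
    and iso: "isomorphic (heis_structure L) (heis_structure L')" and hyp: "hypersurface_bracket L'"
  shows "hypersurface_bracket L"
proof -
  note bl = bracket_tensors_bilinear[OF L] and bl' = bracket_tensors_bilinear[OF L']
  let ?H = "heis_frame L" and ?H' = "heis_frame L'"
  interpret L': bounded_bilinear L' using bl' bilinear_conv_bounded_bilinear by blast
  obtain \<phi> where sm: "smooth_on UNIV \<phi>" and P: "\<And>x. heis_structure L' (\<phi> x) = {frechet_derivative \<phi> (at x) \<circ> u | u. u \<in> heis_structure L x}"
    using iso unfolding isomorphic_def by blast
  define d where "d x = frechet_derivative \<phi> (at x)" for x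
  have d1: "(\<phi> has_derivative d x) (at x)" for x
    unfolding d_def by (rule smooth_on_has_derivative[OF sm UNIV_I])
  have ld: "linear (d x)" for x using has_derivative_linear[OF d1] .
  define D2 where "D2 h v = frechet_derivative (\<lambda>y. d y v) (at 0) h" for h v
  have d2: "((\<lambda>y. d y v) has_derivative (\<lambda>h. D2 h v)) (at 0)" for v
    unfolding D2_def d_def by (rule smooth_on_second_derivative[OF sm UNIV_I])
  have D2sym: "D2 a b = D2 b a" for a b by (rule second_derivative_symmetric[OF open_UNIV UNIV_I d1 d2])
  have fr: "\<exists>g\<in>Ggrp. \<forall>w. d x (?H x w) = ?H' (\<phi> x) (g w)" for x
  proof -
    have "?H x \<circ> id \<in> heis_structure L x" unfolding heis_structure_iff by (rule bexI[OF refl id_Ggrp])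
    then have "d x \<circ> (?H x \<circ> id) \<in> heis_structure L' (\<phi> x)" unfolding P d_def by blast
    then obtain g where g: "g \<in> Ggrp" "d x \<circ> (?H x \<circ> id) = ?H' (\<phi> x) \<circ> g" unfolding heis_structure_iff by (elim bexE) (rule that)
    show ?thesis by (rule bexI[OF _ g(1)]) (use fun_cong[OF g(2)] in simp)
  qed
  obtain g where g: "g \<in> Ggrp" and dg: "\<And>w. d 0 (?H 0 w) = ?H' (\<phi> 0) (g w)" using fr[of 0] by blast
  have H0: "?H 0 w = w" for w by (simp add: heis_frame_eq[OF bl] bilinear_lzero[OF bl])
  have con: "snd (d x (?H x (a, 0))) - (1/2) *\<^sub>R L' (fst (\<phi> x)) (fst (d x (?H x (a, 0)))) = 0" for x a
  proof -
    obtain k where k: "k \<in> Ggrp" "d x (?H x (a, 0)) = ?H' (\<phi> x) (k (a, 0))" using fr[of x] by blast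
    show ?thesis unfolding k(2) using Ggrp_identities(1)[OF k(1), of a] by (simp add: heis_frame_eq[OF bl'])
  qed
  \<comment> \<open>The derivative at the origin of the left-invariant field with initial value \<open>(a, 0)\<close>, pushed forward by \<open>\<phi>\<close>.\<close>
  define E where "E h a = D2 h (a, 0) + d 0 (0, (1/2) *\<^sub>R L (fst h) a)" for h :: "'m Wsp" and a
  have dE: "((\<lambda>x. d x (?H x (a, 0))) has_derivative (\<lambda>h. E h a)) (at 0)" for a
    using has_derivative_family_apply[OF open_UNIV UNIV_I ld d2 heis_frame_has_derivative[OF bl, of "(a, 0)"]]
    by (simp add: E_def H0)
  have dc: "((\<lambda>x. snd (d x (?H x (a, 0))) - (1/2) *\<^sub>R L' (fst (\<phi> x)) (fst (d x (?H x (a, 0))))) has_derivative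
      (\<lambda>h. snd (E h a) - (1/2) *\<^sub>R (L' (fst (\<phi> 0)) (fst (E h a)) + L' (fst (d 0 h)) (fst (d 0 (a, 0)))))) (at 0)" for a
    using has_derivative_diff[OF has_derivative_snd[OF dE] has_derivative_scaleR_right[OF L'.FDERIV[OF has_derivative_fst[OF d1] has_derivative_fst[OF dE]], of "1/2"]]
    by (simp add: H0)
  have con': "snd (E h a) - (1/2) *\<^sub>R (L' (fst (\<phi> 0)) (fst (E h a)) + L' (fst (d 0 h)) (fst (d 0 (a, 0)))) = 0" for h a
    by (rule has_derivative_const_on_open[OF open_UNIV UNIV_I dc con])
  have "snd (g (0, L a b)) = L' (fst (g (a, 0))) (fst (g (b, 0)))" for a b
  proof -
    have e: "E (a, 0) b - E (b, 0) a = d 0 (0, L a b)"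
    proof -
      have "d 0 (0, (1/2) *\<^sub>R L a b) = (1/2) *\<^sub>R d 0 (0, L a b)" "d 0 (0, (1/2) *\<^sub>R L b a) = - (1/2) *\<^sub>R d 0 (0, L a b)"
        using linear_cmul[OF ld[of 0], of "1/2" "(0, L a b)"] linear_cmul[OF ld[of 0], of "- (1/2)" "(0, L a b)"] bracket_tensors_skew[OF L, of b a] by simp_all
      then show ?thesis unfolding E_def using D2sym[of "(a,0)" "(b,0)"] by (simp flip: scaleR_add_left)
    qed
    have "snd (E (a, 0) b) - snd (E (b, 0) a) - (1/2) *\<^sub>R (L' (fst (\<phi> 0)) (fst (E (a, 0) b)) - L' (fst (\<phi> 0)) (fst (E (b, 0) a)))
      = (1/2) *\<^sub>R L' (fst (d 0 (a, 0))) (fst (d 0 (b, 0))) - (1/2) *\<^sub>R L' (fst (d 0 (b, 0))) (fst (d 0 (a, 0)))"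
      using con'[of "(a,0)" b] con'[of "(b,0)" a] by (simp add: algebra_simps)
    also have "\<dots> = L' (fst (d 0 (a, 0))) (fst (d 0 (b, 0)))"
      using bracket_tensors_skew[OF L', of "fst (d 0 (b, 0))"] by (simp flip: scaleR_add_left)
    finally have 1: "snd (E (a, 0) b) - snd (E (b, 0) a) - (1/2) *\<^sub>R (L' (fst (\<phi> 0)) (fst (E (a, 0) b)) - L' (fst (\<phi> 0)) (fst (E (b, 0) a)))
      = L' (fst (d 0 (a, 0))) (fst (d 0 (b, 0)))" .
    have 2: "fst (d 0 (u, 0)) = fst (g (u, 0))" for u using dg[of "(u, 0)"] by (simp add: H0 heis_frame_eq[OF bl'])
    have "snd (d 0 (0, L a b)) - (1/2) *\<^sub>R L' (fst (\<phi> 0)) (fst (d 0 (0, L a b))) = L' (fst (g (a, 0))) (fst (g (b, 0)))"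
      using 1 unfolding e[symmetric] 2 by (simp add: L'.diff_right)
    moreover have "d 0 (0, L a b) = ?H' (\<phi> 0) (g (0, L a b))" using dg[of "(0, L a b)"] by (simp add: H0)
    ultimately show ?thesis by (simp add: heis_frame_eq[OF bl'])
  qed
  then show ?thesis by (rule hypersurface_bracket_transfer[OF g hyp])
qed

text \<open>Tested on left-invariant fields, the contact condition at the origin says that an element g of G carries the standard bracket
to L; its inverse then carries L to the standard bracket, as \<open>hypersurface_bracket_transfer\<close> requires.\<close>

lemma quaternionic_contact_imp_hypersurface_bracket:
  fixes L :: "'m::finite bracket"
  assumes L: "L \<in> bracket_tensors" and qc: "quaternionic_contact (heis_structure L)"
  shows "hypersurface_bracket L"
proof -
  note bl = bracket_tensors_bilinear[OF L]
  let ?H = "heis_frame L"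
  have H0: "?H 0 w = w" for w by (simp add: heis_frame_eq[OF bl] bilinear_lzero[OF bl])
  have H0': "?H 0 = id" using H0 by (simp only: fun_eq_iff id_apply) simp
  have dist: "?H y (a, 0) \<in> distr (heis_structure L) y" for y a
  proof -
    have "?H y \<circ> id \<in> heis_structure L y" unfolding heis_structure_iff by (rule bexI[OF refl id_Ggrp])
    then show ?thesis unfolding distr_def by (auto intro!: exI[of _ "?H y"] exI[of _ a])
  qed
  have dist0: "snd w = 0" if w: "w \<in> distr (heis_structure L) 0" for w
  proof -
    obtain u a where u: "w = u (a, 0)" "u \<in> heis_structure L 0" using w unfolding distr_def by blast
    then obtain k where "k \<in> Ggrp" "u = ?H 0 \<circ> k" unfolding heis_structure_iff by (elim bexE) (rule that)
    then show ?thesis using Ggrp_identities(1)[of k a] by (simp add: u(1) H0)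
  qed
  have "\<exists>u\<in>heis_structure L 0. \<forall>N X Y a b.
      0 \<in> N \<and> smooth_on N X \<and> smooth_on N Y \<and>
      (\<forall>y\<in>N. X y \<in> distr (heis_structure L) y \<and> Y y \<in> distr (heis_structure L) y) \<and>
      X 0 = u (a, 0) \<and> Y 0 = u (b, 0) \<longrightarrow>
      lie_bracket X Y 0 - u (0, L_std a b) \<in> distr (heis_structure L) 0"
    using qc unfolding quaternionic_contact_def by (rule spec)
  then obtain u where u: "u \<in> heis_structure L 0" and br: "\<forall>N X Y a b.
      0 \<in> N \<and> smooth_on N X \<and> smooth_on N Y \<and>
      (\<forall>y\<in>N. X y \<in> distr (heis_structure L) y \<and> Y y \<in> distr (heis_structure L) y) \<and>
      X 0 = u (a, 0) \<and> Y 0 = u (b, 0) \<longrightarrow>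
      lie_bracket X Y 0 - u (0, L_std a b) \<in> distr (heis_structure L) 0" ..
  obtain g where g: "g \<in> Ggrp" and ug: "u = ?H 0 \<circ> g" using u unfolding heis_structure_iff by (elim bexE) (rule that)
  have ug: "u = g" unfolding ug H0' by simp
  note lg = Ggrp_linear_bij[OF g]
  have sm: "smooth_on UNIV (\<lambda>y. ?H y w)" for w
    using heis_frame_smooth[OF bl] unfolding frame_field_def smooth_op_on_def by blast
  have main: "snd (g (0, L_std a b)) = L (fst (g (a, 0))) (fst (g (b, 0)))" for a b
  proof -
    have w: "(fst (g (c, 0)), 0) = g (c, 0)" for c using Ggrp_identities(1)[OF g, of c] by (simp add: prod_eq_iff)
    have fd: "frechet_derivative (\<lambda>y. ?H y w) (at 0) = (\<lambda>h. (0, (1/2) *\<^sub>R L (fst h) (fst w)))" for w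
      using frechet_derivative_at[OF heis_frame_has_derivative[OF bl, of w 0]] by simp
    have "lie_bracket (\<lambda>y. ?H y (g (a, 0))) (\<lambda>y. ?H y (g (b, 0))) 0 - u (0, L_std a b) \<in> distr (heis_structure L) 0"
    proof (rule br[rule_format], intro conjI ballI)
      show "0 \<in> (UNIV :: 'm Wsp set)" by simp
      show "smooth_on UNIV (\<lambda>y. ?H y (g (a, 0)))" "smooth_on UNIV (\<lambda>y. ?H y (g (b, 0)))" by (rule sm)+
      show "?H 0 (g (a, 0)) = u (a, 0)" "?H 0 (g (b, 0)) = u (b, 0)" by (simp_all only: H0 ug)
      show "?H y (g (a, 0)) \<in> distr (heis_structure L) y" "?H y (g (b, 0)) \<in> distr (heis_structure L) y" for y
        using dist[of y "fst (g (a, 0))"] dist[of y "fst (g (b, 0))"] by (simp_all only: w)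
    qed
    from dist0[OF this] have "snd (g (0, L_std a b)) = (1/2) *\<^sub>R L (fst (g (a, 0))) (fst (g (b, 0))) - (1/2) *\<^sub>R L (fst (g (b, 0))) (fst (g (a, 0)))"
      by (simp add: lie_bracket_def fd H0 ug)
    then show ?thesis using bracket_tensors_skew[OF L, of "fst (g (b, 0))"] by (simp flip: scaleR_add_left)
  qed
  have gi: "g (inv g w) = w" "inv g (g w) = w" for w using lg(2) by (simp_all add: bij_is_surj surj_f_inv_f bij_is_inj)
  have gI: "inv g \<in> Ggrp" by (rule inv_Ggrp[OF g])
  show ?thesis
  proof (rule hypersurface_bracket_transfer[OF gI L_std_hypersurface])
    fix x y
    define a where "a = fst (inv g (x, 0))"
    define b where "b = fst (inv g (y, 0))"
    have "(a, 0) = inv g (x, 0)" "(b, 0) = inv g (y, 0)"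
      unfolding a_def b_def using Ggrp_identities(1)[OF gI] by (simp_all add: prod_eq_iff)
    then have "g (a, 0) = (x, 0)" "g (b, 0) = (y, 0)" by (simp_all add: gi)
    with main[of a b] have "snd (g (0, L_std a b)) = L x y" by simp
    then have "g (0, L_std a b) = (fst (g (0, L_std a b)), 0) + (0, L x y)" by (simp add: prod_eq_iff)
    from arg_cong[OF this, of "inv g"] have "(0, L_std a b) = inv g (fst (g (0, L_std a b)), 0) + inv g (0, L x y)"
      by (simp only: gi linear_add[OF Ggrp_linear_bij(1)[OF gI]])
    from arg_cong[OF this, of snd] show "snd (inv g (0, L x y)) = L_std (fst (inv g (x, 0))) (fst (inv g (y, 0)))"
      using Ggrp_identities(1)[OF gI] by (simp add: a_def b_def)
  qed
qed

section \<open>A deformation of the standard structure\<close>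

definition stretched_bracket :: "real \<Rightarrow> 'm::finite bracket"
  where "stretched_bracket t x y = L_std x y + (t * L_std x y $ 1) *\<^sub>R ax 1"

lemma stretched_bracket_bilinear:
  "(stretched_bracket t :: 'm::finite Usp \<Rightarrow> 'm Usp \<Rightarrow> real^3) \<in> bracket_tensors"
proof -
  note b = bracket_tensors_bilinear[OF L_std_bracket]
  have "bilinear (stretched_bracket t :: 'm Usp \<Rightarrow> 'm Usp \<Rightarrow> real^3)" unfolding bilinear_def stretched_bracket_def
    by (simp add: linear_iff bilinear_ladd[OF b] bilinear_radd[OF b] bilinear_lmul[OF b] bilinear_rmul[OF b] algebra_simps)
  moreover have "L_std x x = 0" for x :: "'m Usp" using L_std_bracket unfolding bracket_tensors_def by blast
  ultimately show ?thesis by (simp add: bracket_tensors_def stretched_bracket_def)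
qed

text \<open>For a hypersurface bracket, \<open>L\<^sub>k(u, u i\<^sub>k) = \<beta>(u i\<^sub>k, u i\<^sub>k) + \<beta>(u, u)\<close>. Summing over \<open>u = x\<close> and \<open>u = x i\<^sub>a\<close> with a different from k gives the trace of \<open>\<beta>\<close>
on the line, for each k. The stretched bracket gives \<open>2 (1 + t)\<close> for the first component and 2 for the second.\<close>

lemma stretched_bracket_not_hypersurface:
  assumes "t \<noteq> 0"
  shows "\<not> hypersurface_bracket (stretched_bracket t :: 'm::finite Usp \<Rightarrow> 'm Usp \<Rightarrow> real^3)"
proof
  assume "hypersurface_bracket (stretched_bracket t :: 'm Usp \<Rightarrow> 'm Usp \<Rightarrow> real^3)"
  then obtain \<beta> where b: "bilinear \<beta>" "\<And>x y :: 'm Usp. \<beta> x y = \<beta> y x"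
    "\<And>x y k. stretched_bracket t x y $ k = \<beta> (rmulU x (im (ax k))) y - \<beta> x (rmulU y (im (ax k)))"
    unfolding hypersurface_bracket_def by blast
  \<comment> \<open>Any coordinate vector would do.\<close>
  define x :: "'m Usp" where "x = axis undefined q1"
  have std: "L_std (rmulU x p) (rmulU x q) $ k = snd (qcnj p \<odot> q) $ k" for p q k
  proof -
    have "(\<Sum>i\<in>(UNIV :: 'm set). snd (qcnj (x $ i \<odot> p) \<odot> (x $ i \<odot> q)) $ k) = (\<Sum>i\<in>(UNIV :: 'm set). if i = undefined then snd (qcnj p \<odot> q) $ k else 0)"
      by (rule sum.cong[OF refl]) (use exhaust_3[of k] in \<open>auto simp: x_def axis_def\<close>)
    then show ?thesis by (simp add: L_std_nth)
  qed
  define B where "B k = \<beta> (rmulU x (im (ax k))) (rmulU x (im (ax k)))" for k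
  have q: "stretched_bracket t (rmulU x p) (rmulU x (p \<odot> im (ax k))) $ k
     = \<beta> (rmulU x (p \<odot> im (ax k))) (rmulU x (p \<odot> im (ax k))) + \<beta> (rmulU x p) (rmulU x p)" for p k
    unfolding b(3) by (simp add: qmul_assoc im_ax_mult bilinear_rneg[OF b(1)] bilinear_rmul[OF b(1)])
  note n = bilinear_lneg[OF b(1)] bilinear_rneg[OF b(1)]
  have "stretched_bracket t (rmulU x q1) (rmulU x (im (ax 1))) $ 1 = B 1 + \<beta> x x"
    "stretched_bracket t (rmulU x (im (ax 2))) (rmulU x (- im (ax 3))) $ 1 = B 3 + B 2"
    "stretched_bracket t (rmulU x q1) (rmulU x (im (ax 2))) $ 2 = B 2 + \<beta> x x"
    "stretched_bracket t (rmulU x (im (ax 3))) (rmulU x (- im (ax 1))) $ 2 = B 1 + B 3"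
    using q[of q1 1] q[of "im (ax 2)" 1] q[of q1 2] q[of "im (ax 3)" 2] by (simp_all add: B_def im_ax_mult n del: rmulU_nth)
  then have "(1 + t) + (1 + t) = (1 + 1 :: real)"
    by (simp add: stretched_bracket_def std del: rmulU_simps rmulU_real)
  with assms show False by simp
qed

text \<open>The frames are quadratic in \<open>(t, x)\<close>, hence smooth, and an isomorphism with the standard structure would transfer its
form \<open>\<beta>\<close>.\<close>

theorem stretched_family:
  defines "P \<equiv> \<lambda>t. heis_structure (stretched_bracket t :: 'm::finite Usp \<Rightarrow> 'm Usp \<Rightarrow> real^3)"
  shows "smooth_family P" "almost_CR_quaternionic (P t)" "isomorphic (P t) (heis_structure L_std) \<longleftrightarrow> t = 0"
proof -
  note sb = stretched_bracket_bilinear and bl = bracket_tensors_bilinear[OF stretched_bracket_bilinear]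
  note b = bracket_tensors_bilinear[OF L_std_bracket]
  show "almost_CR_quaternionic (P t)" unfolding P_def by (rule heis_almost_CR[OF bl])
  show "isomorphic (P t) (heis_structure L_std) \<longleftrightarrow> t = 0"
  proof
    assume "isomorphic (P t) (heis_structure L_std)"
    from isomorphic_imp_hypersurface_bracket[OF sb L_std_bracket this[unfolded P_def] L_std_hypersurface]
    show "t = 0" using stretched_bracket_not_hypersurface by blast
  next
    assume t: "t = 0"
    have "(stretched_bracket 0 :: 'm Usp \<Rightarrow> _) = L_std" by (simp add: fun_eq_iff stretched_bracket_def)
    then have P: "P t = heis_structure L_std" unfolding P_def t by simp
    have "smooth_on UNIV (id :: 'm Wsp \<Rightarrow> 'm Wsp)"
      by (rule smooth_on_quadratic[where c = 0 and l = id and B = "\<lambda>_ _. 0"]) (simp_all add: bilinear_def linear_iff linear_id)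
    then show "isomorphic (P t) (heis_structure L_std)" unfolding isomorphic_def P
      by (intro exI[of _ id]) (simp only: bij_id inv_id id_apply frechet_derivative_id id_comp, simp)
  qed
  show "smooth_family P" unfolding smooth_family_def
  proof (intro allI impI)
    fix t0 :: real and x0 :: "'m Wsp"
    define s where "s z = heis_frame (stretched_bracket (fst z)) (snd z)" for z :: "real \<times> 'm Wsp"
    have "smooth_on UNIV (\<lambda>z. s z v)" for v
    proof (rule smooth_on_quadratic[where c = v and l = "\<lambda>z. (0, (1/2) *\<^sub>R L_std (fst (snd z)) (fst v))"
          and B = "\<lambda>z z'. (0, (1/2 * (fst z * L_std (fst (snd z')) (fst v) $ 1)) *\<^sub>R ax 1)"])
      show "linear (\<lambda>z. (0, (1/2) *\<^sub>R L_std (fst (snd z)) (fst v)) :: 'm Wsp)"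
        by (simp add: linear_iff bilinear_ladd[OF b] bilinear_lmul[OF b] algebra_simps)
      show "bilinear (\<lambda>z z'. (0, (1/2 * (fst z * L_std (fst (snd z')) (fst v) $ 1)) *\<^sub>R ax 1) :: 'm Wsp)"
        by (simp add: bilinear_def linear_iff bilinear_ladd[OF b] bilinear_lmul[OF b] algebra_simps flip: scaleR_add_left)
      show "s z v = v + (0, (1/2) *\<^sub>R L_std (fst (snd z)) (fst v)) + (0, (1/2 * (fst z * L_std (fst (snd z)) (fst v) $ 1)) *\<^sub>R ax 1)" for z
        by (simp add: s_def heis_frame_eq[OF bl] stretched_bracket_def prod_eq_iff algebra_simps)
    qed simp
    moreover have "linear (s z)" "bij (s z)" for z unfolding s_def by (rule heis_frame_linear[OF bl], rule heis_frame_inv(1)[OF bl])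
    moreover have "P t x = {s (t, x) \<circ> g |g. g \<in> Ggrp}" for t x unfolding P_def s_def heis_structure_def by simp
    ultimately show "\<exists>N s. (t0, x0) \<in> N \<and> smooth_op_on N s \<and> (\<forall>z\<in>N. bij (s z)) \<and>
      (\<forall>t x. (t, x) \<in> N \<and> t \<ge> 0 \<longrightarrow> P t x = {s (t, x) \<circ> g | g. g \<in> Ggrp})"
      unfolding smooth_op_on_def by (intro exI[of _ UNIV] exI[of _ s] conjI ballI allI impI UNIV_I)
  qed
qed

section \<open>Complex coordinates of bilinear forms\<close>

lemma cmat_entries:
  "cmat q $ 1 $ 1 = of_real (fst q) + \<i> * of_real (snd q $ 1)"
  "cmat q $ 1 $ 2 = of_real (snd q $ 2) + \<i> * of_real (snd q $ 3)"
  "cmat q $ 2 $ 1 = - of_real (snd q $ 2) + \<i> * of_real (snd q $ 3)"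
  "cmat q $ 2 $ 2 = of_real (fst q) - \<i> * of_real (snd q $ 1)"
  by (simp_all add: cmat_def complex_eq_iff vector_2)

lemma cmat_mult: "cmat (p \<odot> q) $ s $ a = (\<Sum>b\<in>UNIV. cmat p $ s $ b * cmat q $ b $ a)"
  using exhaust_2[of s] exhaust_2[of a]
  by (auto simp: sum_2 cmat_entries complex_eq_iff algebra_simps)

lemma cmat_add: "cmat (p + q) $ s $ a = cmat p $ s $ a + cmat q $ s $ a"
  and cmat_scaleR: "cmat (r *\<^sub>R p) $ s $ a = r *\<^sub>R cmat p $ s $ a"
  using exhaust_2[of s] exhaust_2[of a]
  by (auto simp: cmat_entries complex_eq_iff algebra_simps)

lemma cmat_sum: "cmat (\<Sum>j\<in>A. p j) $ s $ a = (\<Sum>j\<in>A. cmat (p j) $ s $ a)"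
proof -
  have "linear (\<lambda>p. cmat p $ s $ a)" by (simp add: linear_iff cmat_add cmat_scaleR)
  then show ?thesis by (rule linear_sum)
qed

lemma sum_UNIV_prod: "(\<Sum>e\<in>UNIV. F e) = (\<Sum>i\<in>(UNIV::'a::finite set). \<Sum>s\<in>(UNIV::'b::finite set). F (i, s))"
  unfolding sum.cartesian_product UNIV_Times_UNIV by (rule sum.cong) auto

text \<open>The complex coordinates of U: left multiplication by quaternionic matrices acts on the index e, which is an index of E, and
right multiplication by quaternions on the index a, which is an index of H.\<close>

definition hat :: "'m::finite Usp \<Rightarrow> 'm \<times> 2 \<Rightarrow> 2 \<Rightarrow> complex"
  where "hat x e a = cmat (x $ fst e) $ snd e $ a"

lemma hat_add: "hat (x + y) e a = hat x e a + hat y e a" and hat_scaleR: "hat (r *\<^sub>R x) e a = r *\<^sub>R hat x e a"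
  by (simp_all add: hat_def cmat_add cmat_scaleR)

lemma hat_rmulU: "hat (rmulU x q) e a = (\<Sum>b\<in>UNIV. hat x e b * cmat q $ b $ a)"
  by (simp add: hat_def cmat_mult)

lemma hat_qmatvec: "hat (qmatvec X x) e a = (\<Sum>g\<in>UNIV. cmatE X e g * hat x g a)"
  by (simp add: hat_def qmatvec_def cmat_sum cmat_mult sum_UNIV_prod cmatE_def)

text \<open>The real linear, complex valued form on U with coordinates N.\<close>

definition lform :: "('m::finite \<times> 2 \<Rightarrow> 2 \<Rightarrow> complex) \<Rightarrow> 'm Usp \<Rightarrow> complex"
  where "lform N x = (\<Sum>e\<in>UNIV. \<Sum>a\<in>UNIV. hat x e a * N e a)"

lemma lform_add_right: "lform N (x + y) = lform N x + lform N y" and lform_scaleR_right: "lform N (r *\<^sub>R x) = r *\<^sub>R lform N x"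
  by (simp_all add: lform_def hat_add hat_scaleR sum.distrib algebra_simps scaleR_sum_right)

lemma lform_linear: "linear (lform N)"
  by (simp add: linear_iff lform_add_right lform_scaleR_right)

lemma lform_add: "lform (\<lambda>e a. N e a + N' e a) x = lform N x + lform N' x"
  and lform_mult: "lform (\<lambda>e a. z * N e a) x = z * lform N x"
  by (simp_all add: lform_def sum.distrib algebra_simps sum_distrib_left)

lemma sum_adjoint:
  fixes h n :: "'a::finite \<Rightarrow> complex"
  shows "(\<Sum>e\<in>UNIV. (\<Sum>g\<in>UNIV. X e g * h g) * n e) = (\<Sum>e\<in>UNIV. h e * (\<Sum>g\<in>UNIV. X g e * n g))"
proof -
  have "(\<Sum>e\<in>UNIV. (\<Sum>g\<in>UNIV. X e g * h g) * n e) = (\<Sum>e\<in>UNIV. \<Sum>g\<in>UNIV. X e g * h g * n e)"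
    by (simp add: sum_distrib_right)
  also have "\<dots> = (\<Sum>g\<in>UNIV. \<Sum>e\<in>UNIV. X e g * h g * n e)" by (rule sum.swap)
  also have "\<dots> = (\<Sum>e\<in>UNIV. h e * (\<Sum>g\<in>UNIV. X g e * n g))" by (simp add: sum_distrib_left mult_ac)
  finally show ?thesis .
qed

lemma lform_qmatvec: "lform N (qmatvec X x) = lform (\<lambda>e a. \<Sum>g\<in>UNIV. cmatE X g e * N g a) x"
  by (simp only: lform_def sum_2 sum.distrib hat_qmatvec sum_adjoint)

lemma lform_rmulU: "lform N (rmulU x q) = lform (\<lambda>e a. \<Sum>b\<in>UNIV. cmat q $ a $ b * N e b) x"
  unfolding lform_def by (rule sum.cong[OF refl]) (simp add: hat_rmulU sum_2 algebra_simps)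

text \<open>In the complexification of H, \<open>1/2 (unit1 s a - \<i> unit2 s a)\<close> is the element that \<open>cmat\<close> maps to the elementary matrix with entry
1 at position \<open>(s, a)\<close>.\<close>

definition unit1 :: "2 \<Rightarrow> 2 \<Rightarrow> quat"
  where "unit1 s a = (if s = a then q1 else if s = 1 then im (ax 2) else - im (ax 2))"

definition unit2 :: "2 \<Rightarrow> 2 \<Rightarrow> quat"
  where "unit2 s a = (if s \<noteq> a then im (ax 3) else if s = 1 then im (ax 1) else - im (ax 1))"

text \<open>The value of the complex linear extension of f on the elementary matrices, that is, the coordinates of f.\<close>

definition dual_coeff :: "('m::finite Usp \<Rightarrow> complex) \<Rightarrow> 'm \<times> 2 \<Rightarrow> 2 \<Rightarrow> complex"
  where "dual_coeff f e a = (f (axis (fst e) (unit1 (snd e) a)) - \<i> * f (axis (fst e) (unit2 (snd e) a))) / 2"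

lemma axis_linear: "axis i (x + y) = axis i x + (axis i y :: 'a::real_vector^'n)" "axis i (r *\<^sub>R x) = r *\<^sub>R (axis i x :: 'a^'n)"
  "axis i (- x) = - (axis i x :: 'a^'n)"
  by (simp_all add: vec_eq_iff axis_def)

lemma vec_axis_sum: "x = (\<Sum>i\<in>UNIV. axis i (x $ i))" for x :: "'a::real_vector^'n::finite"
  by (simp add: vec_eq_iff axis_def sum_component)

lemma lform_dual_coeff:
  assumes "linear f" shows "lform (dual_coeff f) x = f x"
proof -
  have q: "f (axis i q) = (\<Sum>s\<in>UNIV. \<Sum>a\<in>UNIV. cmat q $ s $ a * dual_coeff f (i, s) a)" for i q
  proof -
    have "f (axis i (a *\<^sub>R q1 + b *\<^sub>R im (ax 1) + c *\<^sub>R im (ax 2) + d *\<^sub>R im (ax 3))) =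
      a *\<^sub>R f (axis i q1) + b *\<^sub>R f (axis i (im (ax 1))) + c *\<^sub>R f (axis i (im (ax 2))) + d *\<^sub>R f (axis i (im (ax 3)))" for a b c d
      by (simp only: axis_linear linear_add[OF assms] linear_cmul[OF assms])
    from this[of "fst q" "snd q $ 1" "snd q $ 2" "snd q $ 3", unfolded quat_basis[symmetric]]
    show ?thesis
      by (simp add: sum_2 cmat_entries dual_coeff_def unit1_def unit2_def axis_linear linear_neg[OF assms] complex_eq_iff field_simps)
  qed
  have "f x = (\<Sum>i\<in>UNIV. f (axis i (x $ i)))"
    by (subst vec_axis_sum[of x]) (rule linear_sum[OF assms])
  then show ?thesis by (simp add: q lform_def sum_UNIV_prod hat_def)
qed

lemma dual_coeff_hat: "dual_coeff (\<lambda>x. hat x g b) e a = (if g = e \<and> b = a then 1 else 0)"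
  using exhaust_2[of "snd g"] exhaust_2[of "snd e"] exhaust_2[of a] exhaust_2[of b]
  by (auto simp: dual_coeff_def hat_def axis_def unit1_def unit2_def cmat_entries complex_eq_iff prod_eq_iff)

lemma dual_coeff_lin: "dual_coeff (lform N) e a = N e a"
proof -
  have "dual_coeff (lform N) e a = (\<Sum>g\<in>UNIV. \<Sum>b\<in>UNIV. dual_coeff (\<lambda>x. hat x g b) e a * N g b)"
    by (simp add: dual_coeff_def lform_def sum_distrib_left sum_divide_distrib sum_subtractf[symmetric] algebra_simps diff_divide_distrib
        flip: sum_subtractf)
  also have "\<dots> = (\<Sum>g\<in>UNIV. \<Sum>b\<in>UNIV. if b = a then if g = e then N g b else 0 else 0)"
    by (intro sum.cong refl) (simp add: dual_coeff_hat)
  finally show ?thesis by simp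
qed

type_synonym 'm form_coord = "'m \<times> 2 \<Rightarrow> 'm \<times> 2 \<Rightarrow> 2 \<Rightarrow> 2 \<Rightarrow> complex"

text \<open>The real bilinear, complex valued form on U with coordinates M.\<close>

definition bform :: "'m::finite form_coord \<Rightarrow> 'm Usp \<Rightarrow> 'm Usp \<Rightarrow> complex"
  where "bform M x y = lform (\<lambda>e a. lform (\<lambda>f b. M e f a b) y) x"

lemma bform_swap: "bform M x y = lform (\<lambda>f b. lform (\<lambda>e a. M e f a b) x) y"
proof -
  have "bform M x y = (\<Sum>e\<in>UNIV. \<Sum>f\<in>UNIV. \<Sum>a\<in>UNIV. \<Sum>b\<in>UNIV. hat x e a * hat y f b * M e f a b)"
    unfolding bform_def lform_def sum_distrib_left
    by (rule sum.cong[OF refl]) (subst sum.swap, simp add: mult.assoc)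
  also have "\<dots> = (\<Sum>f\<in>UNIV. \<Sum>e\<in>UNIV. \<Sum>a\<in>UNIV. \<Sum>b\<in>UNIV. hat x e a * hat y f b * M e f a b)"
    by (rule sum.swap)
  also have "\<dots> = lform (\<lambda>f b. lform (\<lambda>e a. M e f a b) x) y"
    unfolding lform_def sum_distrib_left
    by (rule sum.cong[OF refl]) (simp add: sum_2 sum.distrib mult_ac)
  finally show ?thesis .
qed

lemma bform_flip: "bform M y x = bform (\<lambda>e f a b. M f e b a) x y"
  unfolding bform_swap[of M] unfolding bform_def ..

lemma bform_bilinear: "bilinear (bform M)"
proof -
  have "(\<lambda>x. bform M x y) = lform (\<lambda>e a. lform (\<lambda>f b. M e f a b) y)" for y by (rule ext) (rule bform_def)
  moreover have "bform M x = lform (\<lambda>f b. lform (\<lambda>e a. M e f a b) x)" for x by (rule ext) (rule bform_swap)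
  ultimately show ?thesis unfolding bilinear_def by (simp only: lform_linear simp_thms)
qed

lemma bform_add: "bform (\<lambda>e f a b. M e f a b + M' e f a b) x y = bform M x y + bform M' x y"
  and bform_mult: "bform (\<lambda>e f a b. z * M e f a b) x y = z * bform M x y"
  by (simp_all add: bform_def lform_add lform_mult)

lemma bform_uminus: "bform (\<lambda>e f a b. - M e f a b) x y = - bform M x y"
  using bform_mult[of "-1" M] by simp

lemma bform_diff: "bform (\<lambda>e f a b. M e f a b - M' e f a b) x y = bform M x y - bform M' x y"
  using bform_add[of M "\<lambda>e f a b. - M' e f a b" x y] by (simp add: bform_uminus)

lemma bform_qmatvec:
  "bform M (qmatvec X x) y = bform (\<lambda>e f a b. \<Sum>g\<in>UNIV. cmatE X g e * M g f a b) x y"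
  "bform M x (qmatvec X y) = bform (\<lambda>e f a b. \<Sum>g\<in>UNIV. cmatE X g f * M e g a b) x y"
proof -
  show "bform M x (qmatvec X y) = bform (\<lambda>e f a b. \<Sum>g\<in>UNIV. cmatE X g f * M e g a b) x y"
    by (simp only: bform_def lform_qmatvec)
  show "bform M (qmatvec X x) y = bform (\<lambda>e f a b. \<Sum>g\<in>UNIV. cmatE X g e * M g f a b) x y"
    by (simp only: bform_swap lform_qmatvec)
qed

lemma bform_rmulU:
  "bform M (rmulU x q) y = bform (\<lambda>e f a b. \<Sum>c\<in>UNIV. cmat q $ a $ c * M e f c b) x y"
  "bform M x (rmulU y q) = bform (\<lambda>e f a b. \<Sum>c\<in>UNIV. cmat q $ b $ c * M e f a c) x y"
proof -
  show "bform M x (rmulU y q) = bform (\<lambda>e f a b. \<Sum>c\<in>UNIV. cmat q $ b $ c * M e f a c) x y"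
    by (simp only: bform_def lform_rmulU)
  show "bform M (rmulU x q) y = bform (\<lambda>e f a b. \<Sum>c\<in>UNIV. cmat q $ a $ c * M e f c b) x y"
    by (simp only: bform_swap lform_rmulU)
qed

definition form_coeff :: "('m::finite Usp \<Rightarrow> 'm Usp \<Rightarrow> complex) \<Rightarrow> 'm form_coord"
  where "form_coeff F e f a b = dual_coeff (\<lambda>x. dual_coeff (\<lambda>y. F x y) f b) e a"

lemma linear_dual_coeff:
  assumes "\<And>y. linear (\<lambda>x. F x y)" shows "linear (\<lambda>x. dual_coeff (F x) f b)"
  using assms by (simp add: linear_iff dual_coeff_def algebra_simps add_divide_distrib diff_divide_distrib scaleR_conv_of_real)

lemma bform_form_coeff:
  assumes "bilinear F" shows "bform (form_coeff F) x y = F x y"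
proof -
  have l: "linear (\<lambda>x. F x y)" "linear (F x)" for x y using assms by (simp_all add: bilinear_def)
  have "bform (form_coeff F) x y = lform (\<lambda>f b. lform (\<lambda>e a. form_coeff F e f a b) x) y" by (rule bform_swap)
  also have "\<dots> = lform (dual_coeff (F x)) y"
  proof -
    have "lform (dual_coeff (\<lambda>x. dual_coeff (F x) f b)) x = dual_coeff (F x) f b" for f b
      by (rule lform_dual_coeff[OF linear_dual_coeff[OF l(1)]])
    then show ?thesis by (simp only: form_coeff_def)
  qed
  also have "\<dots> = F x y" by (rule lform_dual_coeff[OF l(2)])
  finally show ?thesis .
qed

lemma form_coeff_bform: "form_coeff (bform M) = M"
  by (intro ext) (simp add: form_coeff_def bform_swap dual_coeff_lin)

section \<open>Tensors with four H-indices\<close>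

text \<open>The invariant symplectic form of \<open>H = C\<^sup>2\<close>.\<close>

definition sympl :: "2 \<Rightarrow> 2 \<Rightarrow> complex"
  where "sympl a b = (if a = b then 0 else if a = 1 then 1 else -1)"

text \<open>The isomorphism between the complexification of Im H and \<open>S\<^sup>2H\<close>: lowering an index of an imaginary unit with the
symplectic form makes it a symmetric matrix.\<close>

definition imH_sympl :: "3 \<Rightarrow> 2 \<Rightarrow> 2 \<Rightarrow> complex"
  where "imH_sympl k c d = (\<Sum>b\<in>UNIV. sympl c b * cmat (im (ax k)) $ b $ d)"

text \<open>The last two H-indices of T stand for the value of the bracket in Im H, the first two for the H-indices of its arguments.\<close>

definition contract :: "'m::finite EHtensor \<Rightarrow> 3 \<Rightarrow> 'm form_coord"
  where "contract T k e f a b = (\<Sum>c\<in>UNIV. \<Sum>d\<in>UNIV. imH_sympl k c d * T e f [a, b, c, d])"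

definition bracket_of :: "'m::finite EHtensor \<Rightarrow> 'm ctensor"
  where "bracket_of T x y = (\<chi> k. bform (contract T k) x y)"

lemma contract_simps:
  "contract T 1 e f a b = - \<i> * (T e f [a, b, 1, 2] + T e f [a, b, 2, 1])"
  "contract T 2 e f a b = - (T e f [a, b, 1, 1] + T e f [a, b, 2, 2])"
  "contract T 3 e f a b = \<i> * (T e f [a, b, 1, 1] - T e f [a, b, 2, 2])"
  by (simp_all add: contract_def imH_sympl_def sum_2 cmat_entries sympl_def algebra_simps)

lemma levi_ImH_eq: "levi_ImH X \<xi> v = 2 *\<^sub>R cross3 \<xi> v"
  by (simp add: levi_ImH_def levi_def rmulV_def vec_eq_iff forall_3 cross3_def)

lemma levi_U_eq: "levi_U X \<xi> x = qmatvec X x - rmulU x (im \<xi>)"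
  by (simp add: levi_U_def levi_def)

lemma complexify_levi:
  "complexify_map (levi_ImH X \<xi>) z $ 1 = 2 * (of_real (\<xi> $ 2) * z $ 3 - of_real (\<xi> $ 3) * z $ 2)"
  "complexify_map (levi_ImH X \<xi>) z $ 2 = 2 * (of_real (\<xi> $ 3) * z $ 1 - of_real (\<xi> $ 1) * z $ 3)"
  "complexify_map (levi_ImH X \<xi>) z $ 3 = 2 * (of_real (\<xi> $ 1) * z $ 2 - of_real (\<xi> $ 2) * z $ 1)"
  by (simp_all add: complexify_map_def levi_ImH_eq cross3_def complex_eq_iff)

lemma act_EH_4:
  "act_EH X \<xi> T e f [a, b, c, d] = - (\<Sum>g\<in>UNIV. cmatE X g e * T g f [a, b, c, d]) - (\<Sum>g\<in>UNIV. cmatE X g f * T e g [a, b, c, d])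
    + (\<Sum>i\<in>UNIV. cmat (im \<xi>) $ a $ i * T e f [i, b, c, d]) + (\<Sum>i\<in>UNIV. cmat (im \<xi>) $ b $ i * T e f [a, i, c, d])
    + (\<Sum>i\<in>UNIV. cmat (im \<xi>) $ c $ i * T e f [a, b, i, d]) + (\<Sum>i\<in>UNIV. cmat (im \<xi>) $ d $ i * T e f [a, b, c, i])"
  by (simp add: act_EH_def numeral_eq_Suc lessThan_Suc)

lemma act_EH_2:
  "act_EH X \<xi> T e f [a, b] = - (\<Sum>g\<in>UNIV. cmatE X g e * T g f [a, b]) - (\<Sum>g\<in>UNIV. cmatE X g f * T e g [a, b])
    + (\<Sum>i\<in>UNIV. cmat (im \<xi>) $ a $ i * T e f [i, b]) + (\<Sum>i\<in>UNIV. cmat (im \<xi>) $ b $ i * T e f [a, i])"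
  by (simp add: act_EH_def numeral_eq_Suc lessThan_Suc)

lemma act_EH_0:
  "act_EH X \<xi> T e f [] = - (\<Sum>g\<in>UNIV. cmatE X g e * T g f []) - (\<Sum>g\<in>UNIV. cmatE X g f * T e g [])"
  by (simp add: act_EH_def)

text \<open>The action of the Levi factor on the coordinates of bilinear forms.\<close>

definition coeff_act ::
    "quat^'m^'m \<Rightarrow> real^3 \<Rightarrow> 'm::finite form_coord \<Rightarrow> 'm form_coord"
  where "coeff_act X \<xi> M e f a b =
    - (\<Sum>g\<in>UNIV. cmatE X g e * M g f a b) - (\<Sum>g\<in>UNIV. cmatE X g f * M e g a b)
    + (\<Sum>i\<in>UNIV. cmat (im \<xi>) $ a $ i * M e f i b) + (\<Sum>i\<in>UNIV. cmat (im \<xi>) $ b $ i * M e f a i)"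

lemma bform_coeff_act: "bform (coeff_act X \<xi> M) x y = - bform M (levi_U X \<xi> x) y - bform M x (levi_U X \<xi> y)"
proof -
  have "bform (\<lambda>e f a b. - P e f a b - Q e f a b + R e f a b + S e f a b) x y
    = - bform P x y - bform Q x y + bform R x y + bform S x y" for P Q R S
    by (simp only: bform_add bform_diff bform_uminus)
  then show ?thesis
    unfolding coeff_act_def[abs_def] levi_U_eq bilinear_rsub[OF bform_bilinear] bilinear_lsub[OF bform_bilinear] bform_qmatvec bform_rmulU
    by simp
qed

text \<open>The terms of the action on the last two H-indices turn into the rotation action of \<open>\<xi>\<close> on Im H, since \<open>imH_sympl\<close> is equivariant.\<close>

lemma contract_act:
  fixes T :: "'m::finite EHtensor"
  shows "contract (act_EH X \<xi> T) 1 e f a b = coeff_act X \<xi> (contract T 1) e f a b + 2 * (of_real (\<xi> $ 2) * contract T 3 e f a b - of_real (\<xi> $ 3) * contract T 2 e f a b)"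
    "contract (act_EH X \<xi> T) 2 e f a b = coeff_act X \<xi> (contract T 2) e f a b + 2 * (of_real (\<xi> $ 3) * contract T 1 e f a b - of_real (\<xi> $ 1) * contract T 3 e f a b)"
    "contract (act_EH X \<xi> T) 3 e f a b = coeff_act X \<xi> (contract T 3) e f a b + 2 * (of_real (\<xi> $ 1) * contract T 2 e f a b - of_real (\<xi> $ 2) * contract T 1 e f a b)"
proof -
  have s: "(\<Sum>g\<in>UNIV. X g * (u * (T g + T' g))) = u * ((\<Sum>g\<in>UNIV. X g * T g) + (\<Sum>g\<in>UNIV. X g * T' g))"
    "(\<Sum>g\<in>UNIV. X g * (u * (T g - T' g))) = u * ((\<Sum>g\<in>UNIV. X g * T g) - (\<Sum>g\<in>UNIV. X g * T' g))"
    "(\<Sum>g\<in>UNIV. X g * (- (T g + T' g))) = - ((\<Sum>g\<in>UNIV. X g * T g) + (\<Sum>g\<in>UNIV. X g * T' g))"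
    for X T T' :: "'m \<times> 2 \<Rightarrow> complex" and u
    by (simp_all add: algebra_simps sum.distrib sum_subtractf sum_distrib_left sum_negf)
  show "contract (act_EH X \<xi> T) 1 e f a b = coeff_act X \<xi> (contract T 1) e f a b + 2 * (of_real (\<xi> $ 2) * contract T 3 e f a b - of_real (\<xi> $ 3) * contract T 2 e f a b)"
    unfolding coeff_act_def contract_simps act_EH_4 s by (simp add: sum_2 cmat_entries algebra_simps)
  show "contract (act_EH X \<xi> T) 2 e f a b = coeff_act X \<xi> (contract T 2) e f a b + 2 * (of_real (\<xi> $ 3) * contract T 1 e f a b - of_real (\<xi> $ 1) * contract T 3 e f a b)"
    unfolding coeff_act_def contract_simps act_EH_4 s by (simp add: sum_2 cmat_entries algebra_simps)
  show "contract (act_EH X \<xi> T) 3 e f a b = coeff_act X \<xi> (contract T 3) e f a b + 2 * (of_real (\<xi> $ 1) * contract T 2 e f a b - of_real (\<xi> $ 2) * contract T 1 e f a b)"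
    unfolding coeff_act_def contract_simps act_EH_4 s by (simp add: sum_2 cmat_entries algebra_simps)
qed

lemma bracket_of_act:
  fixes T :: "'m::finite EHtensor"
  shows "bracket_of (act_EH X \<xi> T) = act_ctensor X \<xi> (bracket_of T)"
proof (intro ext)
  fix x y :: "'m Usp"
  have ev3: "bform (\<lambda>e f a b. P e f a b + 2 * (u * M e f a b - v * N e f a b)) x y = bform P x y + 2 * (u * bform M x y - v * bform N x y)" for P M N :: "'m form_coord" and u v
    by (simp only: bform_add bform_mult bform_diff)
  show "bracket_of (act_EH X \<xi> T) x y = act_ctensor X \<xi> (bracket_of T) x y"
    unfolding vec_eq_iff forall_3 act_ctensor_def bracket_of_def vector_minus_component complexify_levi
    by (simp only: vec_lambda_beta contract_act[abs_def] ev3 bform_coeff_act) (simp add: algebra_simps)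
qed

lemma EH_moduleD:
  assumes "t \<in> EH_module \<epsilon> k"
  shows "t f e l = \<epsilon> * t e f l" "mset l' = mset l \<Longrightarrow> t e f l' = t e f l" "length l \<noteq> k \<Longrightarrow> t e f l = 0"
  using assms unfolding EH_module_def by blast+

lemma EH_moduleI:
  assumes "\<And>e f l. t f e l = \<epsilon> * t e f l" "\<And>e f l l'. mset l' = mset l \<Longrightarrow> t e f l' = t e f l" "\<And>e f l. length l \<noteq> k \<Longrightarrow> t e f l = 0"
  shows "t \<in> EH_module \<epsilon> k"
  unfolding EH_module_def using assms by blast

text \<open>Replacing an entry of a list changes its multiset in a way that depends only on the entry, so the sum is a sum over the multiset
of entries. This is why the action preserves symmetric tensors.\<close>

lemma sum_replace_entry_mset:
  fixes F :: "'i::finite list \<Rightarrow> complex"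
  assumes F: "\<And>l l'. mset l' = mset l \<Longrightarrow> F l' = F l" and l: "mset l' = mset l"
  shows "(\<Sum>p<length l'. \<Sum>b\<in>UNIV. c (l' ! p) b * F (l'[p := b])) = (\<Sum>p<length l. \<Sum>b\<in>UNIV. c (l ! p) b * F (l[p := b]))"
proof -
  define G where "G x = (\<Sum>b\<in>UNIV. c x b * F (SOME m. mset m = add_mset b (mset l - {#x#})))" for x
  have *: "(\<Sum>p<length m. \<Sum>b\<in>UNIV. c (m ! p) b * F (m[p := b])) = sum_mset (image_mset G (mset l))" if m: "mset m = mset l" for m
  proof -
    have "c (m ! p) b * F (m[p := b]) = c (m ! p) b * F (SOME m'. mset m' = add_mset b (mset l - {#m ! p#}))" if "p < length m" for p b
    proof -
      have "mset (m[p := b]) = add_mset b (mset l - {#m ! p#})" using mset_update[OF that, of b] m by simp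
      moreover from this have "mset (SOME m'. mset m' = add_mset b (mset l - {#m ! p#})) = add_mset b (mset l - {#m ! p#})"
        by (rule someI)
      ultimately show ?thesis using F by metis
    qed
    then have "(\<Sum>p<length m. \<Sum>b\<in>UNIV. c (m ! p) b * F (m[p := b])) = (\<Sum>p<length m. G (m ! p))"
      unfolding G_def by (intro sum.cong refl) simp
    also have "\<dots> = sum_list (map G m)" by (simp add: sum_list_sum_nth atLeast0LessThan)
    also have "\<dots> = sum_mset (image_mset G (mset m))" by (simp flip: sum_mset_sum_list)
    finally show ?thesis unfolding m .
  qed
  show ?thesis unfolding *[OF l] *[OF refl] ..
qed

lemma act_EH_module:
  assumes t: "t \<in> EH_module \<epsilon> k" shows "act_EH X \<xi> t \<in> EH_module \<epsilon> k"
proof (rule EH_moduleI)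
  note sw = EH_moduleD(1)[OF t] and ms = EH_moduleD(2)[OF t] and ln = EH_moduleD(3)[OF t]
  show "act_EH X \<xi> t f e l = \<epsilon> * act_EH X \<xi> t e f l" for e f l
  proof -
    have "(\<Sum>g\<in>UNIV. cmatE X g f * t g e l) = \<epsilon> * (\<Sum>g\<in>UNIV. cmatE X g f * t e g l)"
      unfolding sum_distrib_left by (rule sum.cong[OF refl]) (subst sw, simp add: mult_ac)
    moreover have "(\<Sum>g\<in>UNIV. cmatE X g e * t f g l) = \<epsilon> * (\<Sum>g\<in>UNIV. cmatE X g e * t g f l)"
      unfolding sum_distrib_left by (rule sum.cong[OF refl]) (subst sw, simp add: mult_ac)
    moreover have "(\<Sum>p<length l. \<Sum>b\<in>UNIV. cmat (im \<xi>) $ (l ! p) $ b * t f e (l[p := b])) =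
        \<epsilon> * (\<Sum>p<length l. \<Sum>b\<in>UNIV. cmat (im \<xi>) $ (l ! p) $ b * t e f (l[p := b]))"
      unfolding sum_distrib_left by (intro sum.cong[OF refl]) (subst sw, simp add: mult_ac)
    ultimately show ?thesis unfolding act_EH_def by (simp add: algebra_simps)
  qed
  show "act_EH X \<xi> t e f l' = act_EH X \<xi> t e f l" if l: "mset l' = mset l" for e f l l'
    unfolding act_EH_def ms[OF l]
    using sum_replace_entry_mset[of "t e f" l' l "\<lambda>a b. cmat (im \<xi>) $ a $ b", OF ms l] by simp
  show "act_EH X \<xi> t e f l = 0" if "length l \<noteq> k" for e f l
    using that by (simp add: act_EH_def ln)
qed

lemma EH_module_add:
  assumes t: "t \<in> EH_module \<epsilon> k" and t': "t' \<in> EH_module \<epsilon> k"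
  shows "(\<lambda>e f l. t e f l + t' e f l) \<in> EH_module \<epsilon> k"
proof (rule EH_moduleI)
  show "t f e l + t' f e l = \<epsilon> * (t e f l + t' e f l)" for e f l
    using EH_moduleD(1)[OF t, of f e l] EH_moduleD(1)[OF t', of f e l] by (simp add: algebra_simps)
  show "t e f l' + t' e f l' = t e f l + t' e f l" if "mset l' = mset l" for e f l l'
    using EH_moduleD(2)[OF t that] EH_moduleD(2)[OF t' that] by simp
  show "t e f l + t' e f l = 0" if "length l \<noteq> k" for e f l
    using EH_moduleD(3)[OF t that] EH_moduleD(3)[OF t' that] by simp
qed

lemma EH_module_mult:
  assumes t: "t \<in> EH_module \<epsilon> k"
  shows "(\<lambda>e f l. z * t e f l) \<in> EH_module \<epsilon> k"
proof (rule EH_moduleI)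
  show "z * t f e l = \<epsilon> * (z * t e f l)" for e f l using EH_moduleD(1)[OF t, of f e l] by simp
  show "z * t e f l' = z * t e f l" if "mset l' = mset l" for e f l l' using EH_moduleD(2)[OF t that] by simp
  show "z * t e f l = 0" if "length l \<noteq> k" for e f l using EH_moduleD(3)[OF t that] by simp
qed

lemma EH_module_zero: "(\<lambda>e f l. 0) \<in> EH_module \<epsilon> k"
  unfolding EH_module_def by simp

lemma bracket_of_add: "bracket_of (\<lambda>e f l. T e f l + T' e f l) = (\<lambda>x y. bracket_of T x y + bracket_of T' x y)"
proof -
  have c: "contract (\<lambda>e f l. T e f l + T' e f l) k = (\<lambda>e f a b. contract T k e f a b + contract T' k e f a b)" for k
    by (simp add: contract_def fun_eq_iff sum_2 algebra_simps)
  show ?thesis by (intro ext) (simp add: bracket_of_def vec_eq_iff c bform_add)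
qed

lemma bracket_of_mult: "bracket_of (\<lambda>e f l. z * T e f l) = (\<lambda>x y. z *s bracket_of T x y)"
proof -
  have c: "contract (\<lambda>e f l. z * T e f l) k = (\<lambda>e f a b. z * contract T k e f a b)" for k
    by (simp add: contract_def fun_eq_iff sum_2 algebra_simps)
  show ?thesis by (intro ext) (simp add: bracket_of_def vec_eq_iff c bform_mult)
qed

lemma bracket_of_cong:
  assumes "\<And>e f a b c d. T e f [a, b, c, d] = T' e f [a, b, c, d]"
  shows "bracket_of T = bracket_of T'"
proof -
  have c: "contract T = contract T'" by (intro ext) (simp only: contract_def assms)
  show ?thesis by (intro ext) (simp only: bracket_of_def c)
qed

lemma bracket_of_bilinear: "bilinear (bracket_of T)"
proof -
  note b = bform_bilinear
  show ?thesis unfolding bilinear_def bracket_of_def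
    by (simp add: linear_iff vec_eq_iff bilinear_ladd[OF b] bilinear_radd[OF b] bilinear_lmul[OF b] bilinear_rmul[OF b])
qed

lemma bracket_of_ctensor:
  assumes "\<And>e f a b c d. T f e [b, a, c, d] = - T e f [a, b, c, d]"
  shows "bracket_of T \<in> ctensors"
proof -
  have "bracket_of T x x = 0" for x
  proof -
    have "bform (contract T k) x x = - bform (contract T k) x x" for k
    proof -
      have *: "contract T k f e b a = - contract T k e f a b" for e f a b by (simp add: contract_def sum_2 assms[of f e b a])
      have "bform (contract T k) x x = bform (\<lambda>e f a b. contract T k f e b a) x x" by (rule bform_flip)
      also have "\<dots> = bform (\<lambda>e f a b. - contract T k e f a b) x x" by (subst *) (rule refl)
      finally show ?thesis unfolding bform_uminus .
    qed
    then have "bform (contract T k) x x = 0" for k by (simp only: eq_neg_iff_add_eq_0) simp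
    then show ?thesis by (simp add: bracket_of_def vec_eq_iff)
  qed
  then show ?thesis unfolding ctensors_def using bracket_of_bilinear by blast
qed

lemma bracket_of_eq_0D:
  assumes "bracket_of T = (\<lambda>x y. 0)" and "\<And>e f a b c d. T e f [a, b, d, c] = T e f [a, b, c, d]"
  shows "T e f [a, b, c, d] = 0"
proof -
  have "bform (contract T k) x y = 0" for k x y using fun_cong[OF fun_cong[OF assms(1), of x], of y] by (simp add: bracket_of_def vec_eq_iff)
  then have "form_coeff (bform (contract T k)) e f a b = 0" for k by (simp add: form_coeff_def dual_coeff_def)
  then have z: "contract T k e f a b = 0" for k by (simp add: form_coeff_bform)
  show ?thesis using z[of 1] z[of 2] z[of 3] assms(2)[of e f a b 2 1] exhaust_2[of c] exhaust_2[of d]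
    by (auto simp: contract_simps eq_neg_iff_add_eq_0)
qed

text \<open>A way to write the tensors of \<open>EH_module \<epsilon> k\<close> with four H-indices, such that the result is the coordinate tensor of a bracket.
Only the values on lists of length four matter.\<close>

definition embedding :: "complex \<Rightarrow> nat \<Rightarrow> ('m::finite EHtensor \<Rightarrow> 'm EHtensor) \<Rightarrow> bool"
  where "embedding \<epsilon> k \<iota> \<longleftrightarrow>
    (\<forall>t t'. \<iota> (\<lambda>e f l. t e f l + t' e f l) = (\<lambda>e f l. \<iota> t e f l + \<iota> t' e f l)) \<and>
    (\<forall>z t. \<iota> (\<lambda>e f l. z * t e f l) = (\<lambda>e f l. z * \<iota> t e f l)) \<and>
    (\<forall>X \<xi> t e f a b c d. \<iota> (act_EH X \<xi> t) e f [a, b, c, d] = act_EH X \<xi> (\<iota> t) e f [a, b, c, d]) \<and>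
    (\<forall>t\<in>EH_module \<epsilon> k. \<forall>e f a b c d. \<iota> t f e [b, a, c, d] = - \<iota> t e f [a, b, c, d] \<and> \<iota> t e f [a, b, d, c] = \<iota> t e f [a, b, c, d]) \<and>
    (\<forall>t\<in>EH_module \<epsilon> k. (\<forall>e f a b c d. \<iota> t e f [a, b, c, d] = 0) \<longrightarrow> t = (\<lambda>e f l. 0))"

lemma embeddingI:
  assumes "\<And>t t'. \<iota> (\<lambda>e f l. t e f l + t' e f l) = (\<lambda>e f l. \<iota> t e f l + \<iota> t' e f l)"
    and "\<And>z t. \<iota> (\<lambda>e f l. z * t e f l) = (\<lambda>e f l. z * \<iota> t e f l)"
    and "\<And>X \<xi> t e f a b c d. \<iota> (act_EH X \<xi> t) e f [a, b, c, d] = act_EH X \<xi> (\<iota> t) e f [a, b, c, d]"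
    and "\<And>t e f a b c d. t \<in> EH_module \<epsilon> k \<Longrightarrow> \<iota> t f e [b, a, c, d] = - \<iota> t e f [a, b, c, d]"
    and "\<And>t e f a b c d. t \<in> EH_module \<epsilon> k \<Longrightarrow> \<iota> t e f [a, b, d, c] = \<iota> t e f [a, b, c, d]"
    and "\<And>t. t \<in> EH_module \<epsilon> k \<Longrightarrow> \<forall>e f a b c d. \<iota> t e f [a, b, c, d] = 0 \<Longrightarrow> t = (\<lambda>e f l. 0)"
  shows "embedding \<epsilon> k \<iota>"
  unfolding embedding_def
proof (intro conjI allI ballI impI)
qed (rule assms; assumption)+

text \<open>The image under an embedding is a submodule of the given type, because passing from coordinates to brackets is equivariant and
injective on the tensors that are symmetric in the last two indices.\<close>

lemma embedding_iso:
  fixes \<iota> :: "'m::finite EHtensor \<Rightarrow> 'm EHtensor"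
  assumes "embedding \<epsilon> k \<iota>"
  defines "\<phi> \<equiv> \<lambda>t. bracket_of (\<iota> t)"
  shows "module_iso \<phi> (EH_module \<epsilon> k) (\<phi> ` EH_module \<epsilon> k)" and "submodule (\<phi> ` EH_module \<epsilon> k)"
proof -
  note emb = assms(1)[unfolded embedding_def]
  have add: "\<iota> (\<lambda>e f l. t e f l + t' e f l) = (\<lambda>e f l. \<iota> t e f l + \<iota> t' e f l)" for t t'
    by (rule emb[THEN conjunct1, THEN spec, THEN spec])
  have mult: "\<iota> (\<lambda>e f l. z * t e f l) = (\<lambda>e f l. z * \<iota> t e f l)" for t z
    by (rule emb[THEN conjunct2, THEN conjunct1, THEN spec, THEN spec])
  have act: "\<iota> (act_EH X \<xi> t) e f [a, b, c, d] = act_EH X \<xi> (\<iota> t) e f [a, b, c, d]" for t X \<xi> e f a b c d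
    by (rule emb[THEN conjunct2, THEN conjunct2, THEN conjunct1, rule_format])
  have sk: "\<iota> t f e [b, a, c, d] = - \<iota> t e f [a, b, c, d]" if t: "t \<in> EH_module \<epsilon> k" for t e f a b c d
    by (rule emb[THEN conjunct2, THEN conjunct2, THEN conjunct2, THEN conjunct1, rule_format, OF t, THEN conjunct1])
  have sy: "\<iota> t e f [a, b, d, c] = \<iota> t e f [a, b, c, d]" if t: "t \<in> EH_module \<epsilon> k" for t e f a b c d
    by (rule emb[THEN conjunct2, THEN conjunct2, THEN conjunct2, THEN conjunct1, rule_format, OF t, THEN conjunct2])
  have inj0: "t = (\<lambda>e f l. 0)" if t: "t \<in> EH_module \<epsilon> k" and 0: "\<And>e f a b c d. \<iota> t e f [a, b, c, d] = 0" for t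
    by (rule emb[THEN conjunct2, THEN conjunct2, THEN conjunct2, THEN conjunct2, rule_format, OF t]) (rule 0)
  have add': "\<phi> (\<lambda>e f l. t e f l + t' e f l) = (\<lambda>x y. \<phi> t x y + \<phi> t' x y)" for t t' by (simp only: \<phi>_def add bracket_of_add)
  have mult': "\<phi> (\<lambda>e f l. z * t e f l) = (\<lambda>x y. z *s \<phi> t x y)" for z t by (simp only: \<phi>_def mult bracket_of_mult)
  have act': "\<phi> (act_EH X \<xi> t) = act_ctensor X \<xi> (\<phi> t)" for X \<xi> t
    unfolding \<phi>_def bracket_of_act[symmetric] by (rule bracket_of_cong) (rule act)
  have "inj_on \<phi> (EH_module \<epsilon> k)"
  proof (rule inj_onI)
    fix t t' assume t: "t \<in> EH_module \<epsilon> k" "t' \<in> EH_module \<epsilon> k" and eq: "\<phi> t = \<phi> t'"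
    define u where "u = (\<lambda>e f l. t e f l + (-1) * t' e f l)"
    have u: "u \<in> EH_module \<epsilon> k" unfolding u_def by (rule EH_module_add[OF t(1) EH_module_mult[OF t(2)]])
    have "\<phi> u = (\<lambda>x y. 0)" unfolding u_def add' mult' eq by (simp add: fun_eq_iff vec_eq_iff)
    then have "\<iota> u e f [a, b, c, d] = 0" for e f a b c d unfolding \<phi>_def by (rule bracket_of_eq_0D) (rule sy[OF u])
    then have u0: "u = (\<lambda>e f l. 0)" by (rule inj0[OF u])
    show "t = t'"
    proof (intro ext)
      fix e f l
      have "u e f l = 0" by (simp only: u0)
      then show "t e f l = t' e f l" by (simp add: u_def)
    qed
  qed
  then show "module_iso \<phi> (EH_module \<epsilon> k) (\<phi> ` EH_module \<epsilon> k)"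
    unfolding module_iso_def bij_betw_def by (intro conjI ballI allI add' mult' act' refl)
  show "submodule (\<phi> ` EH_module \<epsilon> k)" unfolding submodule_def
  proof (intro conjI ballI allI)
    show "\<phi> ` EH_module \<epsilon> k \<subseteq> ctensors" unfolding \<phi>_def
      by (intro image_subsetI bracket_of_ctensor) (rule sk)
    have z: "\<phi> (\<lambda>e f l. 0) = (\<lambda>x y. 0)" using mult'[of 0 "\<lambda>_ _ _. 0"] by simp
    from imageI[OF EH_module_zero[of \<epsilon> k], of \<phi>] show "(\<lambda>x y. 0) \<in> \<phi> ` EH_module \<epsilon> k" unfolding z .
  next
    fix f g assume "f \<in> \<phi> ` EH_module \<epsilon> k" "g \<in> \<phi> ` EH_module \<epsilon> k"
    then obtain t t' where f: "f = \<phi> t" "t \<in> EH_module \<epsilon> k" and g: "g = \<phi> t'" "t' \<in> EH_module \<epsilon> k" by (elim imageE)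
    from imageI[OF EH_module_add[OF f(2) g(2)], of \<phi>] show "(\<lambda>x y. f x y + g x y) \<in> \<phi> ` EH_module \<epsilon> k"
      unfolding add' f(1) g(1) .
  next
    fix f z assume "f \<in> \<phi> ` EH_module \<epsilon> k"
    then obtain t where f: "f = \<phi> t" "t \<in> EH_module \<epsilon> k" by (elim imageE)
    from imageI[OF EH_module_mult[OF f(2), of z], of \<phi>] show "(\<lambda>x y. z *s f x y) \<in> \<phi> ` EH_module \<epsilon> k"
      unfolding mult' f(1) .
  next
    fix f X \<xi> assume "f \<in> \<phi> ` EH_module \<epsilon> k"
    then obtain t where f: "f = \<phi> t" "t \<in> EH_module \<epsilon> k" by (elim imageE)
    from imageI[OF act_EH_module[OF f(2), of X \<xi>], of \<phi>] show "act_ctensor X \<xi> f \<in> \<phi> ` EH_module \<epsilon> k"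
      unfolding act' f(1) .
  qed
qed

lemma embedding_component:
  assumes "embedding \<epsilon> k \<iota>" "t \<in> EH_module \<epsilon> k" shows "bracket_of (\<iota> t) \<in> component \<epsilon> k"
  unfolding component_def using embedding_iso[OF assms(1)] assms(2) by blast

text \<open>The four embeddings. Missing H-indices are supplied by the symplectic form; the result is then symmetrised in the first pair and
in the last pair of indices, except for \<open>emb_sym\<close>, where the symplectic form fills the first pair and makes it antisymmetric.\<close>

definition emb_S4 :: "'m::finite EHtensor \<Rightarrow> 'm EHtensor"
  where "emb_S4 t = t"

definition emb_sym :: "'m::finite EHtensor \<Rightarrow> 'm EHtensor"
  where "emb_sym t e f l = sympl (l ! 0) (l ! 1) * t e f [l ! 2, l ! 3]"

definition emb_S2 :: "'m::finite EHtensor \<Rightarrow> 'm EHtensor"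
  where "emb_S2 t e f l =
    sympl (l ! 1) (l ! 3) * t e f [l ! 0, l ! 2] + sympl (l ! 1) (l ! 2) * t e f [l ! 0, l ! 3] +
    sympl (l ! 0) (l ! 3) * t e f [l ! 1, l ! 2] + sympl (l ! 0) (l ! 2) * t e f [l ! 1, l ! 3]"

definition emb_S0 :: "'m::finite EHtensor \<Rightarrow> 'm EHtensor"
  where "emb_S0 t e f l = (sympl (l ! 0) (l ! 2) * sympl (l ! 1) (l ! 3) + sympl (l ! 0) (l ! 3) * sympl (l ! 1) (l ! 2)) * t e f []"

lemma sympl_simps [simp]: "sympl 1 1 = 0" "sympl 1 2 = 1" "sympl 2 1 = -1" "sympl 2 2 = 0"
  by (simp_all add: sympl_def)

lemma nth_simps4 [simp]: "[a, b, c, d] ! 2 = c" "[a, b, c, d] ! 3 = d"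
  by (simp_all add: numeral_eq_Suc)

lemma sum_pull:
  fixes X T :: "'a \<Rightarrow> complex"
  shows "(\<Sum>g\<in>A. X g * (u * T g)) = u * (\<Sum>g\<in>A. X g * T g)"
    and "(\<Sum>g\<in>A. X g * (T1 g + T2 g)) = (\<Sum>g\<in>A. X g * T1 g) + (\<Sum>g\<in>A. X g * T2 g)"
  by (simp_all add: algebra_simps sum.distrib sum_distrib_left)

lemma embedding_S4: "embedding (-1) 4 emb_S4"
proof -
  have z: "t = (\<lambda>e f l. 0)" if t: "t \<in> EH_module (-1) 4" and 0: "\<forall>e f a b c d. t e f [a, b, c, d] = 0" for t :: "'m::finite EHtensor"
  proof (intro ext)
    fix e f l
    show "t e f l = 0"
    proof (cases "length l = 4")
      case True
      then obtain a b c d where l: "l = [a, b, c, d]" by (auto simp: numeral_eq_Suc length_Suc_conv)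
      show ?thesis unfolding l by (rule 0[rule_format])
    qed (rule EH_moduleD(3)[OF t])
  qed
  have sk: "t f e [b, a, c, d] = - t e f [a, b, c, d]" and sy: "t e f [a, b, d, c] = t e f [a, b, c, d]" if t: "t \<in> EH_module (-1) 4" for t :: "'m::finite EHtensor" and e f a b c d
    using EH_moduleD(1)[OF t, of f e "[b, a, c, d]"] EH_moduleD(2)[OF t, of "[b, a, c, d]" "[a, b, c, d]" e f]
      EH_moduleD(2)[OF t, of "[a, b, d, c]" "[a, b, c, d]" e f] by (simp_all add: add_mset_commute)
  show ?thesis unfolding emb_S4_def[abs_def]
    by (rule embeddingI) (rule refl | rule sk sy z; assumption)+
qed

lemma EH_module_2_sym: "t \<in> EH_module \<epsilon> 2 \<Longrightarrow> t e f [b, a] = t e f [a, b]"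
  by (rule EH_moduleD(2)) (simp_all add: add_mset_commute)

lemma EH_module_2_zero:
  assumes t: "t \<in> EH_module \<epsilon> 2" and 0: "\<And>e f. t e f [1, 1] = 0" "\<And>e f. t e f [1, 2] = 0" "\<And>e f. t e f [2, 2] = 0"
  shows "t = (\<lambda>e f l. 0)"
proof (intro ext)
  fix e f and l :: "2 list"
  show "t e f l = 0"
  proof (cases "length l = 2")
    case True
    then obtain a b where "l = [a, b]" by (auto simp: numeral_eq_Suc length_Suc_conv)
    then show ?thesis using 0[of e f] EH_module_2_sym[OF t, of e f 1 2] exhaust_2[of a] exhaust_2[of b] by auto
  qed (rule EH_moduleD(3)[OF t])
qed

text \<open>Equivariance of this embedding and of the next two rests on the invariance of the symplectic form, that is, on the fact that the matrices \<open>cmat (im \<xi>)\<close>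
have trace zero.\<close>

lemma embedding_sym: "embedding 1 2 emb_sym"
proof -
  have act: "emb_sym (act_EH X \<xi> t) e f [a, b, c, d] = act_EH X \<xi> (emb_sym t) e f [a, b, c, d]"
    for X :: "quat^'m^'m::finite" and \<xi> t e f a b c d
    unfolding act_EH_4 emb_sym_def act_EH_2 nth_simps4 nth_Cons_0 nth_Cons_Suc One_nat_def sum_pull
    using exhaust_2[of a] exhaust_2[of b] by (auto simp: sum_2 cmat_entries algebra_simps)
  have sk: "emb_sym t f e [b, a, c, d] = - emb_sym t e f [a, b, c, d]" "emb_sym t e f [a, b, d, c] = emb_sym t e f [a, b, c, d]"
    if t: "t \<in> EH_module 1 2" for t :: "'m::finite EHtensor" and e f a b c d
    using EH_moduleD(1)[OF t, of f e "[c, d]"] EH_module_2_sym[OF t, of e f d c] exhaust_2[of a] exhaust_2[of b]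
    by (auto simp: emb_sym_def)
  have z: "t = (\<lambda>e f l. 0)" if t: "t \<in> EH_module 1 2" and 0: "\<forall>e f a b c d. emb_sym t e f [a, b, c, d] = 0" for t :: "'m::finite EHtensor"
    by (rule EH_module_2_zero[OF t]) (use 0[rule_format, of _ _ 1 2] in \<open>simp_all add: emb_sym_def\<close>)
  show ?thesis
  proof (rule embeddingI)
    show "emb_sym (\<lambda>e f l. t e f l + t' e f l) = (\<lambda>e f l. emb_sym t e f l + emb_sym t' e f l)" for t t' :: "'m::finite EHtensor"
      by (intro ext) (simp add: emb_sym_def algebra_simps)
    show "emb_sym (\<lambda>e f l. z * t e f l) = (\<lambda>e f l. z * emb_sym t e f l)" for z and t :: "'m::finite EHtensor"
      by (intro ext) (simp add: emb_sym_def algebra_simps)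
  qed (rule act sk z; assumption)+
qed

lemma embedding_S2: "embedding (-1) 2 emb_S2"
proof -
  have act: "emb_S2 (act_EH X \<xi> t) e f [a, b, c, d] = act_EH X \<xi> (emb_S2 t) e f [a, b, c, d]"
    for X :: "quat^'m^'m::finite" and \<xi> t e f a b c d
    unfolding act_EH_4 emb_S2_def act_EH_2 nth_simps4 nth_Cons_0 nth_Cons_Suc One_nat_def sum_pull
    using exhaust_2[of a] exhaust_2[of b] exhaust_2[of c] exhaust_2[of d] by (auto simp: sum_2 cmat_entries algebra_simps)
  have sk: "emb_S2 t f e [b, a, c, d] = - emb_S2 t e f [a, b, c, d]" "emb_S2 t e f [a, b, d, c] = emb_S2 t e f [a, b, c, d]"
    if t: "t \<in> EH_module (-1) 2" for t :: "'m::finite EHtensor" and e f a b c d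
    using EH_moduleD(1)[OF t, of f e] by (simp_all add: emb_S2_def)
  have z: "t = (\<lambda>e f l. 0)" if t: "t \<in> EH_module (-1) 2" and 0: "\<forall>e f a b c d. emb_S2 t e f [a, b, c, d] = 0" for t :: "'m::finite EHtensor"
  proof (rule EH_module_2_zero[OF t])
    fix e f
    show "t e f [1, 1] = 0" using 0[rule_format, of e f 1 1 1 2] by (simp add: emb_S2_def)
    show "t e f [1, 2] = 0" using 0[rule_format, of e f 1 1 2 2] by (simp add: emb_S2_def)
    show "t e f [2, 2] = 0" using 0[rule_format, of e f 1 2 2 2] by (simp add: emb_S2_def)
  qed
  show ?thesis
  proof (rule embeddingI)
    show "emb_S2 (\<lambda>e f l. t e f l + t' e f l) = (\<lambda>e f l. emb_S2 t e f l + emb_S2 t' e f l)" for t t' :: "'m::finite EHtensor"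
      by (intro ext) (simp add: emb_S2_def algebra_simps)
    show "emb_S2 (\<lambda>e f l. z * t e f l) = (\<lambda>e f l. z * emb_S2 t e f l)" for z and t :: "'m::finite EHtensor"
      by (intro ext) (simp add: emb_S2_def algebra_simps)
  qed (rule act sk z; assumption)+
qed

lemma embedding_S0: "embedding (-1) 0 emb_S0"
proof -
  have act: "emb_S0 (act_EH X \<xi> t) e f [a, b, c, d] = act_EH X \<xi> (emb_S0 t) e f [a, b, c, d]"
    for X :: "quat^'m^'m::finite" and \<xi> t e f a b c d
    unfolding act_EH_4 emb_S0_def act_EH_0 nth_simps4 nth_Cons_0 nth_Cons_Suc One_nat_def sum_pull
    using exhaust_2[of a] exhaust_2[of b] exhaust_2[of c] exhaust_2[of d] by (auto simp: sum_2 cmat_entries algebra_simps)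
  have sk: "emb_S0 t f e [b, a, c, d] = - emb_S0 t e f [a, b, c, d]" "emb_S0 t e f [a, b, d, c] = emb_S0 t e f [a, b, c, d]"
    if t: "t \<in> EH_module (-1) 0" for t :: "'m::finite EHtensor" and e f a b c d
    using EH_moduleD(1)[OF t, of f e "[]"] by (simp_all add: emb_S0_def algebra_simps)
  have z: "t = (\<lambda>e f l. 0)" if t: "t \<in> EH_module (-1) 0" and 0: "\<forall>e f a b c d. emb_S0 t e f [a, b, c, d] = 0" for t :: "'m::finite EHtensor"
  proof (intro ext)
    fix e f and l :: "2 list"
    show "t e f l = 0" using 0[rule_format, of e f 1 1 2 2] EH_moduleD(3)[OF t, of l e f] by (cases "l = []") (simp_all add: emb_S0_def)
  qed
  show ?thesis
  proof (rule embeddingI)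
    show "emb_S0 (\<lambda>e f l. t e f l + t' e f l) = (\<lambda>e f l. emb_S0 t e f l + emb_S0 t' e f l)" for t t' :: "'m::finite EHtensor"
      by (intro ext) (simp add: emb_S0_def algebra_simps)
    show "emb_S0 (\<lambda>e f l. z * t e f l) = (\<lambda>e f l. z * emb_S0 t e f l)" for z and t :: "'m::finite EHtensor"
      by (intro ext) (simp add: emb_S0_def algebra_simps)
  qed (rule act sk z; assumption)+
qed

section \<open>Clebsch-Gordan decomposition\<close>

text \<open>A symmetric tensor on \<open>C\<^sup>2\<close> is given by its values on the number of indices equal to 2. Defining tensors in this way
makes their symmetry evident.\<close>

lemma count_module:
  assumes "\<And>e f n. v f e n = \<epsilon> * v e f n"
  shows "(\<lambda>e f l. if length l = k then v e f (count (mset l) 2) else 0) \<in> EH_module \<epsilon> k"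
  unfolding EH_module_def mem_Collect_eq
proof (intro allI conjI impI)
  fix e f and l :: "2 list"
  show "(if length l = k then v f e (count (mset l) 2) else 0) = \<epsilon> * (if length l = k then v e f (count (mset l) 2) else 0)"
    using assms[of f e] by simp
  show "(if length l' = k then v e f (count (mset l') 2) else 0) = (if length l = k then v e f (count (mset l) 2) else 0)" if "mset l' = mset l" for l'
    using that mset_eq_length[OF that] by simp
qed simp

text \<open>The part R antisymmetric in the first two H-indices is a multiple of the symplectic form there. The symmetric part P
lies in \<open>S\<^sup>2 \<otimes> S\<^sup>2 = S\<^sup>4 + S\<^sup>2 + S\<^sup>0\<close> of the two-dimensional space H, and solving the linear equations for the sixteen components gives the formulas below.\<close>

lemma clebsch_gordan:
  fixes T :: "'m::finite EHtensor"
  assumes sk: "\<And>e f a b c d. T f e [b, a, c, d] = - T e f [a, b, c, d]" and sy: "\<And>e f a b. T e f [a, b, 2, 1] = T e f [a, b, 1, 2]"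
  obtains t0 t2 ts t4 where "t0 \<in> EH_module (-1) 0" "t2 \<in> EH_module (-1) 2" "ts \<in> EH_module 1 2" "t4 \<in> EH_module (-1) 4"
    "\<And>e f a b c d. T e f [a, b, c, d] = emb_S0 t0 e f [a, b, c, d] + emb_S2 t2 e f [a, b, c, d] + emb_sym ts e f [a, b, c, d] + emb_S4 t4 e f [a, b, c, d]"
proof -
  define P where "P e f a b c d = (T e f [a, b, c, d] + T e f [b, a, c, d]) / 2" for e f a b c d
  define R where "R e f c d = (T e f [1, 2, c, d] - T e f [2, 1, c, d]) / 2" for e f c d
  have Psk: "P f e a b c d = - P e f a b c d" for e f a b c d
    using sk[of f e b a c d] sk[of f e a b c d] by (simp add: P_def field_simps)
  have Rsy: "R f e c d = R e f c d" for e f c d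
    using sk[of f e 2 1 c d] sk[of f e 1 2 c d] by (simp add: R_def field_simps)
  \<comment> \<open>The \<open>S\<^sup>0\<close> part: P at the indices 1122, 2211 and 1212 has \<open>S\<^sup>4\<close> part q for all three, \<open>S\<^sup>0\<close> part 2s, 2s and -s, and \<open>S\<^sup>2\<close> part of
    opposite signs at the first two and zero at the third.\<close>
  define s where "s e f = ((P e f 1 1 2 2 + P e f 2 2 1 1) / 2 - P e f 1 2 1 2) / 3" for e f
  have ssk: "s f e = - s e f" for e f unfolding s_def Psk[of f e] by (simp add: field_simps)
  define v0 where "v0 e f n = s e f" for e f and n :: nat
  define v2 where "v2 e f n = (if n = 0 then (P e f 1 1 1 2 - P e f 1 2 1 1) / 4 else if n = 1 then (P e f 1 1 2 2 - P e f 2 2 1 1) / 8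
    else (P e f 1 2 2 2 - P e f 2 2 1 2) / 4)" for e f and n :: nat
  define vs where "vs e f n = (if n = 0 then R e f 1 1 else if n = 1 then R e f 1 2 else R e f 2 2)" for e f and n :: nat
  define v4 where "v4 e f n = (if n = 0 then P e f 1 1 1 1 else if n = 1 then (P e f 1 1 1 2 + P e f 1 2 1 1) / 2
    else if n = 2 then P e f 1 2 1 2 + s e f else if n = 3 then (P e f 1 2 2 2 + P e f 2 2 1 2) / 2 else P e f 2 2 2 2)" for e f and n :: nat
  define t0 where "t0 = (\<lambda>e f (l :: 2 list). if length l = 0 then v0 e f (count (mset l) 2) else 0)"
  define t2 where "t2 = (\<lambda>e f (l :: 2 list). if length l = 2 then v2 e f (count (mset l) 2) else 0)"
  define ts where "ts = (\<lambda>e f (l :: 2 list). if length l = 2 then vs e f (count (mset l) 2) else 0)"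
  define t4 where "t4 = (\<lambda>e f (l :: 2 list). if length l = 4 then v4 e f (count (mset l) 2) else 0)"
  show thesis
  proof (rule that)
    show "t0 \<in> EH_module (-1) 0" unfolding t0_def
    proof (rule count_module)
      show "v0 f e n = -1 * v0 e f n" for e f n unfolding v0_def mult_minus1 by (rule ssk)
    qed
    show "t2 \<in> EH_module (-1) 2" unfolding t2_def
    proof (rule count_module)
      show "v2 f e n = -1 * v2 e f n" for e f n unfolding v2_def Psk[of f e] by (simp add: field_simps)
    qed
    show "ts \<in> EH_module 1 2" unfolding ts_def
    proof (rule count_module)
      show "vs f e n = 1 * vs e f n" for e f n unfolding vs_def Rsy[of f e] by simp
    qed
    show "t4 \<in> EH_module (-1) 4" unfolding t4_def
    proof (rule count_module)
      show "v4 f e n = -1 * v4 e f n" for e f n unfolding v4_def Psk[of f e] ssk[of f e] by (simp add: field_simps)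
    qed
    show "T e f [a, b, c, d] = emb_S0 t0 e f [a, b, c, d] + emb_S2 t2 e f [a, b, c, d] + emb_sym ts e f [a, b, c, d] + emb_S4 t4 e f [a, b, c, d]"
      for e f a b c d
      using exhaust_2[of a] exhaust_2[of b] exhaust_2[of c] exhaust_2[of d]
      by (elim disjE; simp add: emb_S0_def emb_S2_def emb_sym_def emb_S4_def t0_def t2_def ts_def t4_def v0_def v2_def vs_def v4_def s_def P_def R_def sy field_simps)
  qed
qed

text \<open>The coordinates of the three components of f, regrouped by inverting the linear system \<open>contract_simps\<close>.\<close>

lemma ctensor_bracket_of:
  assumes f: "f \<in> ctensors"
  obtains T where "f = bracket_of T" "\<And>e g a b c d. T g e [b, a, c, d] = - T e g [a, b, c, d]" "\<And>e g a b. T e g [a, b, 2, 1] = T e g [a, b, 1, 2]"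
proof -
  have bl: "bilinear f" and f0: "f x x = 0" for x using f unfolding ctensors_def by blast+
  have sk: "f y x = - f x y" for x y
  proof -
    have "f (x + y) (x + y) = f x y + f y x" unfolding bilinear_ladd[OF bl] bilinear_radd[OF bl] by (simp add: f0)
    then have "f y x + f x y = 0" unfolding f0 by (simp add: add.commute)
    then show ?thesis by (simp only: eq_neg_iff_add_eq_0)
  qed
  define M where "M k = form_coeff (\<lambda>x y. f x y $ k)" for k
  have "bilinear (\<lambda>x y. f x y $ k)" for k
    unfolding bilinear_def by (simp add: linear_iff bilinear_ladd[OF bl] bilinear_radd[OF bl] bilinear_lmul[OF bl] bilinear_rmul[OF bl])
  then have bform: "bform (M k) x y = f x y $ k" for k x y unfolding M_def by (rule bform_form_coeff)
  have Msk: "M k g e b a = - M k e g a b" for k g e a b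
  proof -
    have "bform (\<lambda>e f a b. M k f e b a) = bform (\<lambda>e f a b. - M k e f a b)"
    proof (intro ext)
      fix x y
      have "bform (\<lambda>e f a b. M k f e b a) x y = bform (M k) y x" by (rule bform_flip[symmetric])
      also have "\<dots> = - bform (M k) x y" unfolding bform by (subst sk) (rule vector_uminus_component)
      finally show "bform (\<lambda>e f a b. M k f e b a) x y = bform (\<lambda>e f a b. - M k e f a b) x y" unfolding bform_uminus .
    qed
    from arg_cong[OF this, of form_coeff] show ?thesis unfolding form_coeff_bform by (rule fun_cong[THEN fun_cong, THEN fun_cong, THEN fun_cong])
  qed
  define T :: "'a EHtensor" where "T e g l = (if l ! 2 = l ! 3 then (if l ! 2 = 1 then - M 2 e g (l ! 0) (l ! 1) / 2 - \<i> * M 3 e g (l ! 0) (l ! 1) / 2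
      else - M 2 e g (l ! 0) (l ! 1) / 2 + \<i> * M 3 e g (l ! 0) (l ! 1) / 2) else \<i> * M 1 e g (l ! 0) (l ! 1) / 2)" for e g l
  have "contract T 1 e g a b = M 1 e g a b" "contract T 2 e g a b = M 2 e g a b" "contract T 3 e g a b = M 3 e g a b" for e g a b
    by (simp_all add: contract_simps T_def field_simps)
  then have c: "contract T k = M k" for k using exhaust_3[of k] by (intro ext) auto
  have "f = bracket_of T" by (intro ext) (simp add: bracket_of_def vec_eq_iff c bform)
  moreover have "T g e [b, a, c, d] = - T e g [a, b, c, d]" for e g a b c d by (simp add: T_def Msk[of _ g e] field_simps)
  moreover have "T e g [a, b, 2, 1] = T e g [a, b, 1, 2]" for e g a b by (simp add: T_def)
  ultimately show thesis using that by blast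
qed

theorem ctensor_decomposition:
  fixes f :: "'m::finite ctensor"
  assumes "f \<in> ctensors"
  obtains a b c d where "a \<in> component (-1) 0" "b \<in> component (-1) 2" "c \<in> component 1 2" "d \<in> component (-1) 4"
    "f = (\<lambda>x y. a x y + b x y + c x y + d x y)"
proof -
  obtain T where T: "f = bracket_of T" "\<And>e g a b c d. T g e [b, a, c, d] = - T e g [a, b, c, d]" "\<And>e g a b. T e g [a, b, 2, 1] = T e g [a, b, 1, 2]"
    using ctensor_bracket_of[OF assms] by blast
  obtain t0 t2 ts t4 where t: "t0 \<in> EH_module (-1) 0" "t2 \<in> EH_module (-1) 2" "ts \<in> EH_module 1 2" "t4 \<in> EH_module (-1) 4"
    "\<And>e f a b c d. T e f [a, b, c, d] = emb_S0 t0 e f [a, b, c, d] + emb_S2 t2 e f [a, b, c, d] + emb_sym ts e f [a, b, c, d] + emb_S4 t4 e f [a, b, c, d]"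
    using clebsch_gordan[of T] T(2,3) by blast
  have "f = bracket_of (\<lambda>e f l. emb_S0 t0 e f l + emb_S2 t2 e f l + emb_sym ts e f l + emb_S4 t4 e f l)"
    unfolding T(1) by (rule bracket_of_cong) (rule t(5))
  then have "f = (\<lambda>x y. bracket_of (emb_S0 t0) x y + bracket_of (emb_S2 t2) x y + bracket_of (emb_sym ts) x y + bracket_of (emb_S4 t4) x y)"
    by (simp only: bracket_of_add)
  then show thesis
    using that embedding_component[OF embedding_S0 t(1)] embedding_component[OF embedding_S2 t(2)]
      embedding_component[OF embedding_sym t(3)] embedding_component[OF embedding_S4 t(4)] by blast
qed

section \<open>Equivariance under all quaternionic matrices\<close>

lemma module_isoD:
  assumes "module_iso \<phi> M S"
  shows "bij_betw \<phi> M S"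
    "\<And>t t'. t \<in> M \<Longrightarrow> t' \<in> M \<Longrightarrow> \<phi> (\<lambda>e f l. t e f l + t' e f l) = (\<lambda>x y. \<phi> t x y + \<phi> t' x y)"
    "\<And>z t. t \<in> M \<Longrightarrow> \<phi> (\<lambda>e f l. z * t e f l) = (\<lambda>x y. z *s \<phi> t x y)"
    "\<And>X \<xi> t. X \<in> slH \<Longrightarrow> t \<in> M \<Longrightarrow> \<phi> (act_EH X \<xi> t) = act_ctensor X \<xi> (\<phi> t)"
proof -
  note iso = assms[unfolded module_iso_def]
  show "bij_betw \<phi> M S" by (rule iso[THEN conjunct1])
  show "\<phi> (\<lambda>e f l. t e f l + t' e f l) = (\<lambda>x y. \<phi> t x y + \<phi> t' x y)" if "t \<in> M" "t' \<in> M" for t t'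
    by (rule iso[THEN conjunct2, THEN conjunct1, THEN bspec, THEN bspec, OF that])
  show "\<phi> (\<lambda>e f l. z * t e f l) = (\<lambda>x y. z *s \<phi> t x y)" if "t \<in> M" for z t
    by (rule iso[THEN conjunct2, THEN conjunct2, THEN conjunct1, THEN spec, THEN bspec, OF that])
  show "\<phi> (act_EH X \<xi> t) = act_ctensor X \<xi> (\<phi> t)" if "X \<in> slH" "t \<in> M" for X \<xi> t
    by (rule iso[THEN conjunct2, THEN conjunct2, THEN conjunct2, THEN bspec, THEN spec, THEN bspec, OF that])
qed

definition scalar_mat :: "real \<Rightarrow> quat^'m^'m::finite"
  where "scalar_mat r = (\<chi> i j. if i = j then (r, 0) else 0)"

lemma act_EH_scalar: "act_EH (X + scalar_mat r) \<xi> t e f l = act_EH X \<xi> t e f l + of_real (- 2 * r) * t e f l"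
proof -
  have "cmatE (X + scalar_mat r) g e = cmatE X g e + (if g = e then of_real r else 0)" for g e
    using exhaust_2[of "snd g"] exhaust_2[of "snd e"]
    by (auto simp: cmatE_def cmat_add scalar_mat_def cmat_entries prod_eq_iff)
  then show ?thesis by (simp add: act_EH_def sum.distrib algebra_simps if_distrib[of "(*) _"] cong: if_cong)
qed

lemma act_ctensor_scalar:
  assumes "bilinear f"
  shows "act_ctensor (X + scalar_mat r) \<xi> f x y = act_ctensor X \<xi> f x y + of_real (- 2 * r) *s f x y"
proof -
  have q: "qmatvec (X + scalar_mat r) x = qmatvec X x + r *\<^sub>R x" for x :: "'a Usp"
  proof -
    have "(\<Sum>j\<in>UNIV. (if i = j then (r, 0) else 0) \<odot> x $ j) = r *\<^sub>R x $ i" for i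
    proof -
      have "(\<Sum>j\<in>UNIV. (if i = j then (r, 0) else 0) \<odot> x $ j) = (\<Sum>j\<in>UNIV. if i = j then r *\<^sub>R x $ j else 0)"
        by (rule sum.cong) auto
      then show ?thesis by simp
    qed
    then show ?thesis by (simp add: qmatvec_def vec_eq_iff qmul_add sum.distrib scalar_mat_def)
  qed
  have u: "levi_U (X + scalar_mat r) \<xi> x = levi_U X \<xi> x + r *\<^sub>R x" for x by (simp add: levi_U_eq q)
  have i: "levi_ImH (X + scalar_mat r) \<xi> = levi_ImH X \<xi>" by (intro ext) (simp only: levi_ImH_eq)
  show ?thesis unfolding act_ctensor_def u i bilinear_ladd[OF assms] bilinear_radd[OF assms] bilinear_lmul[OF assms] bilinear_rmul[OF assms]
    by (simp add: vec_eq_iff scaleR_conv_of_real[where 'a = complex])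
qed

text \<open>The identity matrix acts by -2 on brackets and on coordinate tensors alike, so equivariance under \<open>slH\<close> extends to all quaternionic matrices.
This avoids trace corrections in the Casimir operator.\<close>

lemma module_iso_gl:
  fixes \<phi> :: "'m::finite EHtensor \<Rightarrow> 'm ctensor"
  assumes iso: "module_iso \<phi> (EH_module \<epsilon> k) S" and sub: "S \<subseteq> ctensors" and t: "t \<in> EH_module \<epsilon> k"
  shows "\<phi> (act_EH X \<xi> t) = act_ctensor X \<xi> (\<phi> t)"
proof -
  \<comment> \<open>Y is the projection of X to \<open>slH\<close>.\<close>
  define r where "r = fst (\<Sum>i\<in>UNIV. X$i$i) / real CARD('m)"
  define Y where "Y = X + scalar_mat (- r)"
  have "scalar_mat (- r) = - (scalar_mat r :: quat^'m^'m)" by (simp add: vec_eq_iff scalar_mat_def)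
  then have X: "X = Y + scalar_mat r" by (simp add: Y_def)
  have "fst (\<Sum>i\<in>UNIV. Y$i$i) = 0"
    by (simp add: Y_def scalar_mat_def sum.distrib r_def fst_sum)
  then have Y: "Y \<in> slH" by (simp add: slH_def)
  have "\<phi> t \<in> S" using module_isoD(1)[OF iso] t by (rule bij_betw_apply)
  then have bl: "bilinear (\<phi> t)" using sub unfolding ctensors_def by blast
  have "act_EH X \<xi> t = (\<lambda>e f l. act_EH Y \<xi> t e f l + of_real (- 2 * r) * t e f l)"
    unfolding X by (intro ext) (rule act_EH_scalar)
  then have "\<phi> (act_EH X \<xi> t) = (\<lambda>x y. act_ctensor Y \<xi> (\<phi> t) x y + of_real (- 2 * r) *s \<phi> t x y)"
    by (simp only: module_isoD(2)[OF iso act_EH_module[OF t] EH_module_mult[OF t]] module_isoD(3)[OF iso t] module_isoD(4)[OF iso Y t])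
  also have "\<dots> = act_ctensor X \<xi> (\<phi> t)" unfolding X by (intro ext) (rule act_ctensor_scalar[OF bl, symmetric])
  finally show ?thesis .
qed

lemma module_iso_sum:
  assumes iso: "module_iso \<phi> (EH_module \<epsilon> k) S" and A: "finite A" and t: "\<And>i. i \<in> A \<Longrightarrow> t i \<in> EH_module \<epsilon> k"
  shows "(\<lambda>e f l. \<Sum>i\<in>A. z i * t i e f l) \<in> EH_module \<epsilon> k
    \<and> \<phi> (\<lambda>e f l. \<Sum>i\<in>A. z i * t i e f l) = (\<lambda>x y. \<Sum>i\<in>A. z i *s \<phi> (t i) x y)"
  using A t
proof (induction A rule: finite_induct)
  case empty
  have "\<phi> (\<lambda>e f l. 0) = (\<lambda>x y. 0)"
    using module_isoD(3)[OF iso EH_module_zero, of 0] by simp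
  then show ?case using EH_module_zero by simp
next
  case (insert i A)
  have ti: "t i \<in> EH_module \<epsilon> k" and IH: "(\<lambda>e f l. \<Sum>i\<in>A. z i * t i e f l) \<in> EH_module \<epsilon> k"
    "\<phi> (\<lambda>e f l. \<Sum>i\<in>A. z i * t i e f l) = (\<lambda>x y. \<Sum>i\<in>A. z i *s \<phi> (t i) x y)"
    using insert by simp_all
  have e: "(\<lambda>e f l. \<Sum>i\<in>insert i A. z i * t i e f l) = (\<lambda>e f l. z i * t i e f l + (\<Sum>i\<in>A. z i * t i e f l))"
    using insert by (intro ext) simp
  have e': "(\<lambda>x y. \<Sum>i\<in>insert i A. z i *s \<phi> (t i) x y) = (\<lambda>x y. z i *s \<phi> (t i) x y + (\<Sum>i\<in>A. z i *s \<phi> (t i) x y))"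
    using insert by (intro ext) simp
  show ?case unfolding e e' using module_isoD(2)[OF iso EH_module_mult[OF ti] IH(1)] EH_module_add[OF EH_module_mult[OF ti] IH(1)]
    unfolding IH(2) module_isoD(3)[OF iso ti] by blast
qed

section \<open>The Casimir operators\<close>

definition unit_mat :: "'m \<Rightarrow> 'm \<Rightarrow> quat \<Rightarrow> quat^'m^'m::finite"
  where "unit_mat i j q = (\<chi> r s. if r = i \<and> s = j then q else 0)"

text \<open>The four units 1, i, j, k of H indexed by an option type, with the signs \<open>1, -1, -1, -1\<close> of their squares: under the trace form, the
basis dual to the units is given by these signs.\<close>

definition qunit :: "3 option \<Rightarrow> quat"
  where "qunit u = (case u of None \<Rightarrow> q1 | Some k \<Rightarrow> im (ax k))"

definition qsign :: "3 option \<Rightarrow> complex"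
  where "qsign u = (case u of None \<Rightarrow> 1 | Some k \<Rightarrow> -1)"

lemma qunit_simps [simp]: "qunit None = q1" "qunit (Some k) = im (ax k)" "qsign None = 1" "qsign (Some k) = -1"
  by (simp_all add: qunit_def qsign_def)

lemma sum_UNIV_option: "(\<Sum>u\<in>UNIV. F u) = F None + (\<Sum>k\<in>(UNIV :: 'a::finite set). F (Some k))"
  by (simp add: UNIV_option_conv sum.reindex)

definition gl_casimir_EH :: "'m::finite EHtensor \<Rightarrow> 'm EHtensor"
  where "gl_casimir_EH t = (\<lambda>e f l. \<Sum>p\<in>UNIV. qsign (snd (snd p)) *
    act_EH (unit_mat (fst p) (fst (snd p)) (qunit (snd (snd p)))) 0 (act_EH (unit_mat (fst (snd p)) (fst p) (qunit (snd (snd p)))) 0 t) e f l)"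

text \<open>The Casimir operator of \<open>gl\<^sub>n\<^sub>-\<^sub>1(H)\<close>, up to a constant factor.\<close>

definition gl_casimir :: "'m::finite ctensor \<Rightarrow> 'm ctensor"
  where "gl_casimir f = (\<lambda>x y. \<Sum>p\<in>UNIV. qsign (snd (snd p)) *s
    act_ctensor (unit_mat (fst p) (fst (snd p)) (qunit (snd (snd p)))) 0 (act_ctensor (unit_mat (fst (snd p)) (fst p) (qunit (snd (snd p)))) 0 f) x y)"

definition rot_casimir_EH :: "'m::finite EHtensor \<Rightarrow> 'm EHtensor"
  where "rot_casimir_EH t = (\<lambda>e f l. \<Sum>k\<in>UNIV. 1 * act_EH 0 (ax k) (act_EH 0 (ax k) t) e f l)"

definition rot_casimir :: "'m::finite ctensor \<Rightarrow> 'm ctensor"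
  where "rot_casimir f = (\<lambda>x y. \<Sum>k\<in>UNIV. 1 *s act_ctensor 0 (ax k) (act_ctensor 0 (ax k) f) x y)"

text \<open>Casimir operators are polynomials in the action, so every module isomorphism intertwines them.\<close>

lemma module_iso_casimir:
  assumes iso: "module_iso \<phi> (EH_module \<epsilon> k) S" and sub: "S \<subseteq> ctensors" and t: "t \<in> EH_module \<epsilon> k"
  shows "gl_casimir_EH t \<in> EH_module \<epsilon> k" "\<phi> (gl_casimir_EH t) = gl_casimir (\<phi> t)"
    "rot_casimir_EH t \<in> EH_module \<epsilon> k" "\<phi> (rot_casimir_EH t) = rot_casimir (\<phi> t)"
  using module_iso_sum[OF iso finite, of UNIV "\<lambda>p. act_EH (unit_mat (fst p) (fst (snd p)) (qunit (snd (snd p)))) 0 (act_EH (unit_mat (fst (snd p)) (fst p) (qunit (snd (snd p)))) 0 t)"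
      "\<lambda>p. qsign (snd (snd p))", OF act_EH_module[OF act_EH_module[OF t]]]
    module_iso_sum[OF iso finite, of UNIV "\<lambda>k. act_EH 0 (ax k) (act_EH 0 (ax k) t)" "\<lambda>k. 1", OF act_EH_module[OF act_EH_module[OF t]]]
  unfolding gl_casimir_EH_def gl_casimir_def rot_casimir_EH_def rot_casimir_def
    module_iso_gl[OF iso sub act_EH_module[OF t]] module_iso_gl[OF iso sub t] by blast+

text \<open>On brackets whose two H-indices are symmetric or antisymmetric this operator is 2 or -2: it is twice the exchange of the
H-indices of the arguments, or equivalently, as brackets alternate, minus twice the exchange of the E-indices.\<close>

definition swp :: "('m::finite Usp \<Rightarrow> 'm Usp \<Rightarrow> 'v::real_vector) \<Rightarrow> 'm Usp \<Rightarrow> 'm Usp \<Rightarrow> 'v"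
  where "swp f x y = f x y - (\<Sum>k\<in>UNIV. f (rmulU x (im (ax k))) (rmulU y (im (ax k))))"

lemma swp_qunit: "swp f x y = (\<Sum>u\<in>UNIV. qsign u *s f (rmulU x (qunit u)) (rmulU y (qunit u)))"
  for f :: "'m::finite ctensor"
  by (simp add: swp_def sum_UNIV_option sum_3 vec_eq_iff)

text \<open>In \<open>H \<otimes> H\<close>, left and right multiplications act on different spinor indices. The signed sum over the units of left multiplications is twice the exchange of
the left indices, the one of right multiplications is twice the exchange of the right indices, and the product of both exchanges is the
exchange of the factors. The identity is checked on pairs of units.\<close>

lemma quat_swap:
  fixes b :: "quat \<Rightarrow> quat \<Rightarrow> complex^3"
  assumes b: "bilinear b"
  shows "(\<Sum>u\<in>UNIV. qsign u *s b (qunit u \<odot> p) (qunit u \<odot> q)) = (\<Sum>u\<in>UNIV. qsign u *s b (q \<odot> qunit u) (p \<odot> qunit u))"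
proof -
  define F where "F p q = (\<Sum>u\<in>UNIV. qsign u *s b (qunit u \<odot> p) (qunit u \<odot> q))" for p q
  define G where "G p q = (\<Sum>u\<in>UNIV. qsign u *s b (q \<odot> qunit u) (p \<odot> qunit u))" for p q
  note bs = bilinear_ladd[OF b] bilinear_radd[OF b] bilinear_lmul[OF b] bilinear_rmul[OF b] bilinear_lneg[OF b] bilinear_rneg[OF b]
  have m: "b (- 1, 0) p = - b q1 p" "b p (- 1, 0) = - b p q1" for p
    using bs(5)[of q1 p] bs(6)[of p q1] by simp_all
  have F: "F p q = b p q - b (im (ax 1) \<odot> p) (im (ax 1) \<odot> q) - b (im (ax 2) \<odot> p) (im (ax 2) \<odot> q) - b (im (ax 3) \<odot> p) (im (ax 3) \<odot> q)" for p q
    by (simp add: F_def sum_UNIV_option sum_3 vec_eq_iff)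
  have G: "G p q = b q p - b (q \<odot> im (ax 1)) (p \<odot> im (ax 1)) - b (q \<odot> im (ax 2)) (p \<odot> im (ax 2)) - b (q \<odot> im (ax 3)) (p \<odot> im (ax 3))" for p q
    by (simp add: G_def sum_UNIV_option sum_3 vec_eq_iff)
  have "F = G"
  proof (rule bilinear_eq_stdbasis)
    show "bilinear F" "bilinear G" unfolding F G bilinear_def by (simp_all add: linear_iff F G qmul_add bs algebra_simps)
    have basis: "i = q1 \<or> i = im (ax 1) \<or> i = im (ax 2) \<or> i = im (ax 3)" if "i \<in> Basis" for i :: quat
    proof -
      have "i = q1 \<or> (\<exists>k. i = im (ax k))" using that by (auto simp: Basis_prod_def Basis_vec_def im_def)
      then show ?thesis using exhaust_3 by metis
    qed
    show "F i j = G i j" if "i \<in> Basis" "j \<in> Basis" for i j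
      using basis[OF that(1)] basis[OF that(2)]
      by (elim disjE; simp add: F G im_ax_mult bs m)
  qed
  then show ?thesis unfolding F_def G_def by (rule fun_cong[THEN fun_cong])
qed

lemma qmatvec_unit_mat: "qmatvec (unit_mat i j q) x = axis i (q \<odot> x $ j)"
proof -
  have "(\<Sum>s\<in>UNIV. (if r = i \<and> s = j then q else 0) \<odot> x $ s) = (if r = i then q \<odot> x $ j else 0)" for r
  proof -
    have "(\<Sum>s\<in>UNIV. (if r = i \<and> s = j then q else 0) \<odot> x $ s) = (\<Sum>s\<in>UNIV. if s = j then (if r = i then q \<odot> x $ s else 0) else 0)"
      by (rule sum.cong) auto
    then show ?thesis by simp
  qed
  then show ?thesis by (simp add: qmatvec_def unit_mat_def vec_eq_iff axis_def)
qed

lemma act_ctensor_gl: "act_ctensor X 0 f x y = - f (qmatvec X x) y - f x (qmatvec X y)"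
  unfolding act_ctensor_def levi_U_eq im_linear rmulU_simps vec_eq_iff forall_3 vector_minus_component complexify_levi by simp

text \<open>Expanding the square of the action gives terms where both matrices act on the same argument, which produce the constant, and
cross terms, which \<open>quat_swap\<close> turns into right multiplications by units.\<close>

lemma gl_casimir_eq:
  fixes f :: "'m::finite ctensor"
  assumes f: "f \<in> ctensors"
  shows "gl_casimir f x y = of_nat (8 * CARD('m)) *s f x y - 2 *s swp f x y"
proof -
  have b: "bilinear f" using f unfolding ctensors_def by blast
  have sk: "f y x = - f x y" for x y
  proof -
    have "f (x + y) (x + y) = f x x + f y y + (f y x + f x y)" by (simp add: bilinear_ladd[OF b] bilinear_radd[OF b] add_ac)
    moreover have "f z z = 0" for z using f unfolding ctensors_def by blast
    ultimately have "f y x + f x y = 0" by simp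
    then show ?thesis by (simp only: eq_neg_iff_add_eq_0)
  qed
  note bs = bilinear_lneg[OF b] bilinear_rneg[OF b]
  have exp_sum: "f x y = (\<Sum>j\<in>UNIV. f (axis j (x $ j)) y)" "f x y = (\<Sum>j\<in>UNIV. f x (axis j (y $ j)))" for x y
    using linear_sum[OF bilinear_linear(2)[OF b], of "\<lambda>j. axis j (x $ j)" UNIV y] linear_sum[OF bilinear_linear(1)[OF b], of x "\<lambda>j. axis j (y $ j)" UNIV]
    by (simp_all only: vec_axis_sum[symmetric])
  have t1: "(\<Sum>u\<in>UNIV. qsign u *s f (axis j (qunit u \<odot> (qunit u \<odot> p))) y) = 4 *s f (axis j p) y" for j p y
    by (simp add: sum_UNIV_option sum_3 qmul_assoc[symmetric] im_ax_mult axis_linear bs vec_eq_iff)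
  have t2: "(\<Sum>u\<in>UNIV. qsign u *s f x (axis j (qunit u \<odot> (qunit u \<odot> p)))) = 4 *s f x (axis j p)" for j p x
    by (simp add: sum_UNIV_option sum_3 qmul_assoc[symmetric] im_ax_mult axis_linear bs vec_eq_iff)
  have bax: "bilinear (\<lambda>p q. f (axis i p) (axis j q))" for i j
    unfolding bilinear_def by (simp add: linear_iff axis_linear bilinear_ladd[OF b] bilinear_radd[OF b] bilinear_lmul[OF b] bilinear_rmul[OF b])
  note sw = quat_swap[OF bax]
  have cross: "(\<Sum>i\<in>UNIV. \<Sum>j\<in>UNIV. \<Sum>u\<in>UNIV. qsign u *s f (axis i (qunit u \<odot> x $ j)) (axis j (qunit u \<odot> y $ i))) = - swp f x y" for x y
  proof -
    have "(\<Sum>i\<in>UNIV. \<Sum>j\<in>UNIV. \<Sum>u\<in>UNIV. qsign u *s f (axis i (qunit u \<odot> x $ j)) (axis j (qunit u \<odot> y $ i)))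
      = (\<Sum>i\<in>UNIV. \<Sum>j\<in>UNIV. \<Sum>u\<in>UNIV. qsign u *s f (axis i (rmulU y (qunit u) $ i)) (axis j (rmulU x (qunit u) $ j)))"
      by (simp only: sw rmulU_nth)
    also have "\<dots> = (\<Sum>u\<in>UNIV. \<Sum>i\<in>UNIV. \<Sum>j\<in>UNIV. qsign u *s f (axis i (rmulU y (qunit u) $ i)) (axis j (rmulU x (qunit u) $ j)))"
    proof -
      have "(\<Sum>i\<in>UNIV. \<Sum>j\<in>UNIV. \<Sum>u\<in>UNIV. qsign u *s f (axis i (rmulU y (qunit u) $ i)) (axis j (rmulU x (qunit u) $ j)))
        = (\<Sum>i\<in>UNIV. \<Sum>u\<in>UNIV. \<Sum>j\<in>UNIV. qsign u *s f (axis i (rmulU y (qunit u) $ i)) (axis j (rmulU x (qunit u) $ j)))"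
        by (rule sum.cong[OF refl]) (rule sum.swap)
      also have "\<dots> = (\<Sum>u\<in>UNIV. \<Sum>i\<in>UNIV. \<Sum>j\<in>UNIV. qsign u *s f (axis i (rmulU y (qunit u) $ i)) (axis j (rmulU x (qunit u) $ j)))"
        by (rule sum.swap)
      finally show ?thesis .
    qed
    also have "\<dots> = (\<Sum>u\<in>UNIV. qsign u *s f (rmulU y (qunit u)) (rmulU x (qunit u)))"
    proof (rule sum.cong[OF refl])
      fix u
      have "(\<Sum>i\<in>UNIV. \<Sum>j\<in>UNIV. qsign u *s f (axis i (rmulU y (qunit u) $ i)) (axis j (rmulU x (qunit u) $ j)))
        = qsign u *s (\<Sum>i\<in>UNIV. \<Sum>j\<in>UNIV. f (axis i (rmulU y (qunit u) $ i)) (axis j (rmulU x (qunit u) $ j)))"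
        by (simp only: vec.scale_sum_right)
      then show "(\<Sum>i\<in>UNIV. \<Sum>j\<in>UNIV. qsign u *s f (axis i (rmulU y (qunit u) $ i)) (axis j (rmulU x (qunit u) $ j)))
        = qsign u *s f (rmulU y (qunit u)) (rmulU x (qunit u))"
        by (simp only: exp_sum(2)[symmetric] exp_sum(1)[symmetric])
    qed
    also have "\<dots> = swp f y x" by (rule swp_qunit[symmetric])
    also have "\<dots> = - swp f x y"
    proof -
      have "f (rmulU y (im (ax k))) (rmulU x (im (ax k))) = - f (rmulU x (im (ax k))) (rmulU y (im (ax k)))" for k by (rule sk)
      then show ?thesis unfolding swp_def sk[of y x] by (simp only: sum_negf) simp
    qed
    finally show ?thesis .
  qed
  have cross': "(\<Sum>i\<in>UNIV. \<Sum>j\<in>UNIV. \<Sum>u\<in>UNIV. qsign u *s f (axis j (qunit u \<odot> x $ i)) (axis i (qunit u \<odot> y $ j))) = - swp f x y"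
    unfolding cross[of x y, symmetric] by (rule sum.swap)
  have aa: "act_ctensor A 0 (act_ctensor B 0 f) x y = f (qmatvec B (qmatvec A x)) y + f (qmatvec A x) (qmatvec B y)
     + f (qmatvec B x) (qmatvec A y) + f x (qmatvec B (qmatvec A y))" for A B
    unfolding act_ctensor_gl by simp
  have "gl_casimir f x y = (\<Sum>i\<in>UNIV. \<Sum>j\<in>UNIV. \<Sum>u\<in>UNIV. qsign u *s f (axis j (qunit u \<odot> (qunit u \<odot> x $ j))) y
      + qsign u *s f (axis i (qunit u \<odot> x $ j)) (axis j (qunit u \<odot> y $ i))
      + qsign u *s f (axis j (qunit u \<odot> x $ i)) (axis i (qunit u \<odot> y $ j))
      + qsign u *s f x (axis j (qunit u \<odot> (qunit u \<odot> y $ j))))"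
    unfolding gl_casimir_def sum_UNIV_prod fst_conv snd_conv aa qmatvec_unit_mat vector_add_ldistrib
    by (simp add: axis_def)
  also have "\<dots> = (\<Sum>i\<in>(UNIV :: 'm set). \<Sum>j\<in>UNIV. 4 *s f (axis j (x $ j)) y) + - swp f x y + - swp f x y
     + (\<Sum>i\<in>(UNIV :: 'm set). \<Sum>j\<in>UNIV. 4 *s f x (axis j (y $ j)))"
    unfolding sum.distrib t1 t2 cross cross' ..
  also have "\<dots> = of_nat (8 * CARD('m)) *s f x y - 2 *s swp f x y"
    unfolding vec.scale_sum_right[symmetric] exp_sum(1)[symmetric] exp_sum(2)[symmetric]
    by (simp add: vec_eq_iff algebra_simps of_nat_index)
  finally show ?thesis .
qed

text \<open>The signed sum over the units of \<open>cmat q \<otimes> cmat q\<close> is twice the exchange of the two factors \<open>C\<^sup>2\<close>.\<close>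

lemma swp_bform:
  "(\<Sum>u\<in>UNIV. qsign u * bform M (rmulU x (qunit u)) (rmulU y (qunit u))) = 2 * bform (\<lambda>e f a b. M e f b a) x y"
proof -
  define N where "N k e f a b = (\<Sum>c\<in>UNIV. cmat (im (ax k)) $ a $ c * (\<Sum>d\<in>UNIV. cmat (im (ax k)) $ b $ d * M e f c d))" for k e f a b
  have N: "bform M (rmulU x (im (ax k))) (rmulU y (im (ax k))) = bform (N k) x y" for k
    unfolding bform_rmulU N_def[abs_def] ..
  have "2 * M e f b a = M e f a b - N 1 e f a b - N 2 e f a b - N 3 e f a b" for e f a b
    using exhaust_2[of a] exhaust_2[of b] by (auto simp: N_def sum_2 cmat_entries)
  then have "bform (\<lambda>e f a b. 2 * M e f b a) x y = bform M x y - bform (N 1) x y - bform (N 2) x y - bform (N 3) x y"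
    by (simp only: bform_diff)
  then show ?thesis by (simp only: bform_mult sum_UNIV_option sum_3 qunit_simps rmulU_simps N) simp
qed

lemma swp_bracket_of:
  assumes "\<And>e f a b c d. T e f [b, a, c, d] = s * T e f [a, b, c, d]"
  shows "swp (bracket_of T) x y = (2 * s) *s bracket_of T x y"
proof -
  have "contract T k e f b a = s * contract T k e f a b" for k e f a b
  proof -
    have "T e f [b, a, c, d] = s * T e f [a, b, c, d]" for c d by (rule assms)
    then show ?thesis by (simp add: contract_def sum_2 algebra_simps)
  qed
  then have "bform (\<lambda>e f a b. contract T k e f b a) x y = bform (\<lambda>e f a b. s * contract T k e f a b) x y" for k
    by (intro arg_cong[of _ _ "\<lambda>M. bform M x y"] ext)
  then have "(\<Sum>u\<in>UNIV. qsign u * bform (contract T k) (rmulU x (qunit u)) (rmulU y (qunit u))) = 2 * (s * bform (contract T k) x y)" for k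
    unfolding swp_bform bform_mult by simp
  then show ?thesis unfolding swp_qunit vec_eq_iff by (simp add: sum_component bracket_of_def)
qed

lemma componentE:
  assumes "g \<in> component \<epsilon> k"
  obtains S \<phi> t where "S \<subseteq> ctensors" "module_iso \<phi> (EH_module \<epsilon> k) S" "t \<in> EH_module \<epsilon> k" "g = \<phi> t"
proof -
  obtain S \<phi> where S: "submodule S" "module_iso \<phi> (EH_module \<epsilon> k) S" "g \<in> S" using assms unfolding component_def by blast
  have "S = \<phi> ` EH_module \<epsilon> k" using module_isoD(1)[OF S(2)] by (simp add: bij_betw_def)
  then obtain t where "t \<in> EH_module \<epsilon> k" "g = \<phi> t" using S(3) by blast
  moreover have "S \<subseteq> ctensors" using S(1) unfolding submodule_def by blast
  ultimately show thesis using that S(2) by blast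
qed

text \<open>An arbitrary submodule of the given type is compared with the one constructed by the embedding: the Casimir operator is a scalar on the latter,
hence on the module \<open>EH_module \<epsilon> k\<close>, hence on the former.\<close>

lemma swp_component:
  fixes g :: "'m::finite ctensor" and \<iota> :: "'m EHtensor \<Rightarrow> 'm EHtensor"
  assumes emb: "embedding \<epsilon> k \<iota>" and s: "\<And>t e f a b c d. t \<in> EH_module \<epsilon> k \<Longrightarrow> \<iota> t e f [b, a, c, d] = s * \<iota> t e f [a, b, c, d]"
    and g: "g \<in> component \<epsilon> k"
  shows "swp g x y = (2 * s) *s g x y"
proof -
  obtain S \<phi> t where S: "S \<subseteq> ctensors" "module_iso \<phi> (EH_module \<epsilon> k) S" and t: "t \<in> EH_module \<epsilon> k" and gt: "g = \<phi> t"
    using componentE[OF g] .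
  define \<psi> where "\<psi> t = bracket_of (\<iota> t)" for t
  define S0 where "S0 = \<psi> ` EH_module \<epsilon> k"
  have S0: "S0 \<subseteq> ctensors" "module_iso \<psi> (EH_module \<epsilon> k) S0"
    using embedding_iso[OF emb] unfolding S0_def \<psi>_def[abs_def] submodule_def by blast+
  define \<mu> where "\<mu> = of_nat (8 * CARD('m)) - 2 * (2 * s)"
  have mem: "\<psi> t \<in> ctensors" "g \<in> ctensors"
    using S0(1) bij_betw_apply[OF module_isoD(1)[OF S0(2)] t] S(1) bij_betw_apply[OF module_isoD(1)[OF S(2)] t] unfolding gt by blast+
  have sf: "swp (bracket_of (\<iota> t)) x y = (2 * s) *s bracket_of (\<iota> t) x y" for x y by (rule swp_bracket_of) (rule s[OF t])
  have "gl_casimir (\<psi> t) = (\<lambda>x y. \<mu> *s \<psi> t x y)"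
    by (intro ext) (simp add: \<psi>_def gl_casimir_eq[OF mem(1)[unfolded \<psi>_def]] sf \<mu>_def vec_eq_iff algebra_simps)
  then have "\<psi> (gl_casimir_EH t) = \<psi> (\<lambda>e f l. \<mu> * t e f l)"
    by (simp only: module_iso_casimir(2)[OF S0(2,1) t] module_isoD(3)[OF S0(2) t])
  then have "gl_casimir_EH t = (\<lambda>e f l. \<mu> * t e f l)"
    by (rule inj_onD[OF bij_betw_imp_inj_on[OF module_isoD(1)[OF S0(2)]] _ module_iso_casimir(1)[OF S0(2,1) t] EH_module_mult[OF t]])
  then have "gl_casimir g = (\<lambda>x y. \<mu> *s g x y)"
    unfolding gt module_iso_casimir(2)[OF S(2,1) t, symmetric] by (simp only: module_isoD(3)[OF S(2) t])
  from fun_cong[OF fun_cong[OF this, of x], of y] show ?thesis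
    unfolding gl_casimir_eq[OF mem(2)] by (simp add: \<mu>_def vec_eq_iff algebra_simps)
qed

lemma cmatE_zero: "cmatE 0 e f = 0"
  using exhaust_2[of "snd e"] exhaust_2[of "snd f"] by (auto simp: cmatE_def cmat_entries)

text \<open>The Casimir operator of \<open>sp\<^sub>1\<close> is \<open>- k (k + 2)\<close> on \<open>S\<^sup>kH\<close>; here k = 2, and k = 4 in the next lemma.\<close>

lemma rot_casimir_S2:
  assumes t: "t \<in> EH_module (-1) 2" shows "rot_casimir_EH t = (\<lambda>e f l. -8 * t e f l)"
proof (intro ext)
  fix e f and l :: "2 list"
  show "rot_casimir_EH t e f l = -8 * t e f l"
  proof (cases "length l = 2")
    case True
    then obtain a b where l: "l = [a, b]" by (auto simp: numeral_eq_Suc length_Suc_conv)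
    have s: "t e f [2, 1] = t e f [1, 2]" by (rule EH_module_2_sym[OF t])
    show ?thesis unfolding l rot_casimir_EH_def sum_3 act_EH_2
      using exhaust_2[of a] exhaust_2[of b] by (auto simp: act_EH_2 cmatE_zero sum_2 cmat_entries s algebra_simps)
  next
    case False
    then show ?thesis using EH_moduleD(3)[OF act_EH_module[OF act_EH_module[OF t]] False] EH_moduleD(3)[OF t False] by (simp add: rot_casimir_EH_def)
  qed
qed

lemma rot_casimir_S4:
  assumes t: "t \<in> EH_module (-1) 4" shows "rot_casimir_EH t = (\<lambda>e f l. -24 * t e f l)"
proof (intro ext)
  fix e f and l :: "2 list"
  show "rot_casimir_EH t e f l = -24 * t e f l"
  proof (cases "length l = 4")
    case True
    then obtain a b c d where l: "l = [a, b, c, d]" by (auto simp: numeral_eq_Suc length_Suc_conv)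
    have s: "t e f [2, 1, c, d] = t e f [1, 2, c, d]" "t e f [a, 2, 1, d] = t e f [a, 1, 2, d]" "t e f [a, b, 2, 1] = t e f [a, b, 1, 2]" for a b c d
      by (rule EH_moduleD(2)[OF t]; simp add: add_mset_commute)+
    show ?thesis unfolding l rot_casimir_EH_def sum_3 act_EH_4
      using exhaust_2[of a] exhaust_2[of b] exhaust_2[of c] exhaust_2[of d]
      by (elim disjE; simp add: act_EH_4 cmatE_zero sum_2 cmat_entries s algebra_simps)
  next
    case False
    then show ?thesis using EH_moduleD(3)[OF act_EH_module[OF act_EH_module[OF t]] False] EH_moduleD(3)[OF t False] by (simp add: rot_casimir_EH_def)
  qed
qed

lemma rot_casimir_component:
  assumes c: "\<And>t :: 'm::finite EHtensor. t \<in> EH_module \<epsilon> k \<Longrightarrow> rot_casimir_EH t = (\<lambda>e f l. \<mu> * t e f l)" and g: "(g :: 'm ctensor) \<in> component \<epsilon> k"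
  shows "rot_casimir g x y = \<mu> *s g x y"
proof -
  obtain S \<phi> t where S: "S \<subseteq> ctensors" "module_iso \<phi> (EH_module \<epsilon> k) S" and t: "t \<in> EH_module \<epsilon> k" and gt: "g = \<phi> t"
    using componentE[OF g] .
  show ?thesis unfolding gt module_iso_casimir(4)[OF S(2,1) t, symmetric] c[OF t] module_isoD(3)[OF S(2) t] ..
qed

lemma component_S0_invariant:
  assumes g: "g \<in> component (-1) 0" shows "act_ctensor 0 \<xi> g x y = 0"
proof -
  obtain S \<phi> t where S: "S \<subseteq> ctensors" "module_iso \<phi> (EH_module (-1) 0) S" and t: "t \<in> EH_module (-1) 0" and gt: "g = \<phi> t"
    using componentE[OF g] .
  have "act_EH 0 \<xi> t = (\<lambda>e f l. 0 * t e f l)"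
  proof (intro ext)
    fix e f and l :: "2 list"
    show "act_EH 0 \<xi> t e f l = 0 * t e f l"
      using EH_moduleD(3)[OF act_EH_module[OF t], of l] by (cases "l = []") (simp_all add: act_EH_0 cmatE_zero)
  qed
  then have "act_ctensor 0 \<xi> g = (\<lambda>x y. 0 *s g x y)"
    unfolding gt module_iso_gl[OF S(2,1) t, symmetric] by (simp only: module_isoD(3)[OF S(2) t])
  then show ?thesis by simp
qed

section \<open>Components of a real bracket\<close>

text \<open>The action of the j-th imaginary unit of \<open>sp\<^sub>1\<close> on real brackets.\<close>

definition rot_act :: "3 \<Rightarrow> 'm::finite bracket \<Rightarrow> 'm Usp \<Rightarrow> 'm Usp \<Rightarrow> real^3"
  where "rot_act j L x y = 2 *\<^sub>R cross3 (ax j) (L x y) + L (rmulU x (im (ax j))) y + L x (rmulU y (im (ax j)))"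

text \<open>The projection to the components with factor \<open>\<Lambda>\<^sup>2E\<^sup>*\<close>, on which \<open>swp\<close> is 2, along \<open>S\<^sup>2E\<^sup>* \<otimes> S\<^sup>2H\<close>, on which it is -2.\<close>

definition Lambda2E_part :: "'m::finite bracket \<Rightarrow> 'm Usp \<Rightarrow> 'm Usp \<Rightarrow> real^3"
  where "Lambda2E_part L x y = (1/4) *\<^sub>R (2 *\<^sub>R L x y + swp L x y)"

text \<open>Up to a constant factor this recovers \<open>\<beta>\<close> from a hypersurface bracket of pure type.\<close>

definition trace_form :: "'m::finite bracket \<Rightarrow> 'm Usp \<Rightarrow> 'm Usp \<Rightarrow> real"
  where "trace_form L x y = L x (rmulU y (im (ax 1))) $ 1 + L x (rmulU y (im (ax 2))) $ 2 + L x (rmulU y (im (ax 3))) $ 3"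

lemma trace_form_bilinear:
  assumes "bilinear L" shows "bilinear (\<lambda>x y. r * trace_form L x y)"
  unfolding bilinear_def trace_form_def
  by (simp add: linear_iff rmulU_add bilinear_ladd[OF assms] bilinear_radd[OF assms] bilinear_lmul[OF assms] bilinear_rmul[OF assms] algebra_simps)

lemma hypersurface_bracket_add:
  assumes "hypersurface_bracket L" "hypersurface_bracket L'"
  shows "hypersurface_bracket (\<lambda>x y. L x y + L' x y)"
proof -
  obtain \<beta> where b: "bilinear \<beta>" "\<And>x y. \<beta> x y = \<beta> y x"
    "\<And>x y k. L x y $ k = \<beta> (rmulU x (im (ax k))) y - \<beta> x (rmulU y (im (ax k)))"
    using assms(1) unfolding hypersurface_bracket_def by blast
  obtain \<gamma> where c: "bilinear \<gamma>" "\<And>x y. \<gamma> x y = \<gamma> y x"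
    "\<And>x y k. L' x y $ k = \<gamma> (rmulU x (im (ax k))) y - \<gamma> x (rmulU y (im (ax k)))"
    using assms(2) unfolding hypersurface_bracket_def by blast
  have "bilinear (\<lambda>x y. \<beta> x y + \<gamma> x y)"
    using b(1) c(1) unfolding bilinear_def by (simp add: linear_compose_add)
  moreover have "\<beta> x y + \<gamma> x y = \<beta> y x + \<gamma> y x" for x y using b(2)[of x y] c(2)[of x y] by simp
  moreover have "(L x y + L' x y) $ k = (\<beta> (rmulU x (im (ax k))) y + \<gamma> (rmulU x (im (ax k))) y) - (\<beta> x (rmulU y (im (ax k))) + \<gamma> x (rmulU y (im (ax k))))" for x y k
    by (simp add: b(3) c(3))
  ultimately show ?thesis unfolding hypersurface_bracket_def
    by (intro exI[of _ "\<lambda>x y. \<beta> x y + \<gamma> x y"] conjI allI)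
qed

text \<open>The projection amounts to averaging \<open>\<beta>\<close> over the units, and an averaged \<open>\<beta>\<close> is Hermitian. Its bracket \<open>2 \<beta>(x i\<^sub>k, y)\<close> is invariant under \<open>sp\<^sub>1\<close>.\<close>

lemma Lambda2E_part_invariant:
  assumes "hypersurface_bracket L" shows "rot_act j (Lambda2E_part L) x y = 0"
proof -
  obtain \<beta> where b: "bilinear \<beta>"
    and L: "\<And>x y k. L x y $ k = \<beta> (rmulU x (im (ax k))) y - \<beta> x (rmulU y (im (ax k)))"
    using assms unfolding hypersurface_bracket_def by blast
  note n = bilinear_lneg[OF b] bilinear_rneg[OF b] bilinear_lmul[OF b] bilinear_rmul[OF b]
  show ?thesis using exhaust_3[of j]
    by (elim disjE; simp add: rot_act_def Lambda2E_part_def swp_def vec_eq_iff forall_3 cross3_def sum_3 L im_ax_mult n qmul_assoc;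
        simp add: field_simps)
qed

text \<open>An invariant bracket is \<open>L\<^sub>k(x, y) = 2 \<beta>(x i\<^sub>k, y)\<close> with \<open>\<beta>\<close> Hermitian, so the three terms \<open>L\<^sub>k(x, y i\<^sub>k)\<close> all equal \<open>2 \<beta>(x, y)\<close>, whence the factor 1/6.\<close>

lemma invariant_imp_hypersurface_bracket:
  fixes L :: "'m::finite bracket"
  assumes b: "bilinear L" and sk: "\<And>x y. L y x = - L x y" and inv: "\<And>j x y. rot_act j L x y = 0"
  shows "hypersurface_bracket L"
proof -
  note n = bilinear_lneg[OF b] bilinear_rneg[OF b] bilinear_lmul[OF b] bilinear_rmul[OF b]
  have r: "L (rmulU x (im (ax j))) y $ k = - L x (rmulU y (im (ax j))) $ k - 2 * cross3 (ax j) (L x y) $ k" for j x y k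
    using arg_cong[OF inv[of j x y], of "\<lambda>v. v $ k"] by (simp add: rot_act_def algebra_simps)
  have cr: "cross3 (ax 1) v = vector [0, - v $ 3, v $ 2]" "cross3 (ax 2) v = vector [v $ 3, 0, - v $ 1]" "cross3 (ax 3) v = vector [- v $ 2, v $ 1, 0]" for v
    by (simp_all add: cross3_def)
  \<comment> \<open>Moving the two factors of \<open>i\<^sub>1 i\<^sub>2 = i\<^sub>3\<close> from x to y one after the other, or their product at once, must give the same result.
    This relates different components of L; the next two blocks repeat it cyclically.\<close>
  have c3: "L x (rmulU y (im (ax 2))) $ 3 = L x y $ 1" "L x (rmulU y (im (ax 1))) $ 3 = - L x y $ 2" for x y
  proof -
    have "L (rmulU (rmulU x (im (ax 1))) (im (ax 2))) y $ k = L (rmulU x (im (ax 3))) y $ k" for k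
      unfolding rmulU_rmulU im_ax_mult ..
    from this[of 1] this[of 2] show "L x (rmulU y (im (ax 2))) $ 3 = L x y $ 1" "L x (rmulU y (im (ax 1))) $ 3 = - L x y $ 2"
      unfolding r cr by (simp_all add: r cr im_ax_mult n del: rmulU_nth)
  qed
  have c1: "L x (rmulU y (im (ax 3))) $ 1 = L x y $ 2" "L x (rmulU y (im (ax 2))) $ 1 = - L x y $ 3" for x y
  proof -
    have "L (rmulU (rmulU x (im (ax 2))) (im (ax 3))) y $ k = L (rmulU x (im (ax 1))) y $ k" for k
      unfolding rmulU_rmulU im_ax_mult ..
    from this[of 2] this[of 3] show "L x (rmulU y (im (ax 3))) $ 1 = L x y $ 2" "L x (rmulU y (im (ax 2))) $ 1 = - L x y $ 3"
      unfolding r cr by (simp_all add: r cr im_ax_mult n del: rmulU_nth)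
  qed
  have c2: "L x (rmulU y (im (ax 1))) $ 2 = L x y $ 3" "L x (rmulU y (im (ax 3))) $ 2 = - L x y $ 1" for x y
  proof -
    have "L (rmulU (rmulU x (im (ax 3))) (im (ax 1))) y $ k = L (rmulU x (im (ax 2))) y $ k" for k
      unfolding rmulU_rmulU im_ax_mult ..
    from this[of 3] this[of 1] show "L x (rmulU y (im (ax 1))) $ 2 = L x y $ 3" "L x (rmulU y (im (ax 3))) $ 2 = - L x y $ 1"
      unfolding r cr by (simp_all add: r cr im_ax_mult n del: rmulU_nth)
  qed
  define \<beta> where "\<beta> x y = (1/6) * trace_form L x y" for x y
  have "bilinear \<beta>" unfolding \<beta>_def by (rule trace_form_bilinear[OF b])
  moreover have "\<beta> x y = \<beta> y x" for x y
  proof -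
    have "L y (rmulU x (im (ax k))) $ k = L x (rmulU y (im (ax k))) $ k" for k
      unfolding sk[of y "rmulU x (im (ax k))"] vector_uminus_component r using exhaust_3[of k] by (auto simp: cr)
    then show ?thesis by (simp add: \<beta>_def trace_form_def)
  qed
  moreover have "L x y $ k = \<beta> (rmulU x (im (ax k))) y - \<beta> x (rmulU y (im (ax k)))" for x y k
    using exhaust_3[of k] by (elim disjE; simp add: \<beta>_def trace_form_def r cr im_ax_mult n c1 c2 c3)
  ultimately show ?thesis unfolding hypersurface_bracket_def by (intro exI[of _ \<beta>] conjI allI)
qed

text \<open>The hypothesis says that L is invariant under right multiplication of both arguments by a unit: comparing it at \<open>(x, y)\<close> and at
\<open>(x i\<^sub>k, y i\<^sub>k)\<close> isolates the k-th term of the sum. Units are then skew for L, and the sum over k of \<open>i\<^sub>k i\<^sub>l + i\<^sub>l i\<^sub>k = -2 \<delta>\<^sub>k\<^sub>l\<close> gives the formula.\<close>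

lemma unitary_imp_hypersurface_bracket:
  fixes L :: "'m::finite bracket"
  assumes b: "bilinear L" and sk: "\<And>x y. L y x = - L x y" and s: "\<And>x y. swp L x y = (-2) *\<^sub>R L x y"
  shows "hypersurface_bracket L"
proof -
  note n = bilinear_lneg[OF b] bilinear_rneg[OF b] bilinear_lmul[OF b] bilinear_rmul[OF b]
  have t: "L (rmulU x (im (ax 1))) (rmulU y (im (ax 1))) $ c + L (rmulU x (im (ax 2))) (rmulU y (im (ax 2))) $ c
      + L (rmulU x (im (ax 3))) (rmulU y (im (ax 3))) $ c = 3 * L x y $ c" for x y c
    using arg_cong[OF s[of x y], of "\<lambda>v. v $ c"] by (simp add: swp_def sum_3)
  have u: "L (rmulU x (im (ax k))) (rmulU y (im (ax k))) $ c = L x y $ c" for x y k c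
    using t[of x y c] t[of "rmulU x (im (ax k))" "rmulU y (im (ax k))" c] exhaust_3[of k]
    by (auto simp: im_ax_mult n)
  have r: "L (rmulU x (im (ax k))) y $ c = - L x (rmulU y (im (ax k))) $ c" for x y k c
    using u[of x k "rmulU y (im (ax k))" c] by (simp add: im_ax_mult n)
  define \<beta> where "\<beta> x y = (1/2) * trace_form L x y" for x y
  have "bilinear \<beta>" unfolding \<beta>_def by (rule trace_form_bilinear[OF b])
  moreover have "\<beta> x y = \<beta> y x" for x y
  proof -
    have "L y (rmulU x (im (ax k))) $ k = L x (rmulU y (im (ax k))) $ k" for k
      unfolding sk[of y "rmulU x (im (ax k))"] vector_uminus_component r by simp
    then show ?thesis by (simp add: \<beta>_def trace_form_def)
  qed
  moreover have "L x y $ k = \<beta> (rmulU x (im (ax k))) y - \<beta> x (rmulU y (im (ax k)))" for x y k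
    using exhaust_3[of k] by (elim disjE; simp add: \<beta>_def trace_form_def r im_ax_mult n field_simps)
  ultimately show ?thesis unfolding hypersurface_bracket_def by (intro exI[of _ \<beta>] conjI allI)
qed

lemma complexify_ctensor:
  assumes L: "L \<in> bracket_tensors" shows "complexify L \<in> ctensors"
proof -
  note b = bracket_tensors_bilinear[OF L]
  have "bilinear (complexify L)" unfolding bilinear_def complexify_def
    by (simp add: linear_iff vec_eq_iff bilinear_ladd[OF b] bilinear_radd[OF b] bilinear_lmul[OF b] bilinear_rmul[OF b] scaleR_conv_of_real[where 'a = complex])
  moreover have "L x x = 0" for x using L unfolding bracket_tensors_def by blast
  ultimately show ?thesis by (simp add: ctensors_def complexify_def vec_eq_iff)
qed

lemma complexify_inj: "complexify L x y = complexify L' x y \<longleftrightarrow> L x y = L' x y"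
  by (simp add: complexify_def vec_eq_iff)

lemma complexify_swp: "swp (complexify L) x y = complexify (swp L) x y"
  by (simp add: swp_def complexify_def vec_eq_iff sum_component)

lemma complexify_rot_act:
  assumes "bilinear L" shows "act_ctensor 0 (ax j) (complexify L) x y = complexify (rot_act j L) x y"
proof -
  have q: "qmatvec 0 x = 0" for x :: "'a Usp" by (simp add: qmatvec_def vec_eq_iff)
  show ?thesis
    unfolding act_ctensor_def levi_U_eq q vec_eq_iff forall_3 vector_minus_component complexify_levi
    by (simp add: complexify_def rot_act_def cross3_def bilinear_lneg[OF assms] bilinear_rneg[OF assms])
qed

lemma act_ctensor_add: "act_ctensor X \<xi> (\<lambda>x y. f x y + g x y) x y = act_ctensor X \<xi> f x y + act_ctensor X \<xi> g x y"
  unfolding act_ctensor_def vec_eq_iff forall_3 vector_minus_component vector_add_component complexify_levi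
  by (simp add: algebra_simps)

lemma act_ctensor_mult: "act_ctensor X \<xi> (\<lambda>x y. z *s f x y) x y = z *s act_ctensor X \<xi> f x y"
  unfolding act_ctensor_def vec_eq_iff forall_3 vector_minus_component vector_smult_component complexify_levi
  by (simp add: algebra_simps)

lemma rot_casimir_mult: "rot_casimir (\<lambda>x y. z *s f x y) x y = z *s rot_casimir f x y"
proof -
  have "act_ctensor 0 (ax k) (\<lambda>x y. z *s f x y) = (\<lambda>x y. z *s act_ctensor 0 (ax k) f x y)" for k
    by (intro ext) (rule act_ctensor_mult)
  then show ?thesis unfolding rot_casimir_def by (simp only: act_ctensor_mult vec.scale_sum_right vec.scale_one)
qed

lemma emb_symmetries:
  shows "emb_S0 t e f [b, a, c, d] = 1 * emb_S0 t e f [a, b, c, d]"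
    and "emb_S2 t e f [b, a, c, d] = 1 * emb_S2 t e f [a, b, c, d]"
    and "emb_sym t e f [b, a, c, d] = (-1) * emb_sym t e f [a, b, c, d]"
    and "t \<in> EH_module (-1) 4 \<Longrightarrow> emb_S4 t e f [b, a, c, d] = 1 * emb_S4 t e f [a, b, c, d]"
  using exhaust_2[of a] exhaust_2[of b] EH_moduleD(2)[of t "-1" 4 "[b, a, c, d]" "[a, b, c, d]" e f]
  by (auto simp: emb_S0_def emb_S2_def emb_sym_def emb_S4_def add_mset_commute)

lemma swp_components:
  shows "g \<in> component (-1) 0 \<Longrightarrow> swp g x y = 2 *s g x y"
    and "g \<in> component (-1) 2 \<Longrightarrow> swp g x y = 2 *s g x y"
    and "g \<in> component (-1) 4 \<Longrightarrow> swp g x y = 2 *s g x y"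
    and "g \<in> component 1 2 \<Longrightarrow> swp g x y = (-2) *s g x y"
proof -
  show "swp g x y = 2 *s g x y" if "g \<in> component (-1) 0" using swp_component[OF embedding_S0 emb_symmetries(1) that] by simp
  show "swp g x y = 2 *s g x y" if "g \<in> component (-1) 2" using swp_component[OF embedding_S2 emb_symmetries(2) that] by simp
  show "swp g x y = 2 *s g x y" if "g \<in> component (-1) 4" using swp_component[OF embedding_S4 emb_symmetries(4) that] by simp
  show "swp g x y = (-2) *s g x y" if "g \<in> component 1 2" using swp_component[OF embedding_sym emb_symmetries(3) that] by simp
qed

text \<open>The eigenvalues of \<open>swp\<close> on the four components identify the projection, whichever decomposition is given.\<close>

lemma Lambda2E_part_components:
  assumes dec: "complexify L = (\<lambda>x y. a x y + b x y + c x y + d x y)"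
    and mem: "a \<in> component (-1) 0" "b \<in> component (-1) 2" "c \<in> component 1 2" "d \<in> component (-1) 4"
  shows "complexify (Lambda2E_part L) = (\<lambda>x y. a x y + (b x y + d x y))"
proof (intro ext)
  fix x y
  have "complexify (swp L) x y = swp a x y + swp b x y + swp c x y + swp d x y"
    unfolding complexify_swp[symmetric] dec swp_def by (simp add: sum.distrib algebra_simps)
  then have 1: "complexify (swp L) x y $ i = 2 * a x y $ i + 2 * b x y $ i - 2 * c x y $ i + 2 * d x y $ i" for i
    unfolding swp_components(1)[OF mem(1)] swp_components(2)[OF mem(2)] swp_components(4)[OF mem(3)] swp_components(3)[OF mem(4)]
    by simp
  have 2: "complexify L x y $ i = a x y $ i + b x y $ i + c x y $ i + d x y $ i" for i unfolding dec by simp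
  have 3: "complexify (Lambda2E_part L) x y $ i = (1/4) * (2 * complexify L x y $ i + complexify (swp L) x y $ i)" for i
    by (simp add: complexify_def Lambda2E_part_def)
  show "complexify (Lambda2E_part L) x y = a x y + (b x y + d x y)"
    unfolding vec_eq_iff 3 1 2 by simp
qed

lemma Lambda2E_part_bilinear:
  assumes L: "L \<in> bracket_tensors" shows "bilinear (Lambda2E_part L)" "Lambda2E_part L y x = - Lambda2E_part L x y"
proof -
  note b = bracket_tensors_bilinear[OF L]
  show "bilinear (Lambda2E_part L)" unfolding bilinear_def Lambda2E_part_def swp_def sum_3
    by (simp add: linear_iff rmulU_add bilinear_ladd[OF b] bilinear_radd[OF b] bilinear_lmul[OF b] bilinear_rmul[OF b] algebra_simps)
  show "Lambda2E_part L y x = - Lambda2E_part L x y"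
    unfolding Lambda2E_part_def swp_def sum_3 bracket_tensors_skew[OF L, of y x] bracket_tensors_skew[OF L, of "rmulU y _"] 
    by (simp add: algebra_simps)
qed

text \<open>If L is a hypersurface bracket, its \<open>\<Lambda>\<^sup>2E\<^sup>*\<close> part is \<open>sp\<^sub>1\<close> invariant, so \<open>b + d\<close> is killed by the Casimir operator, which is -8 on b and -24 on d;
applying it twice gives \<open>b = d = 0\<close>. If b and d vanish, the components a and c are the complexifications of the two projections
of L, and each of them is a hypersurface bracket.\<close>

theorem nontrivial_component_iff:
  fixes L :: "'m::finite bracket"
  assumes L: "L \<in> bracket_tensors"
  shows "nontrivial_component_S2H_S4H L \<longleftrightarrow> \<not> hypersurface_bracket L"
proof
  assume "nontrivial_component_S2H_S4H L"
  then obtain a b c d where mem: "a \<in> component (-1) 0" "b \<in> component (-1) 2" "c \<in> component 1 2" "d \<in> component (-1) 4"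
    and dec: "complexify L = (\<lambda>x y. a x y + b x y + c x y + d x y)" and ne: "b \<noteq> (\<lambda>x y. 0) \<or> d \<noteq> (\<lambda>x y. 0)"
    unfolding nontrivial_component_S2H_S4H_def by (elim bexE conjE) (rule that)
  show "\<not> hypersurface_bracket L"
  proof
    assume hyp: "hypersurface_bracket L"
    have act: "act_ctensor 0 (ax j) (\<lambda>x y. b x y + d x y) = (\<lambda>x y. 0)" for j
    proof (intro ext)
      fix x y
      have "act_ctensor 0 (ax j) (complexify (Lambda2E_part L)) x y = 0"
        unfolding complexify_rot_act[OF Lambda2E_part_bilinear(1)[OF L]] by (simp add: complexify_def Lambda2E_part_invariant[OF hyp] vec_eq_iff)
      then have "act_ctensor 0 (ax j) a x y + act_ctensor 0 (ax j) (\<lambda>x y. b x y + d x y) x y = 0"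
        unfolding Lambda2E_part_components[OF dec mem] by (simp only: act_ctensor_add)
      then show "act_ctensor 0 (ax j) (\<lambda>x y. b x y + d x y) x y = 0"
        unfolding component_S0_invariant[OF mem(1)] by simp
    qed
    have rb: "rot_casimir b x y = (-8) *s b x y" for x y by (rule rot_casimir_component[OF rot_casimir_S2 mem(2)])
    have rd: "rot_casimir d x y = (-24) *s d x y" for x y by (rule rot_casimir_component[OF rot_casimir_S4 mem(4)])
    have neg: "act_ctensor 0 (ax j) b = (\<lambda>x y. (-1) *s act_ctensor 0 (ax j) d x y)" for j
    proof (intro ext)
      fix x y
      have "act_ctensor 0 (ax j) b x y + act_ctensor 0 (ax j) d x y = 0"
        using fun_cong[OF fun_cong[OF act[of j], of x], of y] by (simp only: act_ctensor_add)
      then show "act_ctensor 0 (ax j) b x y = (-1) *s act_ctensor 0 (ax j) d x y" by (simp add: eq_neg_iff_add_eq_0)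
    qed
    \<comment> \<open>From \<open>- 8 b = 24 d\<close>; a second application of the Casimir operator to this relation gives a different multiple.\<close>
    have b3d: "b x y = (-3) *s d x y" for x y
    proof -
      have "rot_casimir b x y = (-1) *s rot_casimir d x y"
        unfolding rot_casimir_def by (simp only: neg act_ctensor_mult vec.scale_sum_right vec.scale_one)
      then have "- b x y $ i = 3 * d x y $ i" for i unfolding rb rd by (simp add: vec_eq_iff)
      then have "b x y $ i = - (3 * d x y $ i)" for i by (metis minus_minus)
      then show ?thesis by (simp add: vec_eq_iff)
    qed
    have "b = (\<lambda>x y. (-3) *s d x y)" by (intro ext) (rule b3d)
    then have "rot_casimir b x y = (-3) *s rot_casimir d x y" for x y by (simp only: rot_casimir_mult)
    then have d0: "d x y = 0" for x y unfolding rb rd b3d by (simp add: vec_eq_iff)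
    then have "b x y = 0" for x y by (simp add: b3d)
    then have "b = (\<lambda>x y. 0)" "d = (\<lambda>x y. 0)" using d0 by (simp_all add: fun_eq_iff)
    with ne show False by simp
  qed
next
  assume n: "\<not> hypersurface_bracket L"
  obtain a b c d where mem: "a \<in> component (-1) 0" "b \<in> component (-1) 2" "c \<in> component 1 2" "d \<in> component (-1) 4"
    and dec: "complexify L = (\<lambda>x y. a x y + b x y + c x y + d x y)"
    by (rule ctensor_decomposition[OF complexify_ctensor[OF L]])
  have "b \<noteq> (\<lambda>x y. 0) \<or> d \<noteq> (\<lambda>x y. 0)"
  proof (rule ccontr)
    assume "\<not> (b \<noteq> (\<lambda>x y. 0) \<or> d \<noteq> (\<lambda>x y. 0))"
    then have bd: "b = (\<lambda>x y. 0)" "d = (\<lambda>x y. 0)" by blast+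
    have a: "complexify (Lambda2E_part L) = a" unfolding Lambda2E_part_components[OF dec mem] bd by simp
    note bl = bracket_tensors_bilinear[OF L] and sp = Lambda2E_part_bilinear[OF L]
    define K where "K x y = L x y - Lambda2E_part L x y" for x y
    have c: "complexify K = c"
    proof (intro ext)
      fix x y
      have "complexify K x y = complexify L x y - complexify (Lambda2E_part L) x y" by (simp add: complexify_def K_def vec_eq_iff)
      then show "complexify K x y = c x y" unfolding a dec bd by simp
    qed
    have "rot_act j (Lambda2E_part L) x y = 0" for j x y
    proof -
      have "complexify (rot_act j (Lambda2E_part L)) x y = 0"
        unfolding complexify_rot_act[OF sp(1), symmetric] a by (rule component_S0_invariant[OF mem(1)])
      then show ?thesis by (simp add: complexify_def vec_eq_iff)
    qed
    then have h1: "hypersurface_bracket (Lambda2E_part L)" by (rule invariant_imp_hypersurface_bracket[OF sp])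
    have bK: "bilinear K" unfolding K_def bilinear_def
      by (simp add: linear_iff bilinear_ladd[OF bl] bilinear_radd[OF bl] bilinear_lmul[OF bl] bilinear_rmul[OF bl]
          bilinear_ladd[OF sp(1)] bilinear_radd[OF sp(1)] bilinear_lmul[OF sp(1)] bilinear_rmul[OF sp(1)] algebra_simps)
    have kK: "K y x = - K x y" for x y unfolding K_def bracket_tensors_skew[OF L, of y x] sp(2)[of y x] by simp
    have sK: "swp K x y = (-2) *\<^sub>R K x y" for x y
    proof -
      have "complexify (swp K) x y = (-2) *s complexify K x y"
        unfolding complexify_swp[symmetric] c by (rule swp_components(4)[OF mem(3)])
      then have "complexify (swp K) x y = complexify (\<lambda>x y. (-2) *\<^sub>R K x y) x y" by (simp add: complexify_def vec_eq_iff)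
      then show ?thesis by (simp only: complexify_inj)
    qed
    have h2: "hypersurface_bracket K" by (rule unitary_imp_hypersurface_bracket[OF bK kK sK])
    have "hypersurface_bracket (\<lambda>x y. Lambda2E_part L x y + K x y)" by (rule hypersurface_bracket_add[OF h1 h2])
    then have "hypersurface_bracket L" by (simp add: K_def)
    with n show False ..
  qed
  with mem dec show "nontrivial_component_S2H_S4H L" unfolding nontrivial_component_S2H_S4H_def
    by (intro bexI[of _ a] bexI[of _ b] bexI[of _ c] bexI[of _ d] conjI)
qed

section \<open>Curvature, hypersurfaces and contact structures\<close>

theorem theorem4p4:
  fixes L :: "'m::finite Usp \<Rightarrow> 'm Usp \<Rightarrow> real^3" and n :: nat
  assumes "n > 1" and "CARD('m) = n - 1"
    and "L \<in> bracket_tensors"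
  shows "(ess_curvature_nonzero (heis_structure L) \<longleftrightarrow> nontrivial_component_S2H_S4H L) \<and>
    (ess_curvature_nonzero (heis_structure L) \<longrightarrow>
       \<not> (\<exists>(\<A> :: ('p::{t2_space, second_countable_topology}, 'm) chart set) Q N f.
            quaternionic_manifold \<A> Q \<and> N \<noteq> {} \<and> immersion_on \<A> N f \<and>
            induced_on \<A> Q N f (heis_structure L)) \<and>
       \<not> quaternionic_contact (heis_structure L)) \<and>
    (\<exists>P :: real \<Rightarrow> 'm gstruct.
       smooth_family P \<and> (\<forall>t\<ge>0. almost_CR_quaternionic (P t)) \<and>
       (\<forall>t\<ge>0. isomorphic (P t) (heis_structure L_std) \<longleftrightarrow> t = 0))"
proof (intro conjI impI)
  show "ess_curvature_nonzero (heis_structure L) \<longleftrightarrow> nontrivial_component_S2H_S4H L"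
    unfolding ess_curvature_nonzero_iff[OF assms(3)] nontrivial_component_iff[OF assms(3)] ..
next
  assume "ess_curvature_nonzero (heis_structure L)"
  then have n: "\<not> hypersurface_bracket L" unfolding ess_curvature_nonzero_iff[OF assms(3)] .
  show "\<not> quaternionic_contact (heis_structure L)"
    using n quaternionic_contact_imp_hypersurface_bracket[OF assms(3)] by (rule contrapos_nn)
  show "\<not> (\<exists>(\<A> :: ('p::{t2_space, second_countable_topology}, 'm) chart set) Q N f.
            quaternionic_manifold \<A> Q \<and> N \<noteq> {} \<and> immersion_on \<A> N f \<and> induced_on \<A> Q N f (heis_structure L))"
    by (intro notI, elim exE conjE) (rule n[THEN notE], rule induced_imp_hypersurface_bracket[OF assms(3)])
next
  show "\<exists>P :: real \<Rightarrow> 'm gstruct. smooth_family P \<and> (\<forall>t\<ge>0. almost_CR_quaternionic (P t)) \<and>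
       (\<forall>t\<ge>0. isomorphic (P t) (heis_structure L_std) \<longleftrightarrow> t = 0)"
    by (rule exI[of _ "\<lambda>t. heis_structure (stretched_bracket t)"]) (intro conjI allI impI stretched_family)
qed

end
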